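(* Let $X$ be an orbispace such that for every basic open set $U$ of $X$ the group $G_U$ is finite and the space $\widehat U$ is a $T_1$ space. Then the fixed-point set of the canonical $S^1$-action on the free loop space $\mathcal LX$ can be identified with $$\widetilde X:=\{(p,(g)_{G_p})\mid p\in X,\ g\in G_p\},$$ where $G_p$ is the isotropy group of $p$ and $(g)_{G_p}$ is the conjugacy class of $g$ in $G_p$.
   Context: **Orbispaces.** All spaces are locally connected. A $G$-structure on a connected, locally connected space $U$ is a triple $(\widehat U,G_U,\pi_U)$ where $\widehat U$ is a connected, locally connected space with a continuous (not necessarily effective) left action of a topological group $G_U$ and $\pi_U:\widehat U\to U$ is continuous and induces a homeomorphism $\widehat U/G_U\cong U$. An isomorphism of $G$-structures on $U$ is a pair $(\phi,\lambda)$, $\lambda$ an isomorphism of the groups, $\phi$ a $\lambda$-equivariant homeomorphism commuting with the projections to $U$. Each $g\in G_U$ is viewed as the automorphism $(x\mapsto g\cdot x,\ h\mapsto ghg^{-1})$; by convention the automorphism group is $G_U$ (distinct elements are distinct automorphisms). For a connected open $W\subset U$, each component $\widehat W$ of $\pi_U^{-1}(W)$ with $G_W=\{g\in G_U: g\widehat W=\widehat W\}$ and $\pi_U|_{\widehat W}$ is a $G$-structure on $W$ induced from that of $U$. An orbispace structure on a locally connected space $X$ is a base $\mathcal U$ of connected open sets (basic open sets), each with a $G$-structure, and for $U_\alpha\cap U_\beta\neq\emptyset$ a nonempty set $Tran(U_\alpha,U_\beta)$ of transition maps, such that: (a) each transition map is an isomorphism $(\phi,\lambda)$ from a $G$-structure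 of a component of $U_\alpha\cap U_\beta$ induced from $U_\alpha$ to one of the same component induced from $U_\beta$; (b) two transition maps over the same component satisfy $\xi_2=g_\beta^{-1}\circ\xi_1\circ g_\alpha$ for some $g_\alpha\in G_{U_\alpha}$, $g_\beta\in G_{U_\beta}$; all such composites are in $Tran(U_\alpha,U_\beta)$, and $g_\beta^{-1}\circ(\phi,\lambda)\circ g_\alpha$ equals $(\phi,\lambda)$ as an element iff $\lambda(g_\alpha)=g_\beta$; (c) the identity is in $Tran(U,U)$, so $Tran(U,U)=G_U$; (d) if $U_\alpha\cap U_\beta\cap U_\gamma\ne\emptyset$, $\xi\in Tran(U_\alpha,U_\beta)$, $\eta\in Tran(U_\beta,U_\gamma)$ and the range of $\xi$ meets the domain of $\eta$, a composition $\eta\circ\xi\in Tran(U_\alpha,U_\gamma)$ is given whose restriction to $\pi_{U_\alpha}^{-1}(U_\alpha\cap U_\beta\cap U_\gamma)$ is the composition as maps; composition is associative and agrees with that of (b) when $\alpha=\beta$ or $\beta=\gamma$. $Tran(U_\alpha,U_\beta)$ is topologized via the groups $G_{U_\alpha},G_{U_\beta}$. $\mathcal U$ is always enlarged by all connected open subsets of basic open sets (with chosen induced $G$-structures and restricted transition maps). The isotropy group $G_p$ of $p\in U$ is the stabilizer in $G_U$ of a point of $\pi_U^{-1}(p)$ (well defined up to isomorphism). **Free loops.** A free loop in $X$ is a morphism from $S^1=[0,1]/\{0\sim1\}$ (trivial orbispace structure) to $X$: an equivalence class of systems $(\{I_i\},\{U_i\},\{\gamma_i\},\{\xi_{ji}\})$,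 $i=0,\dots,n$, with $I_i$ open intervals covering $S^1$ (only cyclically consecutive ones meeting), $U_i$ basic open sets, $\gamma_i:I_i\to\widehat{U_i}$ continuous, $\xi_{ji}\in Tran(U_i,U_j)$ for consecutive $i,j$ with $\gamma_j=\xi_{ji}\circ\gamma_i$ on $I_i\cap I_j$. Isomorphism: $\gamma_i\mapsto\delta_i\gamma_i$, $\xi_{ji}\mapsto\delta_j\xi_{ji}\delta_i^{-1}$ with $\delta_i\in G_{U_i}$; refinement: $J_k\subset I_{\theta(k)}$, $g_k=\jmath_k^{-1}\circ\gamma_{\theta(k)}|_{J_k}$, $\eta_{lk}=\jmath_l^{-1}\circ\xi_{\theta(l)\theta(k)}\circ\jmath_k$, $\jmath_k\in Tran(V_k,U_{\theta(k)})$; two systems are equivalent if they have isomorphic refinements. $\mathcal LX$ is the set of free loops with the compact-open topology; $S^1$ acts canonically by rotating the domain. $(p,(g)_{G_p})$ corresponds to the free loop given by the constant map to $\hat p\in\pi_U^{-1}(p)$ closed up by $g\in G_{\hat p}$. *)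

theory Defs
  imports "HOL-Analysis.Analysis" "HOL-Algebra.Group_Action"
begin

section \<open>G-structures\<close>

definition topological_group :: "'g monoid \<Rightarrow> 'g topology \<Rightarrow> bool" where
  "topological_group G T \<longleftrightarrow>
     group G \<and> topspace T = carrier G \<and>
     continuous_map (prod_topology T T) T (\<lambda>(g, h). g \<otimes>\<^bsub>G\<^esub> h) \<and>
     continuous_map T T (\<lambda>g. inv\<^bsub>G\<^esub> g)"

text \<open>The quotient topology on the set of orbits.\<close>

definition orbit_space :: "'y topology \<Rightarrow> 'g monoid \<Rightarrow> ('g \<Rightarrow> 'y \<Rightarrow> 'y) \<Rightarrow> 'y set topology" where
  "orbit_space E G \<phi> =
     topology (\<lambda>\<V>. \<V> \<subseteq> orbits G (topspace E) \<phi> \<and>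
                   openin E {x \<in> topspace E. orbit G \<phi> x \<in> \<V>})"

lemma openin_orbit_space:
  "openin (orbit_space E G \<phi>) \<V> \<longleftrightarrow>
     \<V> \<subseteq> orbits G (topspace E) \<phi> \<and> openin E {x \<in> topspace E. orbit G \<phi> x \<in> \<V>}"
proof -
  have "istopology (\<lambda>\<V>. \<V> \<subseteq> orbits G (topspace E) \<phi> \<and>
                   openin E {x \<in> topspace E. orbit G \<phi> x \<in> \<V>})"
    unfolding istopology_def
  proof (rule conjI; intro allI impI conjI)
    fix A B
    assume "A \<subseteq> orbits G (topspace E) \<phi> \<and> openin E {x \<in> topspace E. orbit G \<phi> x \<in> A}"
      and "B \<subseteq> orbits G (topspace E) \<phi> \<and> openin E {x \<in> topspace E. orbit G \<phi> x \<in> B}"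
    moreover have "{x \<in> topspace E. orbit G \<phi> x \<in> A \<inter> B} =
        {x \<in> topspace E. orbit G \<phi> x \<in> A} \<inter> {x \<in> topspace E. orbit G \<phi> x \<in> B}" by auto
    ultimately show "A \<inter> B \<subseteq> orbits G (topspace E) \<phi>"
      and "openin E {x \<in> topspace E. orbit G \<phi> x \<in> A \<inter> B}" by auto
  next
    fix \<K>
    assume *: "\<forall>K\<in>\<K>. K \<subseteq> orbits G (topspace E) \<phi> \<and> openin E {x \<in> topspace E. orbit G \<phi> x \<in> K}"
    then show "\<Union>\<K> \<subseteq> orbits G (topspace E) \<phi>" by blast
    have "{x \<in> topspace E. orbit G \<phi> x \<in> \<Union>\<K>} =
        (\<Union>K\<in>\<K>. {x \<in> topspace E. orbit G \<phi> x \<in> K})" by auto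
    with * show "openin E {x \<in> topspace E. orbit G \<phi> x \<in> \<Union>\<K>}" by auto
  qed
  then show ?thesis by (simp add: orbit_space_def topology_inverse')
qed

record ('x, 'y, 'g) gstr =
  cover :: "'y topology"
  sgroup :: "'g monoid"
  gtop :: "'g topology"
  act :: "'g \<Rightarrow> 'y \<Rightarrow> 'y"
  proj :: "'y \<Rightarrow> 'x"

text \<open>
  \<^const>\<open>group_action\<close> asks each \<^term>\<open>act S g\<close> to be an extensional function on the underlying
  set of the cover; this only fixes values outside the cover.
\<close>

definition g_structure :: "'x topology \<Rightarrow> ('x, 'y, 'g) gstr \<Rightarrow> bool" where
  "g_structure U S \<longleftrightarrow>
     connected_space U \<and> locally_connected_space U \<and>
     connected_space (cover S) \<and> locally_connected_space (cover S) \<and>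
     topological_group (sgroup S) (gtop S) \<and>
     group_action (sgroup S) (topspace (cover S)) (act S) \<and>
     continuous_map (prod_topology (gtop S) (cover S)) (cover S) (\<lambda>(g, x). act S g x) \<and>
     continuous_map (cover S) U (proj S) \<and>
     (\<exists>f. homeomorphic_map (orbit_space (cover S) (sgroup S) (act S)) U f \<and>
          (\<forall>x \<in> topspace (cover S). f (orbit (sgroup S) (act S) x) = proj S x))"

definition set_stabilizer :: "('x, 'y, 'g) gstr \<Rightarrow> 'y set \<Rightarrow> 'g set" where
  "set_stabilizer S W = {g \<in> carrier (sgroup S). act S g ` W = W}"

text \<open>The induced structure; \<open>W\<close> is meant to be a component of the preimage of a connected open
  subset of the base.\<close>

definition induced :: "('x, 'y, 'g) gstr \<Rightarrow> 'y set \<Rightarrow> ('x, 'y, 'g) gstr" where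
  "induced S W =
     \<lparr> cover = subtopology (cover S) W,
       sgroup = (sgroup S)\<lparr>carrier := set_stabilizer S W\<rparr>,
       gtop = subtopology (gtop S) (set_stabilizer S W),
       act = (\<lambda>g. restrict (act S g) W),
       proj = proj S \<rparr>"

definition gstr_iso ::
  "('x, 'y, 'g) gstr \<Rightarrow> ('x, 'y, 'g) gstr \<Rightarrow> ('y \<Rightarrow> 'y) \<Rightarrow> ('g \<Rightarrow> 'g) \<Rightarrow> bool" where
  "gstr_iso S T \<phi> \<kappa> \<longleftrightarrow>
     homeomorphic_map (cover S) (cover T) \<phi> \<and>
     \<kappa> \<in> iso (sgroup S) (sgroup T) \<and> homeomorphic_map (gtop S) (gtop T) \<kappa> \<and>
     (\<forall>g \<in> carrier (sgroup S). \<forall>x \<in> topspace (cover S). \<phi> (act S g x) = act T (\<kappa> g) (\<phi> x)) \<and>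
     (\<forall>x \<in> topspace (cover S). proj T (\<phi> x) = proj S x)"


section \<open>Orbispaces\<close>

text \<open>
  Elements of \<^term>\<open>Tran X a b\<close> are abstract: distinct ones may have the same underlying
  isomorphism \<open>(tmap, thom)\<close>, because the groups need not act effectively. \<^term>\<open>tdom X a b \<xi>\<close> is
  the cover of the \<open>G\<close>-structure on which \<open>\<xi>\<close> is defined, and \<^term>\<open>aut X U\<close> identifies the group
  of \<open>U\<close> with \<^term>\<open>Tran X U U\<close>.

  \<^term>\<open>tcomp X a b c \<eta> \<xi> x\<close> is the composite of \<open>\<xi>\<close> (from \<open>a\<close> to \<open>b\<close>) and \<open>\<eta>\<close> (from \<open>b\<close> to \<open>c\<close>)
  near the point \<open>x\<close>. The point is needed because the set where \<open>\<eta>\<close> after \<open>\<xi>\<close> is defined can meet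
  several components of the preimage of \<open>a \<inter> c\<close>, whereas every transition map lives over a
  single component; a single composite then cannot restrict to the composite map everywhere.
\<close>

record ('x, 'y, 'g, 't) orbi =
  space_of :: "'x topology"
  basic :: "'x set set"
  gstr :: "'x set \<Rightarrow> ('x, 'y, 'g) gstr"
  Tran :: "'x set \<Rightarrow> 'x set \<Rightarrow> 't set"
  tdom :: "'x set \<Rightarrow> 'x set \<Rightarrow> 't \<Rightarrow> 'y set"
  tmap :: "'x set \<Rightarrow> 'x set \<Rightarrow> 't \<Rightarrow> 'y \<Rightarrow> 'y"
  thom :: "'x set \<Rightarrow> 'x set \<Rightarrow> 't \<Rightarrow> 'g \<Rightarrow> 'g"
  aut :: "'x set \<Rightarrow> 'g \<Rightarrow> 't"
  tcomp :: "'x set \<Rightarrow> 'x set \<Rightarrow> 'x set \<Rightarrow> 't \<Rightarrow> 't \<Rightarrow> 'y \<Rightarrow> 't"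

abbreviation hat :: "('x, 'y, 'g, 't) orbi \<Rightarrow> 'x set \<Rightarrow> 'y topology" where
  "hat X U \<equiv> cover (gstr X U)"

abbreviation grp :: "('x, 'y, 'g, 't) orbi \<Rightarrow> 'x set \<Rightarrow> 'g monoid" where
  "grp X U \<equiv> sgroup (gstr X U)"

abbreviation hact :: "('x, 'y, 'g, 't) orbi \<Rightarrow> 'x set \<Rightarrow> 'g \<Rightarrow> 'y \<Rightarrow> 'y" where
  "hact X U \<equiv> act (gstr X U)"

abbreviation hproj :: "('x, 'y, 'g, 't) orbi \<Rightarrow> 'x set \<Rightarrow> 'y \<Rightarrow> 'x" where
  "hproj X U \<equiv> proj (gstr X U)"

definition lift_components :: "('x, 'y, 'g, 't) orbi \<Rightarrow> 'x set \<Rightarrow> 'x set \<Rightarrow> 'y set set" where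
  "lift_components X U W =
     connected_components_of (subtopology (hat X U) {x \<in> topspace (hat X U). hproj X U x \<in> W})"

definition transition_over ::
  "('x, 'y, 'g, 't) orbi \<Rightarrow> 'x set \<Rightarrow> 'x set \<Rightarrow> 't \<Rightarrow> 'x set \<Rightarrow> bool" where
  "transition_over X a b \<xi> W \<longleftrightarrow>
     tdom X a b \<xi> \<in> lift_components X a W \<and>
     tmap X a b \<xi> ` tdom X a b \<xi> \<in> lift_components X b W \<and>
     gstr_iso (induced (gstr X a) (tdom X a b \<xi>))
              (induced (gstr X b) (tmap X a b \<xi> ` tdom X a b \<xi>))
              (tmap X a b \<xi>) (thom X a b \<xi>)"

definition composable_at ::
  "('x, 'y, 'g, 't) orbi \<Rightarrow> 'x set \<Rightarrow> 'x set \<Rightarrow> 'x set \<Rightarrow> 't \<Rightarrow> 't \<Rightarrow> 'y set" where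
  "composable_at X a b c \<eta> \<xi> = {x \<in> tdom X a b \<xi>. tmap X a b \<xi> x \<in> tdom X b c \<eta>}"

text \<open>The composite of \<open>g\<close>, then \<open>\<xi>\<close>, then the inverse of \<open>h\<close>. It does not depend on the point
  \<open>x\<close>, by the local constancy of \<^const>\<open>tcomp\<close>.\<close>

definition twist ::
  "('x, 'y, 'g, 't) orbi \<Rightarrow> 'x set \<Rightarrow> 'x set \<Rightarrow> 'g \<Rightarrow> 't \<Rightarrow> 'g \<Rightarrow> 'y \<Rightarrow> 't" where
  "twist X a b h \<xi> g x =
     tcomp X a b b (aut X b (inv\<^bsub>grp X b\<^esub> h)) (tcomp X a a b \<xi> (aut X a g) x) x"

locale orbispace =
  fixes X :: "('x, 'y, 'g, 't) orbi"
  assumes locally_connected: "locally_connected_space (space_of X)"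
    and basic_base: "openin (space_of X) = arbitrary union_of (\<lambda>U. U \<in> basic X)"
    and basic_connected:
      "\<And>U. U \<in> basic X \<Longrightarrow> U \<noteq> {} \<and> openin (space_of X) U \<and> connectedin (space_of X) U"
    and basic_enlarged:
      "\<And>U W. \<lbrakk> U \<in> basic X; W \<subseteq> U; W \<noteq> {}; openin (space_of X) W; connectedin (space_of X) W \<rbrakk>
         \<Longrightarrow> W \<in> basic X"
    and basic_g_structure:
      "\<And>U. U \<in> basic X \<Longrightarrow> g_structure (subtopology (space_of X) U) (gstr X U)"
    and Tran_nonempty:
      "\<And>a b. \<lbrakk> a \<in> basic X; b \<in> basic X; a \<inter> b \<noteq> {} \<rbrakk> \<Longrightarrow> Tran X a b \<noteq> {}"
    and Tran_iso:
      "\<And>a b \<xi>. \<lbrakk> a \<in> basic X; b \<in> basic X; \<xi> \<in> Tran X a b \<rbrakk> \<Longrightarrow>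
         \<exists>W \<in> connected_components_of (subtopology (space_of X) (a \<inter> b)). transition_over X a b \<xi> W"
    \<comment> \<open>Two-sided action of the groups; closure under it is part of \<open>tcomp_map\<close>.\<close>
    and Tran_transitive:
      "\<And>a b \<xi> \<xi>' W. \<lbrakk> a \<in> basic X; b \<in> basic X; \<xi> \<in> Tran X a b; \<xi>' \<in> Tran X a b;
          W \<in> connected_components_of (subtopology (space_of X) (a \<inter> b));
          transition_over X a b \<xi> W; transition_over X a b \<xi>' W \<rbrakk> \<Longrightarrow>
         \<exists>g \<in> carrier (grp X a). \<exists>h \<in> carrier (grp X b). \<forall>x \<in> tdom X a b \<xi>'.
           hact X a g x \<in> tdom X a b \<xi> \<and> \<xi>' = twist X a b h \<xi> g x"
    and twist_eq_iff:
      "\<And>a b \<xi> g h x. \<lbrakk> a \<in> basic X; b \<in> basic X; \<xi> \<in> Tran X a b;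
          g \<in> carrier (grp X a); h \<in> carrier (grp X b);
          x \<in> topspace (hat X a); hact X a g x \<in> tdom X a b \<xi> \<rbrakk> \<Longrightarrow>
         twist X a b h \<xi> g x = \<xi> \<longleftrightarrow>
           g \<in> set_stabilizer (gstr X a) (tdom X a b \<xi>) \<and> thom X a b \<xi> g = h"
    \<comment> \<open>Group elements as automorphisms.\<close>
    and aut_bij: "\<And>U. U \<in> basic X \<Longrightarrow> bij_betw (aut X U) (carrier (grp X U)) (Tran X U U)"
    and aut_map:
      "\<And>U g. \<lbrakk> U \<in> basic X; g \<in> carrier (grp X U) \<rbrakk> \<Longrightarrow>
         tdom X U U (aut X U g) = topspace (hat X U) \<and>
         (\<forall>x \<in> topspace (hat X U). tmap X U U (aut X U g) x = hact X U g x) \<and>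
         (\<forall>h \<in> carrier (grp X U).
            thom X U U (aut X U g) h = g \<otimes>\<^bsub>grp X U\<^esub> h \<otimes>\<^bsub>grp X U\<^esub> inv\<^bsub>grp X U\<^esub> g)"
    and aut_mult:
      "\<And>U g h x. \<lbrakk> U \<in> basic X; g \<in> carrier (grp X U); h \<in> carrier (grp X U);
          x \<in> topspace (hat X U) \<rbrakk> \<Longrightarrow>
         tcomp X U U U (aut X U g) (aut X U h) x = aut X U (g \<otimes>\<^bsub>grp X U\<^esub> h)"
    \<comment> \<open>Composition.\<close>
    and tcomp_map:
      "\<And>a b c \<xi> \<eta> x. \<lbrakk> a \<in> basic X; b \<in> basic X; c \<in> basic X; \<xi> \<in> Tran X a b; \<eta> \<in> Tran X b c;
          x \<in> composable_at X a b c \<eta> \<xi> \<rbrakk> \<Longrightarrow>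
         tcomp X a b c \<eta> \<xi> x \<in> Tran X a c \<and>
         x \<in> tdom X a c (tcomp X a b c \<eta> \<xi> x) \<and>
         tmap X a c (tcomp X a b c \<eta> \<xi> x) x = tmap X b c \<eta> (tmap X a b \<xi> x)"
    and tcomp_locally_constant:
      "\<And>a b c \<xi> \<eta> C x y. \<lbrakk> a \<in> basic X; b \<in> basic X; c \<in> basic X; \<xi> \<in> Tran X a b; \<eta> \<in> Tran X b c;
          C \<in> connected_components_of (subtopology (hat X a) (composable_at X a b c \<eta> \<xi>));
          x \<in> C; y \<in> C \<rbrakk> \<Longrightarrow>
         tcomp X a b c \<eta> \<xi> x = tcomp X a b c \<eta> \<xi> y"
    and tcomp_hom:
      "\<And>a b c \<xi> \<eta> C x g. \<lbrakk> a \<in> basic X; b \<in> basic X; c \<in> basic X; \<xi> \<in> Tran X a b; \<eta> \<in> Tran X b c;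
          C \<in> connected_components_of (subtopology (hat X a) (composable_at X a b c \<eta> \<xi>));
          x \<in> C; g \<in> set_stabilizer (gstr X a) C \<rbrakk> \<Longrightarrow>
         thom X a c (tcomp X a b c \<eta> \<xi> x) g = thom X b c \<eta> (thom X a b \<xi> g)"
    and tcomp_assoc:
      "\<And>a b c d \<xi> \<eta> \<zeta> x. \<lbrakk> a \<in> basic X; b \<in> basic X; c \<in> basic X; d \<in> basic X;
          \<xi> \<in> Tran X a b; \<eta> \<in> Tran X b c; \<zeta> \<in> Tran X c d;
          x \<in> composable_at X a b c \<eta> \<xi>; tmap X a b \<xi> x \<in> composable_at X b c d \<zeta> \<eta> \<rbrakk> \<Longrightarrow>
         tcomp X a b d (tcomp X b c d \<zeta> \<eta> (tmap X a b \<xi> x)) \<xi> x =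
         tcomp X a c d \<zeta> (tcomp X a b c \<eta> \<xi> x) x"


section \<open>Free loops\<close>

text \<open>The circle is the unit circle of the complex plane, \<open>t \<mapsto> circ t\<close> identifying it with
  \<open>[0,1]\<close> modulo \<open>0 \<sim> 1\<close>.\<close>

definition circ :: "real \<Rightarrow> complex" where
  "circ t = cis (2 * pi * t)"

abbreviation circle :: "complex set" where
  "circle \<equiv> sphere 0 1"

definition open_arc :: "complex set \<Rightarrow> bool" where
  "open_arc I \<longleftrightarrow> (\<exists>a b. a < b \<and> b \<le> a + 1 \<and> I = circ ` {a<..<b})"

definition cyclic_next :: "nat \<Rightarrow> nat \<Rightarrow> nat" where
  "cyclic_next n i = (if i = n then 0 else Suc i)"

text \<open>At least three arcs are used so that consecutive ones can meet in a single arc; one transition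
  map then suffices for each pair. For exactly three arcs every pair is consecutive, and the clause
  on triples is what keeps the transition maps free of a cocycle condition.\<close>

definition cyclic_cover :: "nat \<Rightarrow> (nat \<Rightarrow> complex set) \<Rightarrow> bool" where
  "cyclic_cover n I \<longleftrightarrow>
     2 \<le> n \<and> (\<forall>i\<le>n. open_arc (I i)) \<and> (\<Union>i\<le>n. I i) = circle \<and>
     (\<forall>i\<le>n. open_arc (I i \<inter> I (cyclic_next n i))) \<and>
     (\<forall>i\<le>n. \<forall>j\<le>n. i \<noteq> j \<and> j \<noteq> cyclic_next n i \<and> i \<noteq> cyclic_next n j \<longrightarrow> I i \<inter> I j = {}) \<and>
     (\<forall>i\<le>n. \<forall>j\<le>n. \<forall>k\<le>n. i \<noteq> j \<and> j \<noteq> k \<and> i \<noteq> k \<longrightarrow> I i \<inter> I j \<inter> I k = {})"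

text \<open>\<^term>\<open>gl s j i\<close> is the transition map from the chart of index \<open>i\<close> to that of index \<open>j\<close>. Only
  indices \<open>\<le> top_index s\<close>, points of the arcs, and pairs of meeting arcs are relevant.\<close>

record ('x, 'y, 't) loop_system =
  top_index :: nat
  arc :: "nat \<Rightarrow> complex set"
  chart :: "nat \<Rightarrow> 'x set"
  lft :: "nat \<Rightarrow> complex \<Rightarrow> 'y"
  gl :: "nat \<Rightarrow> nat \<Rightarrow> 't"

definition meets :: "('x, 'y, 't) loop_system \<Rightarrow> nat \<Rightarrow> nat \<Rightarrow> bool" where
  "meets s i j \<longleftrightarrow> i \<le> top_index s \<and> j \<le> top_index s \<and> arc s i \<inter> arc s j \<noteq> {}"

text \<open>The pair \<open>(i, i)\<close> carries the identity and \<open>(j, i)\<close>, \<open>(i, j)\<close> carry mutually inverse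
  transition maps, so that the index map
  of a refinement may repeat or reverse indices.\<close>

definition is_loop_system ::
  "('x, 'y, 'g, 't) orbi \<Rightarrow> ('x, 'y, 't) loop_system \<Rightarrow> bool" where
  "is_loop_system X s \<longleftrightarrow>
     cyclic_cover (top_index s) (arc s) \<and>
     (\<forall>i \<le> top_index s. chart s i \<in> basic X \<and>
        continuous_map (top_of_set (arc s i)) (hat X (chart s i)) (lft s i) \<and>
        gl s i i = aut X (chart s i) \<one>\<^bsub>grp X (chart s i)\<^esub>) \<and>
     (\<forall>i j. meets s i j \<longrightarrow>
        gl s j i \<in> Tran X (chart s i) (chart s j) \<and>
        (\<forall>t \<in> arc s i \<inter> arc s j.
           lft s i t \<in> tdom X (chart s i) (chart s j) (gl s j i) \<and>
           lft s j t = tmap X (chart s i) (chart s j) (gl s j i) (lft s i t) \<and>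
           tcomp X (chart s i) (chart s j) (chart s i) (gl s i j) (gl s j i) (lft s i t)
             = aut X (chart s i) \<one>\<^bsub>grp X (chart s i)\<^esub>))"

definition loop_systems :: "('x, 'y, 'g, 't) orbi \<Rightarrow> ('x, 'y, 't) loop_system set" where
  "loop_systems X = {s. is_loop_system X s}"

definition loop_iso ::
  "('x, 'y, 'g, 't) orbi \<Rightarrow> ('x, 'y, 't) loop_system \<Rightarrow> ('x, 'y, 't) loop_system \<Rightarrow> bool" where
  "loop_iso X s s' \<longleftrightarrow>
     top_index s' = top_index s \<and>
     (\<forall>i \<le> top_index s. arc s' i = arc s i \<and> chart s' i = chart s i) \<and>
     (\<exists>\<delta>. (\<forall>i \<le> top_index s. \<delta> i \<in> carrier (grp X (chart s i)) \<and>
             (\<forall>t \<in> arc s i. lft s' i t = hact X (chart s i) (\<delta> i) (lft s i t))) \<and>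
          (\<forall>i j. meets s i j \<longrightarrow> (\<forall>t \<in> arc s i \<inter> arc s j.
             gl s' j i =
               tcomp X (chart s i) (chart s j) (chart s j) (aut X (chart s j) (\<delta> j))
                 (tcomp X (chart s i) (chart s i) (chart s j) (gl s j i)
                    (aut X (chart s i) (inv\<^bsub>grp X (chart s i)\<^esub> (\<delta> i))) (lft s' i t))
                 (lft s' i t))))"

text \<open>\<open>s'\<close> refines \<open>s\<close>. The formula \<open>\<gamma>' k = (\<iota> k)\<inverse> \<circ> \<gamma> (\<theta> k)\<close> is written as
  \<open>\<iota> k \<circ> \<gamma>' k = \<gamma> (\<theta> k)\<close>, and likewise for the transition maps.\<close>

definition loop_refines ::
  "('x, 'y, 'g, 't) orbi \<Rightarrow> ('x, 'y, 't) loop_system \<Rightarrow> ('x, 'y, 't) loop_system \<Rightarrow> bool" where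
  "loop_refines X s' s \<longleftrightarrow>
     (\<exists>\<theta> \<iota>.
        (\<forall>k \<le> top_index s'. \<theta> k \<le> top_index s \<and> arc s' k \<subseteq> arc s (\<theta> k) \<and>
           \<iota> k \<in> Tran X (chart s' k) (chart s (\<theta> k)) \<and>
           (\<forall>t \<in> arc s' k.
              lft s' k t \<in> tdom X (chart s' k) (chart s (\<theta> k)) (\<iota> k) \<and>
              tmap X (chart s' k) (chart s (\<theta> k)) (\<iota> k) (lft s' k t) = lft s (\<theta> k) t)) \<and>
        (\<forall>k l. meets s' k l \<longrightarrow> (\<forall>t \<in> arc s' k \<inter> arc s' l.
           tcomp X (chart s' k) (chart s' l) (chart s (\<theta> l)) (\<iota> l) (gl s' l k) (lft s' k t) =
           tcomp X (chart s' k) (chart s (\<theta> k)) (chart s (\<theta> l))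
             (gl s (\<theta> l) (\<theta> k)) (\<iota> k) (lft s' k t))))"

definition loop_rel ::
  "('x, 'y, 'g, 't) orbi \<Rightarrow> (('x, 'y, 't) loop_system \<times> ('x, 'y, 't) loop_system) set" where
  "loop_rel X =
     {(s, u). s \<in> loop_systems X \<and> u \<in> loop_systems X \<and>
        (\<exists>s' \<in> loop_systems X. \<exists>u' \<in> loop_systems X.
           loop_refines X s' s \<and> loop_refines X u' u \<and> loop_iso X s' u')}"

definition free_loops :: "('x, 'y, 'g, 't) orbi \<Rightarrow> ('x, 'y, 't) loop_system set set" where
  "free_loops X = loop_systems X // loop_rel X"

definition free_loop ::
  "('x, 'y, 'g, 't) orbi \<Rightarrow> ('x, 'y, 't) loop_system \<Rightarrow> ('x, 'y, 't) loop_system set" where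
  "free_loop X s = loop_rel X `` {s}"

definition rotate_loop :: "complex \<Rightarrow> ('x, 'y, 't) loop_system \<Rightarrow> ('x, 'y, 't) loop_system" where
  "rotate_loop z s = s\<lparr> arc := (\<lambda>i. (\<lambda>w. z * w) ` arc s i), lft := (\<lambda>i w. lft s i (w / z)) \<rparr>"

definition rotation_fixed :: "('x, 'y, 'g, 't) orbi \<Rightarrow> ('x, 'y, 't) loop_system set set" where
  "rotation_fixed X = {L \<in> free_loops X. \<forall>z \<in> circle. rotate_loop z ` L = L}"


section \<open>Points with a conjugacy class of their isotropy group\<close>

definition conj_class :: "'g monoid \<Rightarrow> 'g \<Rightarrow> 'g set" where
  "conj_class G g = {h \<otimes>\<^bsub>G\<^esub> g \<otimes>\<^bsub>G\<^esub> inv\<^bsub>G\<^esub> h | h. h \<in> carrier G}"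

definition isotropy :: "('x, 'y, 'g, 't) orbi \<Rightarrow> 'x set \<Rightarrow> 'y \<Rightarrow> 'g monoid" where
  "isotropy X U y = (grp X U)\<lparr>carrier := stabilizer (grp X U) (hact X U) y\<rparr>"

text \<open>A choice of basic open sets \<open>U p\<close> around the points \<open>p\<close> and of lifts \<open>e p\<close> of \<open>p\<close> to their
  covers. It fixes the isotropy group of each point, which is otherwise only defined up to
  isomorphism.\<close>

definition lift_choice ::
  "('x, 'y, 'g, 't) orbi \<Rightarrow> ('x \<Rightarrow> 'x set) \<Rightarrow> ('x \<Rightarrow> 'y) \<Rightarrow> bool" where
  "lift_choice X U e \<longleftrightarrow>
     (\<forall>p \<in> topspace (space_of X).
        U p \<in> basic X \<and> e p \<in> topspace (hat X (U p)) \<and> hproj X (U p) (e p) = p)"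

definition inertia ::
  "('x, 'y, 'g, 't) orbi \<Rightarrow> ('x \<Rightarrow> 'x set) \<Rightarrow> ('x \<Rightarrow> 'y) \<Rightarrow> ('x \<times> 'g set) set" where
  "inertia X U e =
     {(p, conj_class (isotropy X (U p) (e p)) g) | p g.
        p \<in> topspace (space_of X) \<and> g \<in> carrier (isotropy X (U p) (e p))}"

text \<open>The constant map to \<open>y\<close> closed up by \<open>g\<close>: the arcs are the images of the intervals
  \<open>(0, 1/2)\<close>, \<open>(1/3, 5/6)\<close>, \<open>(2/3, 7/6)\<close>, and the last one is glued to the first by \<open>g\<close>.\<close>

definition constant_loop ::
  "('x, 'y, 'g, 't) orbi \<Rightarrow> 'x set \<Rightarrow> 'y \<Rightarrow> 'g \<Rightarrow> ('x, 'y, 't) loop_system" where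
  "constant_loop X U y g =
     \<lparr> top_index = 2,
       arc = (\<lambda>i. circ ` {real i / 3 <..< real i / 3 + 1 / 2}),
       chart = (\<lambda>i. U),
       lft = (\<lambda>i t. y),
       gl = (\<lambda>j i. if j = 0 \<and> i = 2 then aut X U g
                   else if j = 2 \<and> i = 0 then aut X U (inv\<^bsub>grp X U\<^esub> g)
                   else aut X U \<one>\<^bsub>grp X U\<^esub>) \<rparr>"

end

theory Submission
  imports Defs
begin

text \<open>
  Transition maps at points of charts form a groupoid: germs can be composed and inverted
  (\<open>inverse_germ\<close>), two points of charts are joined by a germ exactly if they lie over the same
  point of the space (\<open>germ_between\<close>, \<open>arrD\<close>), and the germs from a point to itself form its isotropy
  group (\<open>vertex_germ\<close>). A loop system is a cocycle in this groupoid with continuously moving points.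

  In this language the equivalence of loop systems needs no refinements. Two systems are equivalent iff
  there are germs from the points of one to the points of the other that are locally constant in the
  parameter and compatible with the gluing germs (\<open>loop_rel_iff\<close>). Such families can be composed and
  inverted, so that the relation is transitive. They yield a common refinement because their
  labels are constant on arcs that are short enough.

  Pull a system back to the real line. If its lifts are constant, it has a flat section: germs
  from a fixed point \<open>A\<close> to all points of the system, compatible with the gluing. Translation by \<open>1\<close>
  composes the section with an element \<open>g\<close> of the isotropy group of \<open>A\<close>, the holonomy. The pair of \<open>A\<close>
  and \<open>g\<close> determines the equivalence class (\<open>equiv_of_same_holonomy\<close>), the class determines the pair up
  to conjugation by a germ (\<open>holonomy_unique\<close>), and the constant loop at \<open>A\<close> closed up by \<open>g\<close> has
  holonomy \<open>g\<close> (\<open>constant_loop_holonomy\<close>). Hence constant loops are classified by points of the space with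
  a conjugacy class in the isotropy group.

  Rotation only translates sections, so it preserves holonomy, and constant loops are fixed. Conversely,
  equivalent systems have the same underlying loop in the space. If a loop is fixed by all
  rotations, its underlying loop is therefore constant, and the lifts on an arc lie in one fibre. The
  fibre is an orbit of a finite group in a \<open>T\<^sub>1\<close> space, hence discrete, so the lifts are constant
  (\<open>rotation_fixed_const_lifts\<close>) and the loop has a holonomy.
\<close>

section \<open>The groupoid of transition germs\<close>

text \<open>A germ is an arrow between points of charts: its source and target are a basic open set together
  with a point of its cover, its label is a transition map. The source point has to be recorded,
  since the same transition map gives different arrows at different points and composites of
  transition maps depend on the point where they are formed.\<close>

datatype ('o, 't) germ = Germ (src: 'o) (label: 't) (trg: 'o)

context orbispace
begin

definition point :: "'x set \<times> 'y \<Rightarrow> bool" where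
  "point A \<longleftrightarrow> fst A \<in> basic X \<and> snd A \<in> topspace (hat X (fst A))"

definition foot :: "'x set \<times> 'y \<Rightarrow> 'x" where
  "foot A = hproj X (fst A) (snd A)"

definition arr :: "('x set \<times> 'y, 't) germ \<Rightarrow> bool" where
  "arr p \<longleftrightarrow>
     (case p of Germ (a, x) \<xi> (b, y) \<Rightarrow>
        a \<in> basic X \<and> b \<in> basic X \<and> \<xi> \<in> Tran X a b \<and> x \<in> tdom X a b \<xi> \<and> y = tmap X a b \<xi> x)"

definition comp :: "('x set \<times> 'y, 't) germ \<Rightarrow> ('x set \<times> 'y, 't) germ \<Rightarrow> ('x set \<times> 'y, 't) germ"
    (infixr "\<cdot>" 70) where
  "q \<cdot> p = Germ (src p)
     (tcomp X (fst (src p)) (fst (trg p)) (fst (trg q)) (label q) (label p) (snd (src p))) (trg q)"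

definition aut_germ :: "'x set \<times> 'y \<Rightarrow> 'g \<Rightarrow> ('x set \<times> 'y, 't) germ" where
  "aut_germ A g = Germ A (aut X (fst A) g) (fst A, hact X (fst A) g (snd A))"

definition unit :: "'x set \<times> 'y \<Rightarrow> ('x set \<times> 'y, 't) germ" where
  "unit A = Germ A (aut X (fst A) \<one>\<^bsub>grp X (fst A)\<^esub>) A"

definition inverse_germ :: "('x set \<times> 'y, 't) germ \<Rightarrow> ('x set \<times> 'y, 't) germ" where
  "inverse_germ p = (SOME q. arr q \<and> src q = trg p \<and> trg q = src p \<and> q \<cdot> p = unit (src p))"

lemma src_comp [simp]: "src (q \<cdot> p) = src p" and trg_comp [simp]: "trg (q \<cdot> p) = trg q"
  by (simp_all add: comp_def)

lemma src_unit [simp]: "src (unit A) = A" and trg_unit [simp]: "trg (unit A) = A"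
  by (simp_all add: unit_def)

lemma src_aut_germ [simp]: "src (aut_germ A g) = A"
  and trg_aut_germ: "trg (aut_germ A g) = (fst A, hact X (fst A) g (snd A))"
  by (simp_all add: aut_germ_def)

lemma chart_group: "a \<in> basic X \<Longrightarrow> group (grp X a)"
  using basic_g_structure unfolding g_structure_def topological_group_def by blast

lemma chart_action:
  "a \<in> basic X \<Longrightarrow> group_action (grp X a) (topspace (hat X a)) (hact X a)"
  using basic_g_structure unfolding g_structure_def by blast

lemma topspace_chart: "a \<in> basic X \<Longrightarrow> topspace (subtopology (space_of X) a) = a"
  using basic_connected by (metis openin_subset topspace_subtopology_subset)

lemma chart_proj_continuous:
  "a \<in> basic X \<Longrightarrow> continuous_map (hat X a) (subtopology (space_of X) a) (hproj X a)"
  using basic_g_structure unfolding g_structure_def by blast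

lemma chart_proj_in:
  "\<lbrakk> a \<in> basic X; x \<in> topspace (hat X a) \<rbrakk> \<Longrightarrow> hproj X a x \<in> a"
  using chart_proj_continuous topspace_chart
  by (metis continuous_map_image_subset_topspace image_subset_iff)

text \<open>The quotient homeomorphism makes the fibres of the projection the orbits of the chart group.\<close>

lemma chart_fibre:
  assumes "a \<in> basic X" "x \<in> topspace (hat X a)" "y \<in> topspace (hat X a)"
    "hproj X a x = hproj X a y"
  obtains g where "g \<in> carrier (grp X a)" "hact X a g x = y"
proof -
  interpret group_action "grp X a" "topspace (hat X a)" "hact X a"
    using chart_action assms(1) .
  have tops: "topspace (orbit_space (hat X a) (grp X a) (hact X a)) =
      orbits (grp X a) (topspace (hat X a)) (hact X a)" (is "topspace ?Q = ?O")
  proof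
    show "topspace ?Q \<subseteq> ?O"
      using openin_topspace[of ?Q] unfolding openin_orbit_space by blast
    have "{x \<in> topspace (hat X a). orbit (grp X a) (hact X a) x \<in> ?O} = topspace (hat X a)"
      unfolding orbits_def by blast
    then have "openin ?Q ?O"
      unfolding openin_orbit_space by simp
    then show "?O \<subseteq> topspace ?Q"
      by (rule openin_subset)
  qed
  obtain f where f: "homeomorphic_map ?Q (subtopology (space_of X) a) f"
    "\<And>x. x \<in> topspace (hat X a) \<Longrightarrow> f (orbit (grp X a) (hact X a) x) = hproj X a x"
    using basic_g_structure[OF assms(1)] unfolding g_structure_def by blast
  have "inj_on f ?O"
    using homeomorphic_imp_injective_map[OF f(1)] tops by simp
  moreover have "orbit (grp X a) (hact X a) x \<in> ?O" "orbit (grp X a) (hact X a) y \<in> ?O"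
    using assms unfolding orbits_def by blast+
  ultimately have "orbit (grp X a) (hact X a) x = orbit (grp X a) (hact X a) y"
    using f(2) assms by (metis inj_onD)
  then have "y \<in> orbit (grp X a) (hact X a) x"
    using orbit_refl assms(3) by blast
  then show thesis
    using that unfolding orbit_def by blast
qed

lemma chart_proj_surj:
  assumes "a \<in> basic X" "p \<in> a"
  obtains x where "x \<in> topspace (hat X a)" "hproj X a x = p"
proof -
  have tops: "topspace (orbit_space (hat X a) (grp X a) (hact X a)) \<subseteq>
      orbits (grp X a) (topspace (hat X a)) (hact X a)" (is "topspace ?Q \<subseteq> ?O")
    using openin_topspace[of ?Q] unfolding openin_orbit_space by blast
  obtain f where f: "homeomorphic_map ?Q (subtopology (space_of X) a) f"
    "\<And>x. x \<in> topspace (hat X a) \<Longrightarrow> f (orbit (grp X a) (hact X a) x) = hproj X a x"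
    using basic_g_structure[OF assms(1)] unfolding g_structure_def by blast
  have "p \<in> f ` topspace ?Q"
    using homeomorphic_imp_surjective_map[OF f(1)] topspace_chart assms by simp
  then obtain z where z: "z \<in> ?O" "f z = p"
    using tops by blast
  then show thesis
    using that f(2) unfolding orbits_def by auto
qed

lemma transition_domain:
  assumes "a \<in> basic X" "b \<in> basic X" "\<xi> \<in> Tran X a b"
  shows "openin (hat X a) (tdom X a b \<xi>)"
    and "continuous_map (subtopology (hat X a) (tdom X a b \<xi>)) (hat X b) (tmap X a b \<xi>)"
    and "x \<in> tdom X a b \<xi> \<Longrightarrow> hproj X b (tmap X a b \<xi> x) = hproj X a x"
proof -
  obtain W where W: "W \<in> connected_components_of (subtopology (space_of X) (a \<inter> b))"
    "transition_over X a b \<xi> W"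
    using Tran_iso[OF assms] by blast
  have "openin (space_of X) (a \<inter> b)"
    using assms(1,2) basic_connected by blast
  then have "openin (space_of X) W"
    using W(1) locally_connected locally_connected_space_open_connected_components by blast
  moreover have "W \<subseteq> a \<inter> b"
    using connected_components_of_subset[OF W(1)] by auto
  ultimately have "openin (subtopology (space_of X) a) W"
    by (simp add: subset_openin_subtopology)
  then have pre: "openin (hat X a) {x \<in> topspace (hat X a). hproj X a x \<in> W}"
    using openin_continuous_map_preimage[OF chart_proj_continuous[OF assms(1)]] by blast
  have lc: "locally_connected_space (hat X a)"
    using basic_g_structure[OF assms(1)] unfolding g_structure_def by blast
  show op: "openin (hat X a) (tdom X a b \<xi>)"
    using W(2) pre lc unfolding transition_over_def lift_components_def
    by (meson locally_connected_space_open_connected_components)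
  have hom: "homeomorphic_map (subtopology (hat X a) (tdom X a b \<xi>))
      (subtopology (hat X b) (tmap X a b \<xi> ` tdom X a b \<xi>)) (tmap X a b \<xi>)"
    and pr: "\<And>x. x \<in> topspace (hat X a) \<inter> tdom X a b \<xi> \<Longrightarrow> hproj X b (tmap X a b \<xi> x) = hproj X a x"
    using W(2) unfolding transition_over_def gstr_iso_def induced_def by auto
  show "continuous_map (subtopology (hat X a) (tdom X a b \<xi>)) (hat X b) (tmap X a b \<xi>)"
    using homeomorphic_imp_continuous_map[OF hom] continuous_map_in_subtopology by blast
  show "hproj X b (tmap X a b \<xi> x) = hproj X a x" if "x \<in> tdom X a b \<xi>"
    using pr that openin_subset[OF op] by blast
qed

lemma arrD:
  assumes "arr p"
  shows "point (src p)" "point (trg p)" "foot (trg p) = foot (src p)"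
    "fst (src p) \<in> basic X" "fst (trg p) \<in> basic X"
    "label p \<in> Tran X (fst (src p)) (fst (trg p))"
    "snd (src p) \<in> tdom X (fst (src p)) (fst (trg p)) (label p)"
    "snd (trg p) = tmap X (fst (src p)) (fst (trg p)) (label p) (snd (src p))"
proof -
  obtain a x \<xi> b y where p: "p = Germ (a, x) \<xi> (b, y)"
    by (metis germ.exhaust prod.exhaust)
  have h: "a \<in> basic X" "b \<in> basic X" "\<xi> \<in> Tran X a b" "x \<in> tdom X a b \<xi>" "y = tmap X a b \<xi> x"
    using assms unfolding arr_def p by auto
  have x: "x \<in> topspace (hat X a)"
    using transition_domain(1)[OF h(1-3)] h(4) openin_subset by blast
  then have "x \<in> topspace (subtopology (hat X a) (tdom X a b \<xi>))"
    using h by auto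
  then have "y \<in> topspace (hat X b)"
    using continuous_map_image_subset_topspace[OF transition_domain(2)[OF h(1-3)]] h(5) by blast
  then show "point (src p)" "point (trg p)" "foot (trg p) = foot (src p)"
    "fst (src p) \<in> basic X" "fst (trg p) \<in> basic X"
    "label p \<in> Tran X (fst (src p)) (fst (trg p))"
    "snd (src p) \<in> tdom X (fst (src p)) (fst (trg p)) (label p)"
    "snd (trg p) = tmap X (fst (src p)) (fst (trg p)) (label p) (snd (src p))"
    using h x transition_domain(3)[OF h(1-3)] unfolding p point_def foot_def by auto
qed

lemma arrI:
  "\<lbrakk> fst (src p) \<in> basic X; fst (trg p) \<in> basic X; label p \<in> Tran X (fst (src p)) (fst (trg p));
     snd (src p) \<in> tdom X (fst (src p)) (fst (trg p)) (label p);
     snd (trg p) = tmap X (fst (src p)) (fst (trg p)) (label p) (snd (src p)) \<rbrakk> \<Longrightarrow> arr p"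
  unfolding arr_def by (auto split: germ.splits)

lemma composable:
  "\<lbrakk> arr p; arr q; src q = trg p \<rbrakk> \<Longrightarrow>
     snd (src p) \<in> composable_at X (fst (src p)) (fst (trg p)) (fst (trg q)) (label q) (label p)"
  unfolding composable_at_def using arrD(7,8) by fastforce

lemma arr_comp [simp]:
  assumes "arr p" "arr q" "src q = trg p"
  shows "arr (q \<cdot> p)"
proof (rule arrI)
  note t = tcomp_map[OF arrD(4)[OF assms(1)] arrD(5)[OF assms(1)] arrD(5)[OF assms(2)]
      arrD(6)[OF assms(1)] arrD(6)[OF assms(2), unfolded assms(3)] composable[OF assms]]
  show "label (q \<cdot> p) \<in> Tran X (fst (src (q \<cdot> p))) (fst (trg (q \<cdot> p)))"
    "snd (src (q \<cdot> p)) \<in> tdom X (fst (src (q \<cdot> p))) (fst (trg (q \<cdot> p))) (label (q \<cdot> p))"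
    using t by (simp_all add: comp_def)
  show "snd (trg (q \<cdot> p)) =
      tmap X (fst (src (q \<cdot> p))) (fst (trg (q \<cdot> p))) (label (q \<cdot> p)) (snd (src (q \<cdot> p)))"
    using t arrD(8)[OF assms(1)] arrD(8)[OF assms(2)] assms(3) by (simp add: comp_def)
qed (use arrD assms in simp_all)

lemma comp_assoc:
  assumes "arr p" "arr q" "arr r" "src q = trg p" "src r = trg q"
  shows "(r \<cdot> q) \<cdot> p = r \<cdot> q \<cdot> p"
  using tcomp_assoc[OF arrD(4)[OF assms(1)] arrD(5)[OF assms(1)] arrD(5)[OF assms(2)]
      arrD(5)[OF assms(3)] arrD(6)[OF assms(1)] arrD(6)[OF assms(2), unfolded assms(4)]
      arrD(6)[OF assms(3), unfolded assms(5)] composable[OF assms(1,2,4)]]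
    composable[OF assms(2,3,5)] arrD(8)[OF assms(1)] assms(4)
  unfolding comp_def by simp

lemma arr_aut_germ [simp]:
  "\<lbrakk> point A; g \<in> carrier (grp X (fst A)) \<rbrakk> \<Longrightarrow> arr (aut_germ A g)"
  using aut_map[of "fst A" g] bij_betwE[OF aut_bij, of "fst A"]
  by (intro arrI) (auto simp: aut_germ_def point_def)

lemma aut_germ_one: "point A \<Longrightarrow> aut_germ A \<one>\<^bsub>grp X (fst A)\<^esub> = unit A"
  using group_action.id_eq_one[OF chart_action, of "fst A"]
  unfolding aut_germ_def unit_def point_def
  by (auto simp: prod_eq_iff) (metis restrict_apply')

lemma arr_unit [simp]: "point A \<Longrightarrow> arr (unit A)"
  using aut_germ_one arr_aut_germ chart_group
  by (metis group.is_monoid monoid.one_closed point_def)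

lemma comp_aut_germ:
  assumes "point A" "g \<in> carrier (grp X (fst A))" "h \<in> carrier (grp X (fst A))"
    "B = trg (aut_germ A h)"
  shows "aut_germ B g \<cdot> aut_germ A h = aut_germ A (g \<otimes>\<^bsub>grp X (fst A)\<^esub> h)"
  using assms aut_mult group_action.composition_rule[OF chart_action]
  by (auto simp: aut_germ_def comp_def point_def)

text \<open>Unit laws are not among the axioms of composition. The criterion for \<open>h\<inverse> \<circ> \<xi> \<circ> g = \<xi>\<close> at
  \<open>g = h = 1\<close> says that the unit germs cancel when they are put on both sides; as they are
  idempotent, each of them cancels on its own.\<close>

lemma comp_units:
  assumes "arr p"
  shows "unit (trg p) \<cdot> p \<cdot> unit (src p) = p"
proof -
  let ?a = "fst (src p)" and ?b = "fst (trg p)" and ?x = "snd (src p)"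
  interpret A: group_action "grp X ?a" "topspace (hat X ?a)" "hact X ?a"
    using chart_action arrD(4)[OF assms] .
  interpret GA: group "grp X ?a" using chart_group arrD(4)[OF assms] .
  interpret GB: group "grp X ?b" using chart_group arrD(5)[OF assms] .
  have x: "?x \<in> topspace (hat X ?a)" "hact X ?a \<one>\<^bsub>grp X ?a\<^esub> ?x = ?x"
    using arrD(1)[OF assms] A.id_eq_one unfolding point_def by (auto, metis restrict_apply')
  have sub: "tdom X ?a ?b (label p) \<subseteq> topspace (hat X ?a)"
    using transition_domain(1)[OF arrD(4-6)[OF assms]] by (rule openin_subset)
  have "act (gstr X ?a) \<one>\<^bsub>grp X ?a\<^esub> y = y" if "y \<in> topspace (hat X ?a)" for y
    using that A.id_eq_one by (metis restrict_apply')
  then have "act (gstr X ?a) \<one>\<^bsub>grp X ?a\<^esub> ` tdom X ?a ?b (label p) = tdom X ?a ?b (label p)"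
    using sub by (auto simp: image_iff subset_iff)
  then have stab: "\<one>\<^bsub>grp X ?a\<^esub> \<in> set_stabilizer (gstr X ?a) (tdom X ?a ?b (label p))"
    unfolding set_stabilizer_def by simp
  obtain W where W: "transition_over X ?a ?b (label p) W"
    using Tran_iso[OF arrD(4-6)[OF assms]] by blast
  let ?S = "induced (gstr X ?a) (tdom X ?a ?b (label p))"
  let ?T = "induced (gstr X ?b) (tmap X ?a ?b (label p) ` tdom X ?a ?b (label p))"
  have hom: "thom X ?a ?b (label p) \<in> hom (sgroup ?S) (sgroup ?T)"
    using W unfolding transition_over_def gstr_iso_def iso_def by blast
  have "\<one>\<^bsub>grp X ?a\<^esub> \<in> carrier (sgroup ?S)"
    "\<one>\<^bsub>grp X ?a\<^esub> \<otimes>\<^bsub>sgroup ?S\<^esub> \<one>\<^bsub>grp X ?a\<^esub> = \<one>\<^bsub>grp X ?a\<^esub>"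
    using stab by (simp_all add: induced_def)
  then have "thom X ?a ?b (label p) \<one>\<^bsub>grp X ?a\<^esub> \<otimes>\<^bsub>grp X ?b\<^esub> thom X ?a ?b (label p) \<one>\<^bsub>grp X ?a\<^esub>
      = thom X ?a ?b (label p) \<one>\<^bsub>grp X ?a\<^esub>"
    and "thom X ?a ?b (label p) \<one>\<^bsub>grp X ?a\<^esub> \<in> carrier (grp X ?b)"
    using hom_mult[OF hom, of "\<one>\<^bsub>grp X ?a\<^esub>" "\<one>\<^bsub>grp X ?a\<^esub>"] hom_in_carrier[OF hom, of "\<one>\<^bsub>grp X ?a\<^esub>"]
    by (auto simp: induced_def set_stabilizer_def)
  then have "thom X ?a ?b (label p) \<one>\<^bsub>grp X ?a\<^esub> = \<one>\<^bsub>grp X ?b\<^esub>"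
    by (metis GB.l_cancel_one)
  then have "twist X ?a ?b \<one>\<^bsub>grp X ?b\<^esub> (label p) \<one>\<^bsub>grp X ?a\<^esub> ?x = label p"
    using twist_eq_iff[OF arrD(4-6)[OF assms], of "\<one>\<^bsub>grp X ?a\<^esub>" "\<one>\<^bsub>grp X ?b\<^esub>" ?x]
      stab x arrD(7)[OF assms] by simp
  then show ?thesis
    unfolding twist_def by (simp add: germ.expand comp_def unit_def)
qed

lemma unit_unit: "point A \<Longrightarrow> unit A \<cdot> unit A = unit A"
  using comp_units[of "unit A"] comp_assoc[of "unit A" "unit A" "unit A"]
    comp_aut_germ[of A "\<one>\<^bsub>grp X (fst A)\<^esub>" "\<one>\<^bsub>grp X (fst A)\<^esub>" A]
    group.is_monoid[OF chart_group] aut_germ_one[of A]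
  by (simp add: monoid.r_one monoid.one_closed point_def)

lemma comp_unit [simp]:
  assumes "arr p" "src p = A"
  shows "p \<cdot> unit A = p"
proof -
  have pt: "point A" "point (trg p)"
    using assms arrD by blast+
  have "p \<cdot> unit A = (unit (trg p) \<cdot> p \<cdot> unit A) \<cdot> unit A"
    using comp_units[OF assms(1)] assms(2) by simp
  also have "\<dots> = unit (trg p) \<cdot> p \<cdot> unit A \<cdot> unit A"
    using assms pt by (simp add: comp_assoc)
  also have "\<dots> = p"
    using comp_units[OF assms(1)] assms(2) unit_unit[OF pt(1)] by simp
  finally show ?thesis .
qed

lemma unit_comp [simp]:
  assumes "arr p" "trg p = A"
  shows "unit A \<cdot> p = p"
  using comp_units[OF assms(1)] assms by simp

text \<open>If \<open>a \<inter> b\<close> is itself basic then it is connected, hence the only component that transition maps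
  between \<open>a\<close> and \<open>b\<close> can live over.\<close>

lemma transition_over_basic:
  assumes "a \<in> basic X" "b \<in> basic X" "a \<inter> b \<in> basic X" "\<xi> \<in> Tran X a b"
  shows "transition_over X a b \<xi> (a \<inter> b)"
proof -
  have "connected_space (subtopology (space_of X) (a \<inter> b))"
    using basic_connected[OF assms(3)] by (simp add: connectedin_def)
  then have "W = a \<inter> b" if "W \<in> connected_components_of (subtopology (space_of X) (a \<inter> b))" for W
    using that connected_components_of_connected_space[of "subtopology (space_of X) (a \<inter> b)"]
      topspace_chart[OF assms(3)] by (auto split: if_splits)
  then show ?thesis
    using Tran_iso[OF assms(1,2,4)] by blast
qed

lemma lift_components_self:
  assumes "W \<in> basic X" "C \<in> lift_components X W W"
  shows "C = topspace (hat X W)"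
proof -
  have "{x \<in> topspace (hat X W). hproj X W x \<in> W} = topspace (hat X W)"
    using chart_proj_in[OF assms(1)] by blast
  then have C: "C \<in> connected_components_of (hat X W)"
    using assms(2) unfolding lift_components_def by (simp only: subtopology_topspace)
  have "connected_space (hat X W)"
    using basic_g_structure[OF assms(1)] unfolding g_structure_def by blast
  then show ?thesis
    using C connected_components_of_connected_space[of "hat X W"] by (auto split: if_splits)
qed

lemma basic_sub_transition:
  assumes "a \<in> basic X" "W \<in> basic X" "W \<subseteq> a" "\<xi> \<in> Tran X a W"
  shows "tmap X a W \<xi> ` tdom X a W \<xi> = topspace (hat X W)"
  using transition_over_basic[of a W \<xi>] lift_components_self[OF assms(2)] assms
  unfolding transition_over_def by (simp add: Int_absorb1)

lemma sub_basic_transition: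
  assumes "a \<in> basic X" "W \<in> basic X" "W \<subseteq> a" "\<xi> \<in> Tran X W a"
  shows "tdom X W a \<xi> = topspace (hat X W)"
  using transition_over_basic[of W a \<xi>] lift_components_self[OF assms(2)] assms
  unfolding transition_over_def by (simp add: Int_absorb2)

lemma germ_over_chart:
  assumes "point A" "point B" "fst A = fst B" "foot A = foot B"
  obtains g where "g \<in> carrier (grp X (fst A))" "trg (aut_germ A g) = B"
  using chart_fibre[of "fst A" "snd A" "snd B"] assms
  unfolding point_def foot_def trg_aut_germ by (metis prod.collapse)

text \<open>Transition maps between two charts \<open>a\<close>, \<open>b\<close> need not be defined at a given point of the cover of
  \<open>a\<close>. The detour through the component \<open>W\<close> of \<open>a \<inter> b\<close> around the common foot avoids this: transition
  maps between \<open>W\<close> and a larger chart involve the whole cover of \<open>W\<close>, and a mismatch of the lifts of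
  the foot is corrected by the chart groups, which permute the fibres transitively.\<close>

lemma germ_between:
  assumes "point A" "point B" "foot A = foot B"
  obtains p where "arr p" "src p = A" "trg p = B"
proof -
  let ?a = "fst A" and ?b = "fst B"
  have bas: "?a \<in> basic X" "?b \<in> basic X"
    using assms unfolding point_def by auto
  have f: "foot A \<in> ?a \<inter> ?b"
    using assms chart_proj_in unfolding point_def foot_def by (metis IntI)
  have op: "openin (space_of X) (?a \<inter> ?b)"
    using bas basic_connected by blast
  define W where "W = connected_component_of_set (subtopology (space_of X) (?a \<inter> ?b)) (foot A)"
  have top: "topspace (subtopology (space_of X) (?a \<inter> ?b)) = ?a \<inter> ?b"
    using openin_subset[OF op] by (simp add: Int_absorb1)
  have comp: "W \<in> connected_components_of (subtopology (space_of X) (?a \<inter> ?b))"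
    unfolding W_def connected_component_in_connected_components_of top using f .
  have fW: "foot A \<in> W"
    unfolding W_def using f top connected_component_of_refl by (metis mem_Collect_eq)
  have sub: "W \<subseteq> ?a \<inter> ?b"
    using connected_components_of_subset[OF comp] top by simp
  then have Wa: "W \<subseteq> ?a" and Wb: "W \<subseteq> ?b"
    by auto
  have "openin (space_of X) W"
    using comp op locally_connected locally_connected_space_open_connected_components by blast
  moreover have "connectedin (space_of X) W"
    using connectedin_connected_components_of[OF comp] connectedin_subtopology by blast
  ultimately have W: "W \<in> basic X"
    using basic_enlarged[OF bas(1), of W] sub fW by blast
  obtain \<xi> where \<xi>: "\<xi> \<in> Tran X ?a W"
    using Tran_nonempty[OF bas(1) W] fW sub by blast
  obtain \<eta> where \<eta>: "\<eta> \<in> Tran X W ?b"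
    using Tran_nonempty[OF W bas(2)] fW sub by blast
  obtain w where w: "w \<in> topspace (hat X W)" "hproj X W w = foot A"
    using chart_proj_surj[OF W fW] .
  then have "w \<in> tmap X ?a W \<xi> ` tdom X ?a W \<xi>"
    using basic_sub_transition[OF bas(1) W Wa \<xi>] by simp
  then obtain x where x: "x \<in> tdom X ?a W \<xi>" "tmap X ?a W \<xi> x = w"
    by blast
  have e1: "arr (Germ (?a, x) \<xi> (W, w))"
    unfolding arr_def using bas W \<xi> x by simp
  have e2: "arr (Germ (W, w) \<eta> (?b, tmap X W ?b \<eta> w))"
    unfolding arr_def using bas W \<eta> w sub_basic_transition[OF bas(2) W Wb \<eta>] by simp
  note d1 = arrD[OF e1, simplified] and d2 = arrD[OF e2, simplified]
  have pts: "foot (?a, x) = foot A" "foot (?b, tmap X W ?b \<eta> w) = foot A"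
    using d1(3) d2(3) w(2) unfolding foot_def by simp_all
  obtain g where g: "g \<in> carrier (grp X ?a)" "trg (aut_germ A g) = (?a, x)"
    using germ_over_chart[OF assms(1) d1(1)] pts by auto
  obtain h where h: "h \<in> carrier (grp X ?b)" "trg (aut_germ (?b, tmap X W ?b \<eta> w) h) = B"
    using germ_over_chart[OF d2(2) assms(2)] pts assms(3) by auto
  show thesis
  proof (rule that)
    show "arr (aut_germ (?b, tmap X W ?b \<eta> w) h \<cdot> Germ (W, w) \<eta> (?b, tmap X W ?b \<eta> w) \<cdot>
        Germ (?a, x) \<xi> (W, w) \<cdot> aut_germ A g)"
      using e1 e2 d2(2) assms g h by simp
  qed (use h in simp_all)
qed

text \<open>The vertex groups of the groupoid are the isotropy groups, because all transition maps from a
  chart to itself come from its group.\<close>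

lemma vertex_germ:
  assumes "arr p" "fst (src p) = fst (trg p)"
  obtains g where "g \<in> carrier (grp X (fst (src p)))" "p = aut_germ (src p) g"
proof -
  obtain g where g: "g \<in> carrier (grp X (fst (src p)))" "label p = aut X (fst (src p)) g"
    using arrD(6)[OF assms(1)] assms(2) bij_betw_imp_surj_on[OF aut_bij[OF arrD(4)[OF assms(1)]]]
    by auto
  have "snd (trg p) = hact X (fst (src p)) g (snd (src p))"
    using arrD(8)[OF assms(1)] assms(2) g aut_map[OF arrD(4)[OF assms(1)] g(1)]
      arrD(1)[OF assms(1)] unfolding point_def by simp
  then show thesis
    using that g assms(2) by (auto simp: aut_germ_def germ.expand prod_eq_iff)
qed

lemma aut_germ_inj:
  assumes "point A" "g \<in> carrier (grp X (fst A))" "h \<in> carrier (grp X (fst A))"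
    "aut_germ A g = aut_germ A h"
  shows "g = h"
  using assms bij_betw_imp_inj_on[OF aut_bij, of "fst A"]
  by (auto simp: aut_germ_def point_def dest: inj_onD)

text \<open>There is some germ \<open>q\<close> back from the target of \<open>p\<close> to its source. The loop \<open>q \<cdot> p\<close> is a group
  element, and composing \<open>q\<close> with its inverse repairs \<open>q\<close>.\<close>

lemma left_inverse_exists:
  assumes "arr p"
  shows "\<exists>q. arr q \<and> src q = trg p \<and> trg q = src p \<and> q \<cdot> p = unit (src p)"
proof -
  have pts: "point (src p)" "point (trg p)"
    using arrD[OF assms] by auto
  interpret G: group "grp X (fst (src p))" using chart_group arrD(4)[OF assms] .
  obtain q where q: "arr q" "src q = trg p" "trg q = src p"
    using germ_between[OF pts(2,1) arrD(3)[OF assms]] .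
  obtain g where g: "g \<in> carrier (grp X (fst (src p)))" "q \<cdot> p = aut_germ (src p) g"
    using vertex_germ[of "q \<cdot> p"] assms q by auto
  have t: "trg (aut_germ (src p) g) = src p"
    using g(2) q(3) by (metis trg_comp)
  let ?k = "aut_germ (src p) (inv\<^bsub>grp X (fst (src p))\<^esub> g)"
  have k: "?k \<cdot> q \<cdot> p = unit (src p)"
    using comp_aut_germ[OF pts(1) _ g(1), of "inv\<^bsub>grp X (fst (src p))\<^esub> g" "src p"] g t
      aut_germ_one[OF pts(1)] by simp
  moreover have "trg ?k = src p"
    using k by (metis trg_comp trg_unit)
  ultimately show ?thesis
    using q assms pts g(1) by (intro exI[of _ "?k \<cdot> q"]) (simp add: comp_assoc)
qed

lemma inverse_germ:
  assumes "arr p"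
  shows arr_inverse [simp]: "arr (inverse_germ p)" and src_inverse [simp]: "src (inverse_germ p) = trg p"
    and trg_inverse [simp]: "trg (inverse_germ p) = src p"
    and inverse_comp [simp]: "inverse_germ p \<cdot> p = unit (src p)"
  using someI_ex[OF left_inverse_exists[OF assms]] unfolding inverse_germ_def by auto

lemma comp_inverse [simp]:
  assumes "arr p"
  shows "p \<cdot> inverse_germ p = unit (trg p)"
proof -
  let ?i = "inverse_germ p" let ?j = "inverse_germ ?i"
  have pts: "point (src p)" "point (trg p)"
    using arrD[OF assms] by auto
  have "p = (?j \<cdot> ?i) \<cdot> p"
    using assms by simp
  also have "\<dots> = ?j"
    using assms by (subst comp_assoc) simp_all
  finally have "p = ?j" .
  then show ?thesis
    using inverse_comp[OF arr_inverse[OF assms]] assms by simp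
qed

lemma inverse_unique:
  assumes "arr p" "arr q" "src q = trg p" "q \<cdot> p = unit (src p)"
  shows "q = inverse_germ p"
proof -
  have "q = q \<cdot> p \<cdot> inverse_germ p"
    using assms arrD by simp
  also have "\<dots> = (q \<cdot> p) \<cdot> inverse_germ p"
    using assms by (subst comp_assoc) simp_all
  finally show ?thesis
    using assms by simp
qed

lemma inverse_comp_assoc [simp]:
  assumes "arr p" "arr q" "trg q = src p"
  shows "inverse_germ p \<cdot> p \<cdot> q = q"
  using assms by (subst comp_assoc[symmetric]) simp_all

lemma comp_inverse_assoc [simp]:
  assumes "arr p" "arr q" "trg q = trg p"
  shows "p \<cdot> inverse_germ p \<cdot> q = q"
  using assms by (subst comp_assoc[symmetric]) simp_all

lemma comp_left_cancel:
  assumes "arr p" "arr q" "arr r" "trg q = src p" "trg r = src p" "p \<cdot> q = p \<cdot> r"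
  shows "q = r"
  using assms inverse_comp_assoc by metis

lemma inverse_of_comp:
  assumes "arr p" "arr q" "src q = trg p"
  shows "inverse_germ (q \<cdot> p) = inverse_germ p \<cdot> inverse_germ q"
  using assms by (intro inverse_unique[symmetric]) (simp_all add: comp_assoc)

end

section \<open>Flat families of germs\<close>

context orbispace
begin

text \<open>Flatness is continuity for the topology on germs in which the germs of one transition map at
  varying points form an open set: near \<open>t\<close> the label does not change and the source point moves
  continuously.\<close>

definition flat_at :: "(real \<Rightarrow> ('x set \<times> 'y, 't) germ) \<Rightarrow> real \<Rightarrow> bool" where
  "flat_at p t \<longleftrightarrow>
     (\<exists>N a b \<xi> x. open N \<and> t \<in> N \<and> continuous_map (top_of_set N) (hat X a) x \<and>
        (\<forall>s\<in>N. p s = Germ (a, x s) \<xi> (b, tmap X a b \<xi> (x s)) \<and> arr (p s)))"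

lemma flat_atE:
  assumes "flat_at p t"
  obtains N a b \<xi> x where "open N" "t \<in> N" "continuous_map (top_of_set N) (hat X a) x"
    "\<And>s. s \<in> N \<Longrightarrow> p s = Germ (a, x s) \<xi> (b, tmap X a b \<xi> (x s))" "\<And>s. s \<in> N \<Longrightarrow> arr (p s)"
  using assms unfolding flat_at_def by blast

lemma flat_cong:
  assumes "flat_at p t" "open N" "t \<in> N" "\<And>s. s \<in> N \<Longrightarrow> q s = p s"
  shows "flat_at q t"
proof -
  obtain M a b \<xi> x where M: "open M" "t \<in> M" "continuous_map (top_of_set M) (hat X a) x"
    "\<And>s. s \<in> M \<Longrightarrow> p s = Germ (a, x s) \<xi> (b, tmap X a b \<xi> (x s))" "\<And>s. s \<in> M \<Longrightarrow> arr (p s)"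
    using flat_atE[OF assms(1)] by metis
  have "continuous_map (top_of_set (M \<inter> N)) (hat X a) x"
    using M(3) continuous_map_from_subtopology_mono by blast
  then show ?thesis
    unfolding flat_at_def using M assms
    by (intro exI[of _ "M \<inter> N"] exI[of _ a] exI[of _ b] exI[of _ \<xi>] exI[of _ x]) auto
qed

lemma flat_const: "arr q \<Longrightarrow> flat_at (\<lambda>_. q) t"
  unfolding flat_at_def using arrD[of q]
  by (intro exI[of _ UNIV] exI[of _ "fst (src q)"] exI[of _ "fst (trg q)"] exI[of _ "label q"]
      exI[of _ "\<lambda>_. snd (src q)"]) (auto simp: point_def germ.expand prod_eq_iff)

text \<open>The set where two transition maps can be composed is open, so a continuous source point stays
  in one component of it for a while, where the composite is a single transition map.\<close>

lemma openin_composable_at: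
  assumes "a \<in> basic X" "b \<in> basic X" "c \<in> basic X" "\<xi> \<in> Tran X a b" "\<eta> \<in> Tran X b c"
  shows "openin (hat X a) (composable_at X a b c \<eta> \<xi>)"
proof -
  note d = transition_domain[OF assms(1,2,4)] and d' = transition_domain[OF assms(2,3,5)]
  have "openin (subtopology (hat X a) (tdom X a b \<xi>))
      {x \<in> topspace (subtopology (hat X a) (tdom X a b \<xi>)). tmap X a b \<xi> x \<in> tdom X b c \<eta>}"
    using openin_continuous_map_preimage[OF d(2) d'(1)] .
  moreover have "{x \<in> topspace (subtopology (hat X a) (tdom X a b \<xi>)). tmap X a b \<xi> x \<in> tdom X b c \<eta>}
      = composable_at X a b c \<eta> \<xi>"
    using openin_subset[OF d(1)] unfolding composable_at_def by auto
  ultimately show ?thesis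
    using d(1) by (simp add: openin_open_subtopology)
qed

lemma tcomp_constant_near:
  assumes "a \<in> basic X" "b \<in> basic X" "c \<in> basic X" "\<xi> \<in> Tran X a b" "\<eta> \<in> Tran X b c"
    "x \<in> composable_at X a b c \<eta> \<xi>"
  obtains C where "openin (hat X a) C" "x \<in> C" "C \<subseteq> composable_at X a b c \<eta> \<xi>"
    "\<And>y. y \<in> C \<Longrightarrow> tcomp X a b c \<eta> \<xi> y = tcomp X a b c \<eta> \<xi> x"
proof -
  let ?S = "subtopology (hat X a) (composable_at X a b c \<eta> \<xi>)"
  have op: "openin (hat X a) (composable_at X a b c \<eta> \<xi>)"
    using openin_composable_at assms by blast
  have top: "topspace ?S = composable_at X a b c \<eta> \<xi>"
    using openin_subset[OF op] by (simp add: Int_absorb1)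
  have lc: "locally_connected_space (hat X a)"
    using basic_g_structure[OF assms(1)] unfolding g_structure_def by blast
  define C where "C = connected_component_of_set ?S x"
  have C: "C \<in> connected_components_of ?S"
    unfolding C_def connected_component_in_connected_components_of top by (rule assms)
  have xC: "x \<in> C"
    unfolding C_def using assms(6) top connected_component_of_refl by (metis mem_Collect_eq)
  show thesis
  proof (rule that)
    show "openin (hat X a) C"
      using C op lc locally_connected_space_open_connected_components by blast
    show "C \<subseteq> composable_at X a b c \<eta> \<xi>"
      using connected_components_of_subset[OF C] top by simp
    show "tcomp X a b c \<eta> \<xi> y = tcomp X a b c \<eta> \<xi> x" if "y \<in> C" for y
      using tcomp_locally_constant[OF assms(1-5) C that xC] .
  qed (rule xC)
qed

lemma open_continuous_preimage:
  fixes N :: "real set"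
  assumes "open N" "continuous_map (top_of_set N) T x" "openin T C"
  shows "open {s \<in> N. x s \<in> C}"
  using openin_continuous_map_preimage[OF assms(2,3)] assms(1)
  by (simp add: openin_open_eq)

lemma flat_comp:
  assumes "flat_at p t" "flat_at q t" "open M" "t \<in> M" "\<And>s. s \<in> M \<Longrightarrow> src (q s) = trg (p s)"
  shows "flat_at (\<lambda>s. q s \<cdot> p s) t"
proof -
  obtain N a b \<xi> x where N: "open N" "t \<in> N" "continuous_map (top_of_set N) (hat X a) x"
    "\<And>s. s \<in> N \<Longrightarrow> p s = Germ (a, x s) \<xi> (b, tmap X a b \<xi> (x s))" "\<And>s. s \<in> N \<Longrightarrow> arr (p s)"
    using flat_atE[OF assms(1)] by metis
  obtain N' b' c \<eta> y where N': "open N'" "t \<in> N'" "continuous_map (top_of_set N') (hat X b') y"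
    "\<And>s. s \<in> N' \<Longrightarrow> q s = Germ (b', y s) \<eta> (c, tmap X b' c \<eta> (y s))" "\<And>s. s \<in> N' \<Longrightarrow> arr (q s)"
    using flat_atE[OF assms(2)] by metis
  have b: "b' = b"
    using assms(5)[OF assms(4)] N(4)[OF N(2)] N'(4)[OF N'(2)] by simp
  note d = arrD[OF N(5)[OF N(2)], unfolded N(4)[OF N(2)], simplified]
    and d' = arrD[OF N'(5)[OF N'(2)], unfolded N'(4)[OF N'(2)], simplified]
  have "x t \<in> composable_at X a b c \<eta> \<xi>"
    using composable[OF N(5)[OF N(2)] N'(5)[OF N'(2)] assms(5)[OF assms(4)]]
      N(4)[OF N(2)] N'(4)[OF N'(2)] by simp
  then obtain C where C: "openin (hat X a) C" "x t \<in> C"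
    "\<And>y. y \<in> C \<Longrightarrow> tcomp X a b c \<eta> \<xi> y = tcomp X a b c \<eta> \<xi> (x t)"
    using tcomp_constant_near[of a b c \<xi> \<eta> "x t"] d d' b by metis
  let ?K = "{s \<in> N. x s \<in> C} \<inter> N' \<inter> M"
  let ?\<zeta> = "tcomp X a b c \<eta> \<xi> (x t)"
  have "open ?K"
    using open_continuous_preimage[OF N(1,3) C(1)] N'(1) assms(3) by blast
  moreover have "t \<in> ?K"
    using N N' C assms(4) by blast
  moreover have "continuous_map (top_of_set ?K) (hat X a) x"
    by (rule continuous_map_from_subtopology_mono[OF N(3)]) blast
  moreover have "q s \<cdot> p s = Germ (a, x s) ?\<zeta> (c, tmap X a c ?\<zeta> (x s)) \<and> arr (q s \<cdot> p s)"
    if s: "s \<in> ?K" for s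
  proof -
    have qp: "arr (q s \<cdot> p s)"
      using s N(5) N'(5) assms(5) by simp
    moreover have "src (q s \<cdot> p s) = (a, x s)" "label (q s \<cdot> p s) = ?\<zeta>" "fst (trg (q s \<cdot> p s)) = c"
      using s N(4) N'(4) C(3) by (auto simp: comp_def)
    ultimately show ?thesis
      using arrD(8)[OF qp] by (auto intro!: germ.expand simp: prod_eq_iff)
  qed
  ultimately show ?thesis
    unfolding flat_at_def by blast
qed

text \<open>Near \<open>t\<close> the inverse is again given by one transition map \<open>\<eta>\<close>: the composite of \<open>\<eta>\<close> with the label
  of \<open>p\<close> is locally constant, hence the identity near the source point as it is so there.\<close>

lemma flat_inverse:
  assumes "flat_at p t"
  shows "flat_at (\<lambda>s. inverse_germ (p s)) t"
proof -
  obtain N a b \<xi> x where N: "open N" "t \<in> N" "continuous_map (top_of_set N) (hat X a) x"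
    "\<And>s. s \<in> N \<Longrightarrow> p s = Germ (a, x s) \<xi> (b, tmap X a b \<xi> (x s))" "\<And>s. s \<in> N \<Longrightarrow> arr (p s)"
    using flat_atE[OF assms] by metis
  let ?i = "inverse_germ (p t)"
  let ?\<eta> = "label ?i"
  note pt = N(5)[OF N(2)]
  note d = arrD[OF pt, unfolded N(4)[OF N(2)], simplified]
  note di = arrD[OF arr_inverse[OF pt], unfolded src_inverse[OF pt] trg_inverse[OF pt],
      unfolded N(4)[OF N(2)], simplified, folded N(4)[OF N(2)]]
  have "x t \<in> composable_at X a b a ?\<eta> \<xi>"
    using composable[OF pt arr_inverse[OF pt]] N(4)[OF N(2)] pt by simp
  then obtain C where C: "openin (hat X a) C" "x t \<in> C" "C \<subseteq> composable_at X a b a ?\<eta> \<xi>"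
    "\<And>y. y \<in> C \<Longrightarrow> tcomp X a b a ?\<eta> \<xi> y = tcomp X a b a ?\<eta> \<xi> (x t)"
    using tcomp_constant_near[of a b a \<xi> ?\<eta> "x t"] d di by metis
  have e: "tcomp X a b a ?\<eta> \<xi> (x t) = aut X a \<one>\<^bsub>grp X a\<^esub>"
    using arg_cong[OF inverse_comp[OF pt], of label] N(4)[OF N(2)] trg_inverse[OF pt]
    by (simp add: comp_def unit_def)
  let ?K = "{s \<in> N. x s \<in> C}"
  let ?y = "\<lambda>s. tmap X a b \<xi> (x s)"
  have "open ?K"
    using open_continuous_preimage[OF N(1,3) C(1)] .
  moreover have "t \<in> ?K"
    using N C by blast
  moreover have "continuous_map (top_of_set ?K) (hat X b) ?y"
  proof -
    have "continuous_map (top_of_set ?K) (hat X a) x"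
      by (rule continuous_map_from_subtopology_mono[OF N(3)]) blast
    then have "continuous_map (top_of_set ?K) (subtopology (hat X a) (tdom X a b \<xi>)) x"
      using C(3) unfolding composable_at_def by (auto intro!: continuous_map_into_subtopology)
    then show ?thesis
      using continuous_map_compose[OF _ transition_domain(2)[of a b \<xi>], of _ x] d
      by (simp add: o_def)
  qed
  moreover have "inverse_germ (p s) = Germ (b, ?y s) ?\<eta> (a, tmap X b a ?\<eta> (?y s)) \<and>
      arr (inverse_germ (p s))" if s: "s \<in> ?K" for s
  proof -
    let ?q = "Germ (b, ?y s) ?\<eta> (a, tmap X b a ?\<eta> (?y s))"
    have ps: "arr (p s)" "p s = Germ (a, x s) \<xi> (b, ?y s)"
      using s N by auto
    have xs: "x s \<in> C" using s by simp
    have q: "arr ?q"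
      using d di xs C(3) unfolding arr_def composable_at_def by auto
    have qp: "arr (?q \<cdot> p s)"
      using q ps by simp
    have "label (?q \<cdot> p s) = aut X a \<one>\<^bsub>grp X a\<^esub>"
      using C(4)[OF xs] e ps(2) by (simp add: comp_def)
    moreover have src: "src (?q \<cdot> p s) = (a, x s)" "fst (trg (?q \<cdot> p s)) = a"
      using ps by simp_all
    moreover have pa: "point (a, x s)"
      using arrD(1)[OF ps(1)] ps(2) by simp
    ultimately have "?q \<cdot> p s = unit (a, x s)"
      using arrD(8)[OF qp] arrD(8)[OF arr_unit[OF pa]]
      by (auto intro!: germ.expand simp: prod_eq_iff unit_def)
    then have "?q = inverse_germ (p s)"
      using inverse_unique[OF ps(1) q] ps(2) by simp
    then show ?thesis
      using q by simp
  qed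
  ultimately show ?thesis
    unfolding flat_at_def by blast
qed

text \<open>Two flat families with the same sources coincide on an open and closed set, since near
  each parameter both have constant labels.\<close>

lemma flat_agree:
  assumes "flat_at p t" "flat_at q t"
    "open M" "t \<in> M" "\<And>s. s \<in> M \<Longrightarrow> src (p s) = src (q s)"
  obtains K where "open K" "t \<in> K" "K \<subseteq> M" "\<And>s s'. s \<in> K \<Longrightarrow> s' \<in> K \<Longrightarrow> p s = q s \<Longrightarrow> p s' = q s'"
proof -
  obtain N a b \<xi> x where N: "open N" "t \<in> N"
    "\<And>s. s \<in> N \<Longrightarrow> p s = Germ (a, x s) \<xi> (b, tmap X a b \<xi> (x s))"
    using flat_atE[OF assms(1)] by metis
  obtain N' a' b' \<eta> y where N': "open N'" "t \<in> N'"
    "\<And>s. s \<in> N' \<Longrightarrow> q s = Germ (a', y s) \<eta> (b', tmap X a' b' \<eta> (y s))"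
    using flat_atE[OF assms(2)] by metis
  show thesis
  proof (rule that[of "N \<inter> N' \<inter> M"])
    fix s s' assume "s \<in> N \<inter> N' \<inter> M" "s' \<in> N \<inter> N' \<inter> M" "p s = q s"
    then show "p s' = q s'"
      using N(3) N'(3) assms(5)[of s'] by auto
  qed (use N N' assms in auto)
qed

lemma flat_label_constant:
  assumes "connected S" "\<And>t. t \<in> S \<Longrightarrow> flat_at p t" "t \<in> S" "s \<in> S"
  shows "label (p s) = label (p t)"
proof (rule connected_induction_simple[OF assms(1,3,4), of "\<lambda>s. label (p s) = label (p t)"])
  show "\<exists>T. openin (top_of_set S) T \<and> r \<in> T \<and>
      (\<forall>x\<in>T. \<forall>y\<in>T. label (p x) = label (p t) \<longrightarrow> label (p y) = label (p t))" if r: "r \<in> S" for r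
  proof -
    obtain N a b \<xi> x where "open N" "r \<in> N"
      "\<And>s. s \<in> N \<Longrightarrow> p s = Germ (a, x s) \<xi> (b, tmap X a b \<xi> (x s))"
      using flat_atE[OF assms(2)[OF r]] by metis
    then show ?thesis
      using r by (intro exI[of _ "S \<inter> N"]) auto
  qed
qed simp

end

section \<open>Cocycles of germs over the real line\<close>

text \<open>The local data of a loop, pulled back to the real line: \<open>glue\<close> takes the index of the target patch
  first. The points that are glued are the endpoints of the germs.\<close>

record ('o, 't) cocycle =
  patch :: "nat \<Rightarrow> real set"
  glue :: "nat \<Rightarrow> nat \<Rightarrow> real \<Rightarrow> ('o, 't) germ"

context orbispace
begin

definition obj :: "('x set \<times> 'y, 't) cocycle \<Rightarrow> nat \<Rightarrow> real \<Rightarrow> 'x set \<times> 'y" where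
  "obj D i t = src (glue D i i t)"

definition is_cocycle :: "('x set \<times> 'y, 't) cocycle \<Rightarrow> bool" where
  "is_cocycle D \<longleftrightarrow>
     (\<forall>i. open (patch D i)) \<and> (\<forall>t. \<exists>i. t \<in> patch D i) \<and>
     (\<forall>i j t. t \<in> patch D i \<longrightarrow> t \<in> patch D j \<longrightarrow>
        arr (glue D j i t) \<and> flat_at (glue D j i) t \<and>
        src (glue D j i t) = obj D i t \<and> trg (glue D j i t) = obj D j t \<and>
        (\<forall>k. t \<in> patch D k \<longrightarrow> glue D k j t \<cdot> glue D j i t = glue D k i t))"

lemma is_cocycleD:
  assumes "is_cocycle D"
  shows "open (patch D i)" "\<exists>i. t \<in> patch D i"
    "t \<in> patch D i \<Longrightarrow> t \<in> patch D j \<Longrightarrow> arr (glue D j i t)"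
    "t \<in> patch D i \<Longrightarrow> t \<in> patch D j \<Longrightarrow> flat_at (glue D j i) t"
    "t \<in> patch D i \<Longrightarrow> t \<in> patch D j \<Longrightarrow> src (glue D j i t) = obj D i t"
    "t \<in> patch D i \<Longrightarrow> t \<in> patch D j \<Longrightarrow> trg (glue D j i t) = obj D j t"
    "t \<in> patch D i \<Longrightarrow> t \<in> patch D j \<Longrightarrow> t \<in> patch D k \<Longrightarrow>
       glue D k j t \<cdot> glue D j i t = glue D k i t"
    "t \<in> patch D i \<Longrightarrow> point (obj D i t)"
proof -
  show "t \<in> patch D i \<Longrightarrow> t \<in> patch D j \<Longrightarrow> arr (glue D j i t)"
    using assms unfolding is_cocycle_def by blast
  show "t \<in> patch D i \<Longrightarrow> point (obj D i t)"
    using assms arrD(1) unfolding is_cocycle_def obj_def by blast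
qed (use assms in \<open>simp_all add: is_cocycle_def\<close>)

lemma cocycle_unit:
  assumes "is_cocycle D" "t \<in> patch D i"
  shows "glue D i i t = unit (obj D i t)"
proof (rule comp_left_cancel)
  show "glue D i i t \<cdot> glue D i i t = glue D i i t \<cdot> unit (obj D i t)"
    using is_cocycleD[OF assms(1)] assms(2) by simp
qed (use is_cocycleD[OF assms(1)] assms(2) in simp_all)

text \<open>As for bundles given by gluing data, the component for one pair of patches determines those for all
  others. All germs being invertible, every morphism is an isomorphism.\<close>

definition morphism_on ::
  "real set \<Rightarrow> ('x set \<times> 'y, 't) cocycle \<Rightarrow> ('x set \<times> 'y, 't) cocycle \<Rightarrow>
     (nat \<Rightarrow> nat \<Rightarrow> real \<Rightarrow> ('x set \<times> 'y, 't) germ) \<Rightarrow> bool" where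
  "morphism_on B D E H \<longleftrightarrow>
     (\<forall>i j t. t \<in> B \<longrightarrow> t \<in> patch D i \<longrightarrow> t \<in> patch E j \<longrightarrow>
        arr (H j i t) \<and> flat_at (H j i) t \<and> src (H j i t) = obj D i t \<and> trg (H j i t) = obj E j t \<and>
        (\<forall>i'. t \<in> patch D i' \<longrightarrow> H j i' t \<cdot> glue D i' i t = H j i t) \<and>
        (\<forall>j'. t \<in> patch E j' \<longrightarrow> glue E j' j t \<cdot> H j i t = H j' i t))"

lemma morphism_onD:
  assumes "morphism_on B D E H" "t \<in> B" "t \<in> patch D i" "t \<in> patch E j"
  shows "arr (H j i t)" "flat_at (H j i) t" "src (H j i t) = obj D i t" "trg (H j i t) = obj E j t"
    "t \<in> patch D i' \<Longrightarrow> H j i' t \<cdot> glue D i' i t = H j i t"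
    "t \<in> patch E j' \<Longrightarrow> glue E j' j t \<cdot> H j i t = H j' i t"
  using assms unfolding morphism_on_def by auto

lemma morphism_on_subset: "morphism_on B D E H \<Longrightarrow> C \<subseteq> B \<Longrightarrow> morphism_on C D E H"
  unfolding morphism_on_def by blast

lemma morphism_glue: "is_cocycle D \<Longrightarrow> morphism_on B D D (glue D)"
  unfolding morphism_on_def by (auto simp: is_cocycleD)

text \<open>Any patch \<open>j\<close> of the middle cocycle around \<open>t\<close> may be used to compose, as the gluing germs cancel.\<close>

definition compose_morphism ::
  "('x set \<times> 'y, 't) cocycle \<Rightarrow> (nat \<Rightarrow> nat \<Rightarrow> real \<Rightarrow> ('x set \<times> 'y, 't) germ) \<Rightarrow>
     (nat \<Rightarrow> nat \<Rightarrow> real \<Rightarrow> ('x set \<times> 'y, 't) germ) \<Rightarrow>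
     nat \<Rightarrow> nat \<Rightarrow> real \<Rightarrow> ('x set \<times> 'y, 't) germ" where
  "compose_morphism E K H k i t =
     (let j = (SOME j. t \<in> patch E j) in K k j t \<cdot> H j i t)"

lemma compose_morphism_eq:
  assumes "is_cocycle E" "morphism_on B D E H" "morphism_on B E F K"
    "t \<in> B" "t \<in> patch D i" "t \<in> patch E j" "t \<in> patch F k"
  shows "compose_morphism E K H k i t = K k j t \<cdot> H j i t"
proof -
  define l where "l = (SOME j. t \<in> patch E j)"
  have l: "t \<in> patch E l"
    unfolding l_def using assms(6) by (rule someI)
  have "K k l t \<cdot> H l i t = K k l t \<cdot> glue E l j t \<cdot> H j i t"
    using morphism_onD(6)[OF assms(2,4,5,6) l] by simp
  also have "\<dots> = (K k l t \<cdot> glue E l j t) \<cdot> H j i t"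
    using morphism_onD(1,4)[OF assms(2,4,5,6)] morphism_onD(1,3)[OF assms(3,4) l assms(7)]
      is_cocycleD(3,5,6)[OF assms(1) assms(6) l] by (simp add: comp_assoc)
  also have "\<dots> = K k j t \<cdot> H j i t"
    using morphism_onD(5)[OF assms(3,4,6,7) l] by simp
  finally show ?thesis
    unfolding compose_morphism_def Let_def l_def .
qed

lemma morphism_compose:
  assumes "open B" "is_cocycle D" "is_cocycle E" "is_cocycle F"
    "morphism_on B D E H" "morphism_on B E F K"
  shows "morphism_on B D F (compose_morphism E K H)"
  unfolding morphism_on_def
proof (intro allI impI)
  fix i k t assume t: "t \<in> B" "t \<in> patch D i" "t \<in> patch F k"
  obtain j where j: "t \<in> patch E j"
    using is_cocycleD(2)[OF assms(3)] by blast
  note h = morphism_onD[OF assms(5) t(1,2) j] and k = morphism_onD[OF assms(6) t(1) j t(3)]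
  have eq: "compose_morphism E K H k' i' t = K k' j t \<cdot> H j i' t"
    if "t \<in> patch D i'" "t \<in> patch F k'" for i' k'
    using compose_morphism_eq[OF assms(3,5,6) t(1) that(1) j that(2)] .
  have "flat_at (\<lambda>s. K k j s \<cdot> H j i s) t"
  proof (rule flat_comp[OF h(2) k(2)])
    show "open (B \<inter> patch D i \<inter> patch E j \<inter> patch F k)"
      using assms(1) is_cocycleD(1)[OF assms(2)] is_cocycleD(1)[OF assms(3)]
        is_cocycleD(1)[OF assms(4)] by blast
    show "src (K k j s) = trg (H j i s)" if "s \<in> B \<inter> patch D i \<inter> patch E j \<inter> patch F k" for s
      using that morphism_onD(4)[OF assms(5)] morphism_onD(3)[OF assms(6)] by simp
  qed (use t j in simp)
  then have "flat_at (compose_morphism E K H k i) t"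
  proof (rule flat_cong)
    show "open (B \<inter> patch D i \<inter> patch E j \<inter> patch F k)"
      using assms(1) is_cocycleD(1)[OF assms(2)] is_cocycleD(1)[OF assms(3)]
        is_cocycleD(1)[OF assms(4)] by blast
    show "compose_morphism E K H k i s = K k j s \<cdot> H j i s"
      if "s \<in> B \<inter> patch D i \<inter> patch E j \<inter> patch F k" for s
      using that compose_morphism_eq[OF assms(3,5,6)] by simp
  qed (use t j in simp)
  moreover have "(K k j t \<cdot> H j i' t) \<cdot> glue D i' i t = K k j t \<cdot> H j i t" if "t \<in> patch D i'" for i'
    using morphism_onD[OF assms(5) t(1) that j] k h(5)[OF that] is_cocycleD[OF assms(2)] t that
    by (simp add: comp_assoc)
  moreover have "glue F k' k t \<cdot> K k j t \<cdot> H j i t = K k' j t \<cdot> H j i t" if "t \<in> patch F k'" for k'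
    using h k is_cocycleD[OF assms(4)] t that
    by (simp flip: comp_assoc)
  ultimately show "arr (compose_morphism E K H k i t) \<and> flat_at (compose_morphism E K H k i) t \<and>
      src (compose_morphism E K H k i t) = obj D i t \<and> trg (compose_morphism E K H k i t) = obj F k t \<and>
      (\<forall>i'. t \<in> patch D i' \<longrightarrow>
         compose_morphism E K H k i' t \<cdot> glue D i' i t = compose_morphism E K H k i t) \<and>
      (\<forall>k'. t \<in> patch F k' \<longrightarrow>
         glue F k' k t \<cdot> compose_morphism E K H k i t = compose_morphism E K H k' i t)"
    using h k t by (simp add: eq)
qed

lemma morphism_inverse:
  assumes "is_cocycle D" "is_cocycle E" "morphism_on B D E H"
  shows "morphism_on B E D (\<lambda>i j t. inverse_germ (H j i t))"
  unfolding morphism_on_def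
proof (intro allI impI)
  fix j i t assume t: "t \<in> B" "t \<in> patch E j" "t \<in> patch D i"
  note h = morphism_onD[OF assms(3) t(1,3,2)]
  have "inverse_germ (H j' i t) \<cdot> glue E j' j t = inverse_germ (H j i t)" if j': "t \<in> patch E j'" for j'
  proof (rule inverse_unique)
    note h' = morphism_onD[OF assms(3) t(1,3) j']
    show "(inverse_germ (H j' i t) \<cdot> glue E j' j t) \<cdot> H j i t = unit (src (H j i t))"
      using h h' is_cocycleD[OF assms(2)] t j' by (simp add: comp_assoc h(6)[OF j'])
    show "arr (inverse_germ (H j' i t) \<cdot> glue E j' j t)"
      "src (inverse_germ (H j' i t) \<cdot> glue E j' j t) = trg (H j i t)"
      using h h' is_cocycleD[OF assms(2)] t j' by simp_all
  qed (rule h)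
  moreover have "glue D i' i t \<cdot> inverse_germ (H j i t) = inverse_germ (H j i' t)"
    if i': "t \<in> patch D i'" for i'
  proof (rule inverse_unique)
    note h' = morphism_onD[OF assms(3) t(1) i' t(2)]
    have "H j i t \<cdot> glue D i i' t = H j i' t"
      using h'(5)[OF t(3)] .
    then have "(glue D i' i t \<cdot> inverse_germ (H j i t)) \<cdot> H j i' t =
        (glue D i' i t \<cdot> inverse_germ (H j i t)) \<cdot> H j i t \<cdot> glue D i i' t"
      by simp
    also have "\<dots> = glue D i' i t \<cdot> glue D i i' t"
      using h is_cocycleD[OF assms(1)] t i' by (simp add: comp_assoc)
    also have "\<dots> = glue D i' i' t"
      using is_cocycleD(7)[OF assms(1) i' t(3) i'] .
    also have "\<dots> = unit (obj D i' t)"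
      using cocycle_unit[OF assms(1) i'] .
    finally show "(glue D i' i t \<cdot> inverse_germ (H j i t)) \<cdot> H j i' t = unit (src (H j i' t))"
      using h' by simp
    show "arr (glue D i' i t \<cdot> inverse_germ (H j i t))" "arr (H j i' t)"
      "src (glue D i' i t \<cdot> inverse_germ (H j i t)) = trg (H j i' t)"
      using h h' is_cocycleD[OF assms(1)] t i' by simp_all
  qed
  ultimately show "arr (inverse_germ (H j i t)) \<and> flat_at (\<lambda>t. inverse_germ (H j i t)) t \<and>
      src (inverse_germ (H j i t)) = obj E j t \<and> trg (inverse_germ (H j i t)) = obj D i t \<and>
      (\<forall>j'. t \<in> patch E j' \<longrightarrow>
         inverse_germ (H j' i t) \<cdot> glue E j' j t = inverse_germ (H j i t)) \<and>
      (\<forall>i'. t \<in> patch D i' \<longrightarrow> glue D i' i t \<cdot> inverse_germ (H j i t) = inverse_germ (H j i' t))"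
    using h flat_inverse by simp
qed

lemma morphism_spread:
  assumes "morphism_on B D E H" "morphism_on B D E H'" "t \<in> B"
    "t \<in> patch D i" "t \<in> patch E j" "H j i t = H' j i t" "t \<in> patch D i'" "t \<in> patch E j'"
  shows "H j' i' t = H' j' i' t"
proof -
  have "H j i' t = H' j i' t"
    using morphism_onD(5)[OF assms(1,3,7,5,4)] morphism_onD(5)[OF assms(2,3,7,5,4)] assms(6) by simp
  then show ?thesis
    using morphism_onD(6)[OF assms(1,3,7,5,8)] morphism_onD(6)[OF assms(2,3,7,5,8)] by simp
qed

text \<open>Flat families that agree once agree on a connected set, and naturality carries agreement from
  one pair of patches to all others.\<close>

lemma morphism_unique:
  assumes "open B" "connected B" "is_cocycle D" "is_cocycle E"
    "morphism_on B D E H" "morphism_on B D E H'"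
    "t0 \<in> B" "t0 \<in> patch D i0" "t0 \<in> patch E j0" "H j0 i0 t0 = H' j0 i0 t0"
    "t \<in> B" "t \<in> patch D i" "t \<in> patch E j"
  shows "H j i t = H' j i t"
proof -
  let ?P = "\<lambda>t. \<forall>i j. t \<in> patch D i \<longrightarrow> t \<in> patch E j \<longrightarrow> H j i t = H' j i t"
  have "?P t"
  proof (rule connected_induction_simple[OF assms(2,7,11)])
    show "?P t0"
      using morphism_spread[OF assms(5-10)] by blast
    show "\<exists>T. openin (top_of_set B) T \<and> r \<in> T \<and> (\<forall>x\<in>T. \<forall>y\<in>T. ?P x \<longrightarrow> ?P y)" if r: "r \<in> B" for r
    proof -
      obtain i j where ij: "r \<in> patch D i" "r \<in> patch E j"
        using is_cocycleD(2)[OF assms(3)] is_cocycleD(2)[OF assms(4)] by blast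
      let ?M = "B \<inter> patch D i \<inter> patch E j"
      have M: "open ?M" "r \<in> ?M"
        using assms(1) is_cocycleD(1)[OF assms(3)] is_cocycleD(1)[OF assms(4)] r ij by blast+
      have src: "src (H j i s) = src (H' j i s)" if "s \<in> ?M" for s
        using that morphism_onD(3)[OF assms(5)] morphism_onD(3)[OF assms(6)] by simp
      obtain K where K: "open K" "r \<in> K" "K \<subseteq> ?M"
        "\<And>s s'. s \<in> K \<Longrightarrow> s' \<in> K \<Longrightarrow> H j i s = H' j i s \<Longrightarrow> H j i s' = H' j i s'"
        using flat_agree[OF morphism_onD(2)[OF assms(5) r ij] morphism_onD(2)[OF assms(6) r ij]
            M src] by blast
      have "?P y" if "x \<in> K" "y \<in> K" "?P x" for x y
      proof -
        have "H j i x = H' j i x"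
          using that K(3) by blast
        then have "H j i y = H' j i y"
          using K(4) that by blast
        then show ?thesis
          using morphism_spread[OF assms(5,6), of y i j] that K(3) by blast
      qed
      moreover have "openin (top_of_set B) K"
        using K(1,3) by (simp add: openin_open_eq assms(1))
      ultimately show ?thesis
        using K(2) by (intro exI[of _ K] conjI ballI impI) assumption+
    qed
  qed
  then show ?thesis
    using assms(12,13) by simp
qed

text \<open>Morphisms form a sheaf.\<close>

lemma morphism_amalgamate:
  assumes "is_cocycle D" "is_cocycle E"
    and mor: "\<And>B H. (B, H) \<in> \<H> \<Longrightarrow> open B \<and> morphism_on B D E H"
    and agree: "\<And>B H B' H' t i j. \<lbrakk> (B, H) \<in> \<H>; (B', H') \<in> \<H>; t \<in> B; t \<in> B';
        t \<in> patch D i; t \<in> patch E j \<rbrakk> \<Longrightarrow> H j i t = H' j i t"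
  obtains K where "morphism_on (\<Union>(fst ` \<H>)) D E K"
    "\<And>B H t i j. \<lbrakk> (B, H) \<in> \<H>; t \<in> B; t \<in> patch D i; t \<in> patch E j \<rbrakk> \<Longrightarrow> K j i t = H j i t"
proof -
  define K where "K = (\<lambda>j i t. snd (SOME BH. BH \<in> \<H> \<and> t \<in> fst BH) j i t)"
  have K: "K j i t = H j i t" if "(B, H) \<in> \<H>" "t \<in> B" "t \<in> patch D i" "t \<in> patch E j" for B H t i j
  proof -
    define BH where "BH = (SOME BH. BH \<in> \<H> \<and> t \<in> fst BH)"
    have "\<exists>BH. BH \<in> \<H> \<and> t \<in> fst BH"
      using that by force
    then have "BH \<in> \<H> \<and> t \<in> fst BH"
      unfolding BH_def by (rule someI_ex)
    then have "snd BH j i t = H j i t"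
      using agree[of "fst BH" "snd BH" B H t i j] that by simp
    then show ?thesis
      unfolding K_def BH_def .
  qed
  have "morphism_on (\<Union>(fst ` \<H>)) D E K"
    unfolding morphism_on_def
  proof (intro allI impI)
    fix i j t assume t: "t \<in> \<Union>(fst ` \<H>)" "t \<in> patch D i" "t \<in> patch E j"
    then obtain B H where B: "(B, H) \<in> \<H>" "t \<in> B"
      by force
    have m: "open B" "morphism_on B D E H"
      using mor[OF B(1)] by auto
    note h = morphism_onD[OF m(2) B(2) t(2,3)]
    have "flat_at (K j i) t"
    proof (rule flat_cong[OF h(2)])
      show "open (B \<inter> patch D i \<inter> patch E j)"
        using m(1) is_cocycleD(1)[OF assms(1)] is_cocycleD(1)[OF assms(2)] by blast
    qed (use K[OF B(1)] t B in auto)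
    then show "arr (K j i t) \<and> flat_at (K j i) t \<and> src (K j i t) = obj D i t \<and> trg (K j i t) = obj E j t \<and>
        (\<forall>i'. t \<in> patch D i' \<longrightarrow> K j i' t \<cdot> glue D i' i t = K j i t) \<and>
        (\<forall>j'. t \<in> patch E j' \<longrightarrow> glue E j' j t \<cdot> K j i t = K j' i t)"
      using h t by (simp add: K[OF B])
  qed
  then show thesis
    using that K by blast
qed

text \<open>The trivial cocycle at the point \<open>A\<close>. Morphisms from it to \<open>D\<close> are the flat sections of \<open>D\<close> whose
  germs start at \<open>A\<close>.\<close>

definition const_cocycle :: "'x set \<times> 'y \<Rightarrow> ('x set \<times> 'y, 't) cocycle" where
  "const_cocycle A = \<lparr> patch = (\<lambda>i. if i = 0 then UNIV else {}), glue = (\<lambda>_ _ _. unit A) \<rparr>"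

lemma const_cocycle_simps [simp]:
  "t \<in> patch (const_cocycle A) i \<longleftrightarrow> i = 0" "glue (const_cocycle A) j i t = unit A"
  "obj (const_cocycle A) i t = A"
  by (auto simp: const_cocycle_def obj_def)

lemma is_cocycle_const: "point A \<Longrightarrow> is_cocycle (const_cocycle A)"
proof -
  assume A: "point A"
  have "glue (const_cocycle A) j i = (\<lambda>_. unit A)" for i j
    by (simp add: const_cocycle_def)
  moreover have "open (patch (const_cocycle A) i)" for i
    by (simp add: const_cocycle_def)
  ultimately show ?thesis
    using A flat_const[of "unit A"] unfolding is_cocycle_def by simp
qed

lemma morphism_near:
  assumes "is_cocycle D" "N \<subseteq> patch D i" "\<And>t. t \<in> N \<Longrightarrow> obj D i t = trg m" "arr m" "open N"
  shows "morphism_on N (const_cocycle (src m)) D (\<lambda>j _ t. glue D j i t \<cdot> m)"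
  unfolding morphism_on_def
proof (intro allI impI)
  fix k j t assume t: "t \<in> N" "t \<in> patch (const_cocycle (src m)) k" "t \<in> patch D j"
  have ti: "t \<in> patch D i" using assms t by blast
  have "flat_at (\<lambda>t. glue D j i t \<cdot> m) t"
  proof (rule flat_comp[OF flat_const[OF assms(4)] is_cocycleD(4)[OF assms(1) ti t(3)]])
    show "open (N \<inter> patch D j)"
      using assms(5) is_cocycleD(1)[OF assms(1)] by blast
    show "src (glue D j i s) = trg m" if "s \<in> N \<inter> patch D j" for s
      using that assms(2,3) is_cocycleD(5)[OF assms(1)] by auto
  qed (use t in simp)
  moreover have "(glue D j i t \<cdot> m) \<cdot> unit (src m) = glue D j i t \<cdot> m"
    using is_cocycleD[OF assms(1)] t ti assms by simp
  moreover have "glue D j' j t \<cdot> glue D j i t \<cdot> m = glue D j' i t \<cdot> m" if "t \<in> patch D j'" for j'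
    using is_cocycleD[OF assms(1)] t ti assms that by (simp flip: comp_assoc)
  ultimately show "arr (glue D j i t \<cdot> m) \<and> flat_at (\<lambda>t. glue D j i t \<cdot> m) t \<and>
      src (glue D j i t \<cdot> m) = obj (const_cocycle (src m)) k t \<and> trg (glue D j i t \<cdot> m) = obj D j t \<and>
      (\<forall>i'. t \<in> patch (const_cocycle (src m)) i' \<longrightarrow>
         (glue D j i t \<cdot> m) \<cdot> glue (const_cocycle (src m)) i' k t = glue D j i t \<cdot> m) \<and>
      (\<forall>j'. t \<in> patch D j' \<longrightarrow> glue D j' j t \<cdot> glue D j i t \<cdot> m = glue D j' i t \<cdot> m)"
    using is_cocycleD[OF assms(1)] t ti assms by simp
qed

text \<open>If the points of \<open>D\<close> are constant on each patch then flat sections exist locally with any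
  prescribed value. By uniqueness the sections through \<open>m\<close> on open intervals amalgamate to one on a
  largest such interval, and at an endpoint a local section would extend it. Some such
  hypothesis is needed: a flat section starting at a fixed point \<open>A\<close> forces the points of \<open>D\<close> to be
  locally constant.\<close>

lemma morphism_from_const_exists:
  assumes D: "is_cocycle D" and const: "\<And>i t s. t \<in> patch D i \<Longrightarrow> s \<in> patch D i \<Longrightarrow> obj D i t = obj D i s"
    and m: "arr m" "trg m = obj D i0 t0" "t0 \<in> patch D i0"
  obtains \<sigma> where "morphism_on UNIV (const_cocycle (src m)) D \<sigma>" "\<sigma> i0 0 t0 = m"
proof -
  let ?C = "const_cocycle (src m)"
  have C: "is_cocycle ?C"
    using is_cocycle_const arrD(1)[OF m(1)] .
  define \<H> where "\<H> = {(J, H). open J \<and> connected J \<and> t0 \<in> J \<and> morphism_on J ?C D H \<and> H i0 0 t0 = m}"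
  have mem: "(J, H) \<in> \<H> \<longleftrightarrow>
      open J \<and> connected J \<and> t0 \<in> J \<and> morphism_on J ?C D H \<and> H i0 0 t0 = m" for J H
    unfolding \<H>_def by simp
  have agree: "H j i t = H' j i t"
    if "open B" "open B'" "connected B" "connected B'" "morphism_on B ?C D H" "morphism_on B' ?C D H'"
      "t1 \<in> B" "t1 \<in> B'" "t1 \<in> patch D j1" "H j1 0 t1 = H' j1 0 t1"
      "t \<in> B" "t \<in> B'" "t \<in> patch ?C i" "t \<in> patch D j" for B H B' H' t i j t1 j1
  proof (rule morphism_unique[of "B \<inter> B'" ?C D H H' t1 0 j1])
    show "connected (B \<inter> B')"
      using that is_interval_Int is_interval_connected_1 by blast
  qed (use that C D morphism_on_subset[of B ?C D H "B \<inter> B'"]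
      morphism_on_subset[of B' ?C D H' "B \<inter> B'"] in \<open>auto simp: open_Int\<close>)
  have near: "\<exists>N. open N \<and> connected N \<and> t \<in> N \<and> N \<subseteq> patch D i" if t: "t \<in> patch D i" for t i
  proof -
    obtain \<epsilon> where "\<epsilon> > 0" "ball t \<epsilon> \<subseteq> patch D i"
      using openE[OF is_cocycleD(1)[OF D] t] by metis
    then show ?thesis
      by (intro exI[of _ "ball t \<epsilon>"]) auto
  qed
  let ?J = "\<Union>(fst ` \<H>)"
  obtain \<sigma> where \<sigma>: "morphism_on ?J ?C D \<sigma>"
    "\<And>B H t i j. \<lbrakk> (B, H) \<in> \<H>; t \<in> B; t \<in> patch ?C i; t \<in> patch D j \<rbrakk> \<Longrightarrow> \<sigma> j i t = H j i t"
  proof (rule morphism_amalgamate[OF C D, of \<H>])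
    show "open B \<and> morphism_on B ?C D H" if "(B, H) \<in> \<H>" for B H
      using that unfolding \<H>_def by blast
    show "H j i t = H' j i t" if "(B, H) \<in> \<H>" "(B', H') \<in> \<H>" "t \<in> B" "t \<in> B'"
      "t \<in> patch ?C i" "t \<in> patch D j" for B H B' H' t i j
      using that agree[of B B' H H' t0 i0 t i j] m(3) unfolding \<H>_def by auto
  qed blast
  have opJ: "open ?J"
    unfolding \<H>_def by auto
  have conJ: "connected ?J"
  proof (rule connected_Union)
    show "\<And>S. S \<in> fst ` \<H> \<Longrightarrow> connected S"
      unfolding \<H>_def by auto
    show "\<Inter> (fst ` \<H>) \<noteq> {}"
      unfolding \<H>_def by auto
  qed
  obtain N0 where N0: "open N0" "connected N0" "t0 \<in> N0" "N0 \<subseteq> patch D i0"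
    using near[OF m(3)] by blast
  have g1: "glue D i0 i0 t0 \<cdot> m = m"
    using cocycle_unit[OF D m(3)] m by simp
  have "(N0, \<lambda>j _ t. glue D j i0 t \<cdot> m) \<in> \<H>"
    using N0 morphism_near[OF D N0(4) _ m(1) N0(1)] const[OF _ m(3)] m(2) g1
    unfolding \<H>_def by auto
  then have t0J: "t0 \<in> ?J" "\<sigma> i0 0 t0 = m"
    using N0(3) \<sigma>(2)[OF _ N0(3), of _ 0 i0] m(3) g1 by (force, simp)
  have "closed ?J"
  proof -
    have "t1 \<in> ?J" if t1: "t1 \<in> closure ?J" for t1
    proof -
      obtain i where i: "t1 \<in> patch D i"
        using is_cocycleD(2)[OF D] by blast
      obtain N where N: "open N" "connected N" "t1 \<in> N" "N \<subseteq> patch D i"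
        using near[OF i] by blast
      obtain s where s: "s \<in> N" "s \<in> ?J"
        using t1 N unfolding closure_iff_nhds_not_empty by blast
      have si: "s \<in> patch D i" using s N by blast
      let ?c = "\<sigma> i 0 s"
      note c = morphism_onD[OF \<sigma>(1) s(2) _ si, of 0, simplified]
      let ?H = "\<lambda>j (_::nat) t. glue D j i t \<cdot> ?c"
      have H: "morphism_on N ?C D ?H"
        using morphism_near[OF D N(4), of ?c] N(1,4) c const[OF _ si] by auto
      have Hs: "?H i 0 s = ?c"
        using c(6)[OF si] by simp
      obtain K where K: "morphism_on (\<Union>(fst ` {(?J, \<sigma>), (N, ?H)})) ?C D K"
        "\<And>B H t i j. \<lbrakk> (B, H) \<in> {(?J, \<sigma>), (N, ?H)}; t \<in> B; t \<in> patch ?C i; t \<in> patch D j \<rbrakk>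
           \<Longrightarrow> K j i t = H j i t"
      proof (rule morphism_amalgamate[OF C D, of "{(?J, \<sigma>), (N, ?H)}"])
        show "open B \<and> morphism_on B ?C D H" if "(B, H) \<in> {(?J, \<sigma>), (N, ?H)}" for B H
          using that opJ \<sigma>(1) N(1) H by auto
        have ag: "\<sigma> j k t = ?H j k t" if "t \<in> ?J" "t \<in> N" "t \<in> patch ?C k" "t \<in> patch D j" for t j k
          using agree[OF opJ N(1) conJ N(2) \<sigma>(1) H s(2,1) si Hs[symmetric] that] .
        show "H j i t = H' j i t" if "(B, H) \<in> {(?J, \<sigma>), (N, ?H)}" "(B', H') \<in> {(?J, \<sigma>), (N, ?H)}"
          "t \<in> B" "t \<in> B'" "t \<in> patch ?C i" "t \<in> patch D j" for B H B' H' t i j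
        proof -
          have "(B = ?J \<and> H = \<sigma>) \<or> (B = N \<and> H = ?H)" "(B' = ?J \<and> H' = \<sigma>) \<or> (B' = N \<and> H' = ?H)"
            using that(1,2) by (simp_all only: insert_iff empty_iff prod.inject simp_thms)
          then show ?thesis
            using that(3-6)
            by (elim disjE conjE) (simp_all only: ag)
        qed
      qed blast
      have U: "\<Union>(fst ` {(?J, \<sigma>), (N, ?H)}) = ?J \<union> N" by auto
      have "connected (?J \<union> N)"
        using connected_Un[OF conJ N(2)] s by blast
      moreover have "K i0 0 t0 = m"
        using K(2)[of ?J \<sigma> t0 0 i0] t0J m(3) by simp
      ultimately have "(?J \<union> N, K) \<in> \<H>"
        using K(1) open_Un[OF opJ N(1)] t0J(1) unfolding mem U by blast
      then have "?J \<union> N \<subseteq> ?J"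
        by force
      then show ?thesis
        using N(3) by blast
    qed
    then show ?thesis
      using closure_subset_eq by blast
  qed
  then have "?J = UNIV"
    using opJ t0J(1) connected_UNIV[where 'a = real] clopen by (metis empty_iff)
  then show thesis
    using that \<sigma>(1) t0J(2) by simp
qed

end

section \<open>The circle as a quotient of the line\<close>

lemma circ_eq_iff: "circ s = circ t \<longleftrightarrow> (\<exists>m::int. s = t + of_int m)"
proof
  assume "circ s = circ t"
  then have "sin (2 * pi * s) = sin (2 * pi * t) \<and> cos (2 * pi * s) = cos (2 * pi * t)"
    unfolding circ_def by (metis cis.sel)
  then obtain n :: int where "2 * pi * s = 2 * pi * t + 2 * pi * of_int n"
    unfolding sin_cos_eq_iff by auto
  then have "2 * pi * s = 2 * pi * (t + of_int n)"
    by (simp add: algebra_simps)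
  then show "\<exists>m::int. s = t + of_int m"
    by auto
next
  assume "\<exists>m::int. s = t + of_int m"
  then obtain m :: int where "s = t + of_int m" by blast
  then have "2 * pi * s = 2 * pi * t + 2 * pi * of_int m"
    by (simp add: algebra_simps)
  then show "circ s = circ t"
    unfolding circ_def using sin_cos_eq_iff[of "2 * pi * s" "2 * pi * t"]
    by (auto simp: complex_eq_iff)
qed

lemma circ_add_int [simp]: "circ (t + of_int m) = circ t"
  by (auto simp: circ_eq_iff)

lemma circ_add_1 [simp]: "circ (t + 1) = circ t"
  using circ_add_int[of t 1] by simp

lemma circ_add: "circ (s + t) = circ s * circ t"
  by (simp add: circ_def cis_mult algebra_simps)

lemma circ_nonzero [simp]: "circ t \<noteq> 0"
  by (simp add: circ_def)

lemma circ_diff: "circ (s - t) = circ s / circ t"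
  using circ_add[of "s - t" t] by (simp add: field_simps)

lemma circ_in_circle [simp]: "circ t \<in> circle"
  by (simp add: circ_def)

lemma circ_surj:
  assumes "w \<in> circle"
  obtains t where "w = circ t"
proof -
  have "w \<noteq> 0" "norm w = 1"
    using assms by auto
  then have "circ (Arg w / (2 * pi)) = w"
    using cis_Arg[of w] by (simp add: circ_def sgn_div_norm)
  then show thesis
    using that by metis
qed

lemma continuous_circ: "continuous_on S circ"
  unfolding circ_def by (intro continuous_intros)

lemma open_arc_lift:
  assumes "open_arc I"
  shows "open {t. circ t \<in> I}"
proof -
  obtain a b where I: "I = circ ` {a<..<b}"
    using assms unfolding open_arc_def by blast
  have "{t. circ t \<in> I} = (\<Union>m::int. {a + of_int m<..<b + of_int m})"
  proof (intro subset_antisym subsetI)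
    fix t assume "t \<in> {t. circ t \<in> I}"
    then obtain s m where "t = s + of_int m" "s \<in> {a<..<b}"
      unfolding I by (auto simp: circ_eq_iff)
    then show "t \<in> (\<Union>m::int. {a + of_int m<..<b + of_int m})"
      by (auto intro!: exI[of _ m])
  next
    fix t assume "t \<in> (\<Union>m::int. {a + of_int m<..<b + of_int m})"
    then obtain m :: int where "a + of_int m < t" "t < b + of_int m"
      by auto
    then have "t - of_int m \<in> {a<..<b}"
      by auto
    then have "circ (t - of_int m) \<in> I"
      unfolding I by blast
    then show "t \<in> {t. circ t \<in> I}"
      using circ_add_int[of "t - of_int m" m] by simp
  qed
  then show ?thesis
    by auto
qed

lemma open_arc_connected:
  assumes "open_arc I" shows "connected I"
proof -
  obtain a b where I: "I = circ ` {a<..<b}"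
    using assms unfolding open_arc_def by blast
  show ?thesis
    unfolding I by (intro connected_continuous_image continuous_circ) simp
qed

lemma open_arc_sub_circle: "open_arc I \<Longrightarrow> I \<subseteq> circle"
  unfolding open_arc_def using circ_in_circle by blast

lemma cyclic_coverD:
  assumes "cyclic_cover n I"
  shows "i \<le> n \<Longrightarrow> open_arc (I i)" "w \<in> circle \<Longrightarrow> \<exists>i\<le>n. w \<in> I i"
    "\<lbrakk> i \<le> n; j \<le> n; k \<le> n; i \<noteq> j; j \<noteq> k; i \<noteq> k \<rbrakk> \<Longrightarrow> I i \<inter> I j \<inter> I k = {}"
proof -
  have a: "\<forall>i\<le>n. open_arc (I i)" and u: "(\<Union>i\<le>n. I i) = circle"
    and t: "\<forall>i\<le>n. \<forall>j\<le>n. \<forall>k\<le>n. i \<noteq> j \<and> j \<noteq> k \<and> i \<noteq> k \<longrightarrow> I i \<inter> I j \<inter> I k = {}"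
    using assms unfolding cyclic_cover_def by - (elim conjE, assumption)+
  show "i \<le> n \<Longrightarrow> open_arc (I i)"
    using a by simp
  show "\<exists>i\<le>n. w \<in> I i" if "w \<in> circle"
    using that unfolding u[symmetric] by auto
  show "\<lbrakk> i \<le> n; j \<le> n; k \<le> n; i \<noteq> j; j \<noteq> k; i \<noteq> k \<rbrakk> \<Longrightarrow> I i \<inter> I j \<inter> I k = {}"
    using t by simp
qed

section \<open>Loop systems as periodic cocycles\<close>

text \<open>Pulling a loop system back along \<open>circ\<close> replaces the circle by a simply connected base, where flat
  sections exist; the price is to keep track of the period \<open>1\<close>.\<close>

definition loop_cocycle ::
  "('x, 'y, 't) loop_system \<Rightarrow> ('x set \<times> 'y, 't) cocycle" where
  "loop_cocycle s =
     \<lparr> patch = (\<lambda>i. {t. i \<le> top_index s \<and> circ t \<in> arc s i}),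
       glue = (\<lambda>j i t. Germ (chart s i, lft s i (circ t)) (gl s j i) (chart s j, lft s j (circ t))) \<rparr>"

lemma patch_loop [simp]: "t \<in> patch (loop_cocycle s) i \<longleftrightarrow> i \<le> top_index s \<and> circ t \<in> arc s i"
  by (simp add: loop_cocycle_def)

lemma glue_loop:
  "glue (loop_cocycle s) j i t =
     Germ (chart s i, lft s i (circ t)) (gl s j i) (chart s j, lft s j (circ t))"
  by (simp add: loop_cocycle_def)

lemma glue_loop_periodic: "glue (loop_cocycle s) j i (t + 1) = glue (loop_cocycle s) j i t"
  by (simp add: glue_loop)

context orbispace
begin

lemma obj_loop [simp]: "obj (loop_cocycle s) i t = (chart s i, lft s i (circ t))"
  by (simp add: obj_def glue_loop)

lemma loop_systemD:
  assumes "s \<in> loop_systems X" 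
  shows "cyclic_cover (top_index s) (arc s)"
    "i \<le> top_index s \<Longrightarrow> chart s i \<in> basic X"
    "i \<le> top_index s \<Longrightarrow> continuous_map (top_of_set (arc s i)) (hat X (chart s i)) (lft s i)"
    "i \<le> top_index s \<Longrightarrow> gl s i i = aut X (chart s i) \<one>\<^bsub>grp X (chart s i)\<^esub>"
    "\<lbrakk> i \<le> top_index s; j \<le> top_index s; w \<in> arc s i; w \<in> arc s j \<rbrakk> \<Longrightarrow>
       gl s j i \<in> Tran X (chart s i) (chart s j) \<and>
       lft s i w \<in> tdom X (chart s i) (chart s j) (gl s j i) \<and>
       lft s j w = tmap X (chart s i) (chart s j) (gl s j i) (lft s i w) \<and>
       tcomp X (chart s i) (chart s j) (chart s i) (gl s i j) (gl s j i) (lft s i w)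
         = aut X (chart s i) \<one>\<^bsub>grp X (chart s i)\<^esub>"
  using assms unfolding loop_systems_def is_loop_system_def meets_def by auto

text \<open>No three arcs meet, so the cocycle identity only has to be checked when two of the three
  indices coincide; there it says that \<open>gl s i i\<close> is a unit and \<open>gl s i j\<close>, \<open>gl s j i\<close> are inverse.\<close>

lemma is_cocycle_loop:
  assumes s: "s \<in> loop_systems X"
  shows "is_cocycle (loop_cocycle s)"
proof -
  let ?D = "loop_cocycle s"
  note c = cyclic_coverD[OF loop_systemD(1)[OF s]]
  have op: "open (patch ?D i)" for i
  proof (cases "i \<le> top_index s")
    case True
    then have "patch ?D i = {t. circ t \<in> arc s i}"
      by auto
    then show ?thesis
      using open_arc_lift c(1)[OF True] by simp
  next
    case False
    then have "patch ?D i = {}" by auto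
    then show ?thesis by simp
  qed
  have cov: "\<exists>i. t \<in> patch ?D i" for t
    using c(2)[OF circ_in_circle, of t] by auto
  have arr: "arr (glue ?D j i t)" if "t \<in> patch ?D i" "t \<in> patch ?D j" for i j t
    using that loop_systemD(2,5)[OF s] unfolding arr_def glue_loop by auto
  have unit: "glue ?D i i t = unit (obj ?D i t)" if "t \<in> patch ?D i" for i t
    using that loop_systemD(4)[OF s] unfolding unit_def glue_loop by auto
  have comp: "glue ?D k j t \<cdot> glue ?D j i t = glue ?D k i t"
    if t: "t \<in> patch ?D i" "t \<in> patch ?D j" "t \<in> patch ?D k" for i j k t
  proof -
    have "i = j \<or> j = k \<or> i = k"
      using c(3)[of i j k] t by auto
    moreover have "glue ?D i j t \<cdot> glue ?D j i t = unit (obj ?D i t)"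
      using loop_systemD(5)[OF s, of i j "circ t"] t
      by (simp add: comp_def unit_def glue_loop)
    ultimately show ?thesis
      using arr[OF t(1,2)] arr[OF t(2,3)] unit t by (auto simp: glue_loop)
  qed
  have cont: "continuous_map (top_of_set (patch ?D i)) (hat X (chart s i)) (\<lambda>t. lft s i (circ t))"
    if "i \<le> top_index s" for i
  proof -
    have "continuous_map (top_of_set (patch ?D i)) (top_of_set (arc s i)) circ"
      using continuous_circ by (auto simp: continuous_map_in_subtopology)
    then show ?thesis
      using continuous_map_compose loop_systemD(3)[OF s that] unfolding o_def by blast
  qed
  have "flat_at (glue ?D j i) t" if t: "t \<in> patch ?D i" "t \<in> patch ?D j" for i j t
    unfolding flat_at_def
  proof (intro exI conjI ballI)
    show "open (patch ?D i \<inter> patch ?D j)"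
      using op by blast
    show "continuous_map (top_of_set (patch ?D i \<inter> patch ?D j)) (hat X (chart s i))
        (\<lambda>t. lft s i (circ t))"
      using t by (intro continuous_map_from_subtopology_mono[OF cont]) auto
    show "glue ?D j i r = Germ (chart s i, lft s i (circ r)) (gl s j i)
         (chart s j, tmap X (chart s i) (chart s j) (gl s j i) (lft s i (circ r)))"
      if "r \<in> patch ?D i \<inter> patch ?D j" for r
      using that loop_systemD(5)[OF s] by (auto simp: glue_loop)
    show "arr (glue ?D j i r)" if "r \<in> patch ?D i \<inter> patch ?D j" for r
      using that arr by blast
  qed (use t in simp)
  then show ?thesis
    unfolding is_cocycle_def using op cov arr comp by (simp add: glue_loop)
qed

text \<open>Periodic morphisms are the morphisms of loop systems over the circle itself.\<close>

definition periodic_morphism ::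
  "('x, 'y, 't) loop_system \<Rightarrow> ('x, 'y, 't) loop_system \<Rightarrow>
     (nat \<Rightarrow> nat \<Rightarrow> real \<Rightarrow> ('x set \<times> 'y, 't) germ) \<Rightarrow> bool" where
  "periodic_morphism s u H \<longleftrightarrow>
     morphism_on UNIV (loop_cocycle s) (loop_cocycle u) H \<and>
     (\<forall>i j t. t \<in> patch (loop_cocycle s) i \<longrightarrow> t \<in> patch (loop_cocycle u) j \<longrightarrow>
        H j i (t + 1) = H j i t)"

definition loop_equiv :: "('x, 'y, 't) loop_system \<Rightarrow> ('x, 'y, 't) loop_system \<Rightarrow> bool" where
  "loop_equiv s u \<longleftrightarrow> (\<exists>H. periodic_morphism s u H)"

lemma loop_equiv_sym:
  assumes "s \<in> loop_systems X" "u \<in> loop_systems X" "loop_equiv s u"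
  shows "loop_equiv u s"
proof -
  obtain H where "periodic_morphism s u H"
    using assms(3) unfolding loop_equiv_def by blast
  then have "periodic_morphism u s (\<lambda>i j t. inverse_germ (H j i t))"
    using morphism_inverse[OF is_cocycle_loop[OF assms(1)] is_cocycle_loop[OF assms(2)]]
    unfolding periodic_morphism_def by auto
  then show ?thesis
    unfolding loop_equiv_def by blast
qed

lemma loop_equiv_trans:
  assumes "s \<in> loop_systems X" "u \<in> loop_systems X" "v \<in> loop_systems X"
    "loop_equiv s u" "loop_equiv u v"
  shows "loop_equiv s v"
proof -
  note c = is_cocycle_loop[OF assms(1)] is_cocycle_loop[OF assms(2)] is_cocycle_loop[OF assms(3)]
  obtain H K where H: "periodic_morphism s u H" and K: "periodic_morphism u v K"
    using assms(4,5) unfolding loop_equiv_def by blast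
  note HK = H[unfolded periodic_morphism_def] K[unfolded periodic_morphism_def]
  let ?M = "compose_morphism (loop_cocycle u) K H"
  have "morphism_on UNIV (loop_cocycle s) (loop_cocycle v) ?M"
    using morphism_compose[OF open_UNIV c] HK by blast
  moreover have "?M k i (t + 1) = ?M k i t"
    if t: "t \<in> patch (loop_cocycle s) i" "t \<in> patch (loop_cocycle v) k" for i k t
  proof -
    obtain j where j: "t \<in> patch (loop_cocycle u) j"
      using is_cocycleD(2)[OF c(2)] by blast
    have "?M k i t = K k j t \<cdot> H j i t" "?M k i (t + 1) = K k j (t + 1) \<cdot> H j i (t + 1)"
      using compose_morphism_eq[OF c(2), of UNIV _ H _ K] HK t j by auto
    then show ?thesis
      using HK t j by simp
  qed
  ultimately show ?thesis
    unfolding loop_equiv_def periodic_morphism_def by blast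
qed

section \<open>Holonomy\<close>

text \<open>A flat section on the line starting at the point \<open>src g\<close> which \<open>g\<close> closes up after one turn. It
  trivialises the system over the line, so together with the period it determines the loop.\<close>

definition has_holonomy ::
  "('x, 'y, 't) loop_system \<Rightarrow> ('x set \<times> 'y, 't) germ \<Rightarrow> bool" where
  "has_holonomy s g \<longleftrightarrow>
     arr g \<and> src g = trg g \<and>
     (\<exists>\<sigma>. morphism_on UNIV (const_cocycle (src g)) (loop_cocycle s) \<sigma> \<and>
        (\<forall>i t. t \<in> patch (loop_cocycle s) i \<longrightarrow> \<sigma> i 0 (t + 1) = \<sigma> i 0 t \<cdot> g))"

lemma has_holonomyE:
  assumes "has_holonomy s g"
  obtains \<sigma> where "arr g" "src g = trg g" "is_cocycle (const_cocycle (src g))"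
    "morphism_on UNIV (const_cocycle (src g)) (loop_cocycle s) \<sigma>"
    "\<And>i t. i \<le> top_index s \<Longrightarrow> circ t \<in> arc s i \<Longrightarrow> \<sigma> i 0 (t + 1) = \<sigma> i 0 t \<cdot> g"
proof -
  obtain \<sigma> where \<sigma>: "morphism_on UNIV (const_cocycle (src g)) (loop_cocycle s) \<sigma>"
    "\<forall>i t. t \<in> patch (loop_cocycle s) i \<longrightarrow> \<sigma> i 0 (t + 1) = \<sigma> i 0 t \<cdot> g"
    and g: "arr g" "src g = trg g"
    using assms unfolding has_holonomy_def by metis
  show thesis
    by (rule that[OF g is_cocycle_const[OF arrD(1)[OF g(1)]] \<sigma>(1)]) (simp add: \<sigma>(2))
qed

lemma section_germ:
  assumes "morphism_on UNIV (const_cocycle A) (loop_cocycle s) \<sigma>" "i \<le> top_index s" "circ t \<in> arc s i"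
  shows "arr (\<sigma> i 0 t)" "src (\<sigma> i 0 t) = A" "trg (\<sigma> i 0 t) = (chart s i, lft s i (circ t))"
  using morphism_onD(1,3,4)[OF assms(1), of t 0 i] assms(2,3) by auto

text \<open>Going back along a section \<open>\<sigma>\<close> of \<open>s\<close> and forth along a section \<open>\<tau>\<close> of \<open>u\<close> is a morphism, which is
  periodic since the factor \<open>g\<close> cancels.\<close>

lemma equiv_of_same_holonomy:
  assumes "s \<in> loop_systems X" "u \<in> loop_systems X" "has_holonomy s g" "has_holonomy u g"
  shows "loop_equiv s u"
proof -
  note c = is_cocycle_loop[OF assms(1)] is_cocycle_loop[OF assms(2)]
  obtain \<sigma> where \<sigma>: "arr g" "src g = trg g" "is_cocycle (const_cocycle (src g))"
    "morphism_on UNIV (const_cocycle (src g)) (loop_cocycle s) \<sigma>"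
    "\<And>i t. i \<le> top_index s \<Longrightarrow> circ t \<in> arc s i \<Longrightarrow> \<sigma> i 0 (t + 1) = \<sigma> i 0 t \<cdot> g"
    using has_holonomyE[OF assms(3)] by metis
  obtain \<tau> where \<tau>: "morphism_on UNIV (const_cocycle (src g)) (loop_cocycle u) \<tau>"
    "\<And>i t. i \<le> top_index u \<Longrightarrow> circ t \<in> arc u i \<Longrightarrow> \<tau> i 0 (t + 1) = \<tau> i 0 t \<cdot> g"
    using has_holonomyE[OF assms(4)] by metis
  note inv = morphism_inverse[OF \<sigma>(3) c(1) \<sigma>(4)]
  let ?M = "compose_morphism (const_cocycle (src g)) \<tau> (\<lambda>i j t. inverse_germ (\<sigma> j i t))"
  have M: "morphism_on UNIV (loop_cocycle s) (loop_cocycle u) ?M"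
    using morphism_compose[OF open_UNIV c(1) \<sigma>(3) c(2) inv \<tau>(1)] .
  have eq: "?M j i t = \<tau> j 0 t \<cdot> inverse_germ (\<sigma> i 0 t)"
    if "i \<le> top_index s" "circ t \<in> arc s i" "j \<le> top_index u" "circ t \<in> arc u j" for i j t
    using compose_morphism_eq[OF \<sigma>(3) inv \<tau>(1), of t i 0 j] that by simp
  have "?M j i (t + 1) = ?M j i t"
    if t: "i \<le> top_index s" "circ t \<in> arc s i" "j \<le> top_index u" "circ t \<in> arc u j" for i j t
  proof -
    note gs = section_germ[OF \<sigma>(4) t(1,2)] section_germ[OF \<tau>(1) t(3,4)]
    have "?M j i (t + 1) = (\<tau> j 0 t \<cdot> g) \<cdot> inverse_germ (\<sigma> i 0 t \<cdot> g)"
      using eq[of i "t + 1" j] t \<sigma>(5) \<tau>(2) by simp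
    also have "\<dots> = \<tau> j 0 t \<cdot> g \<cdot> inverse_germ g \<cdot> inverse_germ (\<sigma> i 0 t)"
      using \<sigma>(1,2) gs by (simp add: inverse_of_comp comp_assoc del: comp_inverse_assoc)
    also have "\<dots> = \<tau> j 0 t \<cdot> inverse_germ (\<sigma> i 0 t)"
      using \<sigma>(1,2) gs by simp
    finally show ?thesis
      using eq t by simp
  qed
  then show ?thesis
    using M unfolding loop_equiv_def periodic_morphism_def by auto
qed

lemma holonomy_of_equiv:
  assumes "s \<in> loop_systems X" "u \<in> loop_systems X" "has_holonomy s g" "loop_equiv s u"
  shows "has_holonomy u g"
proof -
  note c = is_cocycle_loop[OF assms(1)] is_cocycle_loop[OF assms(2)]
  obtain \<sigma> where \<sigma>: "arr g" "src g = trg g" "is_cocycle (const_cocycle (src g))"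
    "morphism_on UNIV (const_cocycle (src g)) (loop_cocycle s) \<sigma>"
    "\<And>i t. i \<le> top_index s \<Longrightarrow> circ t \<in> arc s i \<Longrightarrow> \<sigma> i 0 (t + 1) = \<sigma> i 0 t \<cdot> g"
    using has_holonomyE[OF assms(3)] by metis
  obtain H where H: "morphism_on UNIV (loop_cocycle s) (loop_cocycle u) H"
    "\<And>i j t. \<lbrakk> t \<in> patch (loop_cocycle s) i; t \<in> patch (loop_cocycle u) j \<rbrakk> \<Longrightarrow> H j i (t + 1) = H j i t"
    using assms(4) unfolding loop_equiv_def periodic_morphism_def by blast
  let ?M = "compose_morphism (loop_cocycle s) H \<sigma>"
  have M: "morphism_on UNIV (const_cocycle (src g)) (loop_cocycle u) ?M"
    using morphism_compose[OF open_UNIV \<sigma>(3) c \<sigma>(4) H(1)] .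
  have "?M j 0 (t + 1) = ?M j 0 t \<cdot> g" if t: "t \<in> patch (loop_cocycle u) j" for j t
  proof -
    obtain i where i: "t \<in> patch (loop_cocycle s) i"
      using is_cocycleD(2)[OF c(1)] by blast
    have "?M j 0 t = H j i t \<cdot> \<sigma> i 0 t" "?M j 0 (t + 1) = H j i (t + 1) \<cdot> \<sigma> i 0 (t + 1)"
      using compose_morphism_eq[OF c(1) \<sigma>(4) H(1), of _ 0 i j] i t by auto
    then show ?thesis
      using H(2)[OF i t] \<sigma>(5)[of i t] i t morphism_onD[OF H(1) UNIV_I i t] \<sigma>(1,2)
        section_germ[OF \<sigma>(4), of i t] by (simp add: comp_assoc)
  qed
  then show ?thesis
    using M \<sigma>(1,2) unfolding has_holonomy_def by blast
qed

lemma holonomy_change_base: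
  assumes s: "s \<in> loop_systems X" "has_holonomy s g" and k: "arr k" "trg k = src g"
  shows "has_holonomy s (inverse_germ k \<cdot> g \<cdot> k)"
proof -
  obtain \<sigma> where \<sigma>: "arr g" "src g = trg g" "is_cocycle (const_cocycle (src g))"
    "morphism_on UNIV (const_cocycle (src g)) (loop_cocycle s) \<sigma>"
    "\<And>i t. i \<le> top_index s \<Longrightarrow> circ t \<in> arc s i \<Longrightarrow> \<sigma> i 0 (t + 1) = \<sigma> i 0 t \<cdot> g"
    using has_holonomyE[OF s(2)] by metis
  let ?h = "inverse_germ k \<cdot> g \<cdot> k"
  have c: "is_cocycle (const_cocycle (src k))"
    using is_cocycle_const arrD(1) k(1) by blast
  have "morphism_on UNIV (const_cocycle (src k)) (const_cocycle (src g)) (\<lambda>_ _ _. k)"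
    unfolding morphism_on_def using k flat_const[OF k(1)] by simp
  note m = morphism_compose[OF open_UNIV c \<sigma>(3) is_cocycle_loop[OF s(1)] this \<sigma>(4)]
    and eq = compose_morphism_eq[OF \<sigma>(3) this \<sigma>(4), of _ 0 0, simplified]
  have "compose_morphism (const_cocycle (src g)) \<sigma> (\<lambda>_ _ _. k) i 0 (t + 1) =
      compose_morphism (const_cocycle (src g)) \<sigma> (\<lambda>_ _ _. k) i 0 t \<cdot> ?h"
    if t: "t \<in> patch (loop_cocycle s) i" for i t
    using eq t \<sigma>(1,2,5) k section_germ[OF \<sigma>(4), of i t] by (simp add: comp_assoc)
  then show ?thesis
    using m \<sigma>(1,2) k unfolding has_holonomy_def by auto
qed

text \<open>Going forth along one section and back along the other gives a flat family of germs between two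
  fixed points, which is constant; comparing its values at \<open>0\<close> and \<open>1\<close> gives the conjugation.\<close>

lemma holonomy_unique:
  assumes s: "s \<in> loop_systems X" "has_holonomy s g" "has_holonomy s h"
  obtains k where "arr k" "src k = src g" "trg k = src h" "k \<cdot> g = h \<cdot> k"
proof -
  obtain \<sigma> where \<sigma>: "arr g" "src g = trg g" "is_cocycle (const_cocycle (src g))"
    "morphism_on UNIV (const_cocycle (src g)) (loop_cocycle s) \<sigma>"
    "\<And>i t. i \<le> top_index s \<Longrightarrow> circ t \<in> arc s i \<Longrightarrow> \<sigma> i 0 (t + 1) = \<sigma> i 0 t \<cdot> g"
    using has_holonomyE[OF s(2)] by metis
  obtain \<tau> where \<tau>: "arr h" "src h = trg h" "is_cocycle (const_cocycle (src h))"
    "morphism_on UNIV (const_cocycle (src h)) (loop_cocycle s) \<tau>"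
    "\<And>i t. i \<le> top_index s \<Longrightarrow> circ t \<in> arc s i \<Longrightarrow> \<tau> i 0 (t + 1) = \<tau> i 0 t \<cdot> h"
    using has_holonomyE[OF s(3)] by metis
  note c = is_cocycle_loop[OF s(1)]
  note inv = morphism_inverse[OF \<tau>(3) c \<tau>(4)]
  let ?M = "compose_morphism (loop_cocycle s) (\<lambda>i j t. inverse_germ (\<tau> j i t)) \<sigma>"
  have M: "morphism_on UNIV (const_cocycle (src g)) (const_cocycle (src h)) ?M"
    using morphism_compose[OF open_UNIV \<sigma>(3) c \<tau>(3) \<sigma>(4) inv] .
  let ?k = "?M 0 0 0"
  note k = morphism_onD[OF M UNIV_I, of 0 0 0, simplified]
  have "morphism_on UNIV (const_cocycle (src g)) (const_cocycle (src h)) (\<lambda>_ _ _. ?k)"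
    unfolding morphism_on_def using k flat_const[OF k(1)] by simp
  from morphism_unique[OF open_UNIV connected_UNIV \<sigma>(3) \<tau>(3) M this, of 0 0 0 1 0 0]
  have k1: "?M 0 0 1 = ?k"
    by simp
  obtain i where i: "i \<le> top_index s" "circ 0 \<in> arc s i"
    using is_cocycleD(2)[OF c, of 0] by auto
  have i1: "circ 1 \<in> arc s i"
    using i circ_add_1[of 0] by simp
  note gs = section_germ[OF \<sigma>(4) i] section_germ[OF \<tau>(4) i]
  have k0: "?k = inverse_germ (\<tau> i 0 0) \<cdot> \<sigma> i 0 0"
    using compose_morphism_eq[OF c \<sigma>(4) inv, of 0 0 i 0] i by simp
  have "?k = inverse_germ (\<tau> i 0 0 \<cdot> h) \<cdot> \<sigma> i 0 0 \<cdot> g"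
    using k1 compose_morphism_eq[OF c \<sigma>(4) inv, of 1 0 i 0] i i1 \<sigma>(5)[OF i] \<tau>(5)[OF i] by simp
  also have "\<dots> = inverse_germ h \<cdot> ?k \<cdot> g"
    unfolding k0 using \<sigma>(1,2) \<tau>(1,2) gs by (simp add: inverse_of_comp comp_assoc)
  finally have "h \<cdot> ?k = h \<cdot> inverse_germ h \<cdot> ?k \<cdot> g"
    by simp
  then have "?k \<cdot> g = h \<cdot> ?k"
    using \<sigma>(1,2) \<tau>(1,2) k by simp
  then show thesis
    using that k by blast
qed

lemma flat_translate:
  assumes "flat_at p (t + c)"
  shows "flat_at (\<lambda>t. p (t + c)) t"
proof -
  obtain N a b \<xi> x where N: "open N" "t + c \<in> N" "continuous_map (top_of_set N) (hat X a) x"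
    "\<And>s. s \<in> N \<Longrightarrow> p s = Germ (a, x s) \<xi> (b, tmap X a b \<xi> (x s))" "\<And>s. s \<in> N \<Longrightarrow> arr (p s)"
    using flat_atE[OF assms] by metis
  let ?N = "(\<lambda>t. t + c) -` N"
  have "continuous_map (top_of_set ?N) (top_of_set N) (\<lambda>t. t + c)"
    by (auto simp: continuous_map_in_subtopology intro!: continuous_intros)
  then have "continuous_map (top_of_set ?N) (hat X a) (\<lambda>t. x (t + c))"
    using continuous_map_compose N(3) unfolding o_def by blast
  moreover have "open ?N"
    by (intro open_vimage N continuous_intros)
  ultimately show ?thesis
    unfolding flat_at_def using N
    by (intro exI[of _ ?N] exI[of _ a] exI[of _ b] exI[of _ \<xi>] exI[of _ "\<lambda>t. x (t + c)"]) auto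
qed

lemma morphism_translate:
  assumes "morphism_on UNIV (const_cocycle A) D \<sigma>"
    "\<And>i t. t \<in> patch E i \<longleftrightarrow> t + c \<in> patch D i" "\<And>i j t. glue E j i t = glue D j i (t + c)"
  shows "morphism_on UNIV (const_cocycle A) E (\<lambda>i k t. \<sigma> i k (t + c))"
  unfolding morphism_on_def
proof (intro allI impI)
  fix k j t assume t: "t \<in> UNIV" "t \<in> patch (const_cocycle A) k" "t \<in> patch E j"
  have t': "t + c \<in> patch (const_cocycle A) k" "t + c \<in> patch D j"
    using t assms(2) by auto
  note m = morphism_onD[OF assms(1) UNIV_I t']
  show "arr (\<sigma> j k (t + c)) \<and> flat_at (\<lambda>t. \<sigma> j k (t + c)) t \<and>
      src (\<sigma> j k (t + c)) = obj (const_cocycle A) k t \<and> trg (\<sigma> j k (t + c)) = obj E j t \<and>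
      (\<forall>i'. t \<in> patch (const_cocycle A) i' \<longrightarrow>
         \<sigma> j i' (t + c) \<cdot> glue (const_cocycle A) i' k t = \<sigma> j k (t + c)) \<and>
      (\<forall>j'. t \<in> patch E j' \<longrightarrow> glue E j' j t \<cdot> \<sigma> j k (t + c) = \<sigma> j' k (t + c))"
    using m flat_translate[OF m(2)] t assms(2,3) by (simp add: obj_def)
qed

text \<open>With constant lifts there is a flat section \<open>\<sigma>\<close> on the whole line starting with a unit at \<open>0\<close>. Its
  value at \<open>1\<close> is the holonomy, by uniqueness of flat sections.\<close>

lemma holonomy_of_const_lifts:
  assumes s: "s \<in> loop_systems X"
    and const: "\<And>i w w'. \<lbrakk> i \<le> top_index s; w \<in> arc s i; w' \<in> arc s i \<rbrakk> \<Longrightarrow> lft s i w = lft s i w'"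
  obtains g where "has_holonomy s g"
proof -
  let ?D = "loop_cocycle s"
  note D = is_cocycle_loop[OF s]
  obtain i where i: "i \<le> top_index s" "circ 0 \<in> arc s i"
    using is_cocycleD(2)[OF D, of 0] by auto
  have i1: "circ 1 \<in> arc s i"
    using i circ_add_1[of 0] by simp
  define A where "A = obj ?D i 0"
  have A: "point A"
    unfolding A_def using is_cocycleD(8)[OF D, of 0 i] i by simp
  obtain \<sigma> where \<sigma>: "morphism_on UNIV (const_cocycle A) ?D \<sigma>" "\<sigma> i 0 0 = unit A"
  proof (rule morphism_from_const_exists[OF D, of "unit A" i 0])
    show "obj ?D j t = obj ?D j r" if "t \<in> patch ?D j" "r \<in> patch ?D j" for j t r
      using const[of j "circ t" "circ r"] that by simp
  qed (use A i in \<open>auto simp: A_def\<close>)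
  have g: "arr (\<sigma> i 0 1)" "src (\<sigma> i 0 1) = A" "trg (\<sigma> i 0 1) = A"
    using section_germ[OF \<sigma>(1) i(1) i1] i circ_add_1[of 0] unfolding A_def by auto
  let ?g = "\<sigma> i 0 1"
  \<comment> \<open>The translate of \<open>\<sigma>\<close> by \<open>1\<close> and \<open>\<sigma>\<close> followed by \<open>g\<close> agree at \<open>0\<close>.\<close>
  have shift: "morphism_on UNIV (const_cocycle A) ?D (\<lambda>i k t. \<sigma> i k (t + 1))"
    using morphism_translate[OF \<sigma>(1), of ?D 1] by (simp add: glue_loop)
  have C: "is_cocycle (const_cocycle A)"
    using is_cocycle_const[OF A] .
  have "morphism_on UNIV (const_cocycle A) (const_cocycle A) (\<lambda>_ _ _. ?g)"
    unfolding morphism_on_def using g flat_const[OF g(1)] by simp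
  note comp = morphism_compose[OF open_UNIV C C D this \<sigma>(1)]
    and eq = compose_morphism_eq[OF C this \<sigma>(1), of _ 0 0, simplified]
  have "\<sigma> j 0 (t + 1) = \<sigma> j 0 t \<cdot> ?g" if t: "t \<in> patch ?D j" for j t
    using morphism_unique[OF open_UNIV connected_UNIV C D shift comp, of 0 0 i t 0 j]
      eq[where t = 0 and k = i] eq[where t = t and k = j] t i \<sigma>(2) g by simp
  then have "has_holonomy s ?g"
    unfolding has_holonomy_def using g \<sigma>(1) by auto
  then show thesis
    using that by blast
qed

end

section \<open>Regular cyclic covers\<close>

text \<open>Interval \<open>k\<close> starts at the \<open>k\<close>-th multiple of \<open>1/N\<close> and is \<open>3/2\<close> times as long as \<open>1/N\<close>, so that, for
  \<open>N \<ge> 3\<close>, its image in the circle meets those of its two neighbours and no others. For \<open>N = 3\<close> these are the intervals of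
  the constant loops.\<close>

definition step_interval :: "nat \<Rightarrow> nat \<Rightarrow> real set" where
  "step_interval N k = {real k / real N <..< real k / real N + 3 / (2 * real N)}"

lemma step_interval_iff:
  "N > 0 \<Longrightarrow> x \<in> step_interval N k \<longleftrightarrow> real k < N * x \<and> 2 * (N * x) < 2 * real k + 3"
  unfolding step_interval_def by (auto simp: field_simps)

text \<open>In units of \<open>1/N\<close> the shift is a multiple of \<open>N\<close> that differs from \<open>l - k\<close> by less than \<open>3/2\<close>.\<close>

lemma step_interval_overlap:
  assumes "k < l" "l < N" "3 \<le> N" "x \<in> step_interval N k" "x + of_int m \<in> step_interval N l"
  shows "m = 0 \<and> l = Suc k \<or> m = 1 \<and> k = 0 \<and> Suc l = N"
proof -
  define z where "z = int N * m"
  have N: "N > 0" using assms by simp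
  have z: "real N * (x + of_int m) = N * x + of_int z"
    by (simp add: z_def algebra_simps)
  have b: "real k < N * x" "2 * (N * x) < 2 * real k + 3"
    "real l < N * x + of_int z" "2 * (N * x + of_int z) < 2 * real l + 3"
    using assms(4,5) N unfolding step_interval_iff[OF N] z by auto
  have "real_of_int (2 * z) > real_of_int (2 * (int l - int k) - 3)"
    "real_of_int (2 * z) < real_of_int (2 * (int l - int k) + 3)"
    using b by simp_all
  then have lz: "2 * (int l - int k) - 3 < 2 * z" and uz: "2 * z < 2 * (int l - int k) + 3"
    by linarith+
  have kl: "int k < int l" "int l < int N" "3 \<le> int N" "0 \<le> int k"
    using assms(1-3) by simp_all
  have "m \<ge> 0"
  proof (rule ccontr)
    assume "\<not> m \<ge> 0"
    then have "z \<le> int N * (-1)"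
      unfolding z_def by (intro mult_left_mono) auto
    then have "z \<le> - int N"
      by simp
    then show False
      using lz kl by presburger
  qed
  moreover have "m \<le> 1"
  proof (rule ccontr)
    assume "\<not> m \<le> 1"
    then have "z \<ge> int N * 2"
      unfolding z_def by (intro mult_left_mono) auto
    then show False
      using uz kl by presburger
  qed
  ultimately have "m = 0 \<or> m = 1" by linarith
  then show ?thesis
    using lz uz assms(1-3) unfolding z_def by auto
qed

lemma circ_image_iff: "circ t \<in> circ ` S \<longleftrightarrow> (\<exists>m::int. t + of_int m \<in> S)"
proof
  assume "circ t \<in> circ ` S"
  then obtain y where y: "y \<in> S" "circ y = circ t"
    by auto
  then obtain m :: int where "y = t + of_int m"
    unfolding circ_eq_iff by blast
  then show "\<exists>m::int. t + of_int m \<in> S"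
    using y by blast
next
  assume "\<exists>m::int. t + of_int m \<in> S"
  then obtain m :: int where "t + of_int m \<in> S" by blast
  then show "circ t \<in> circ ` S"
    by (metis circ_add_int image_eqI)
qed

text \<open>If three arcs \<open>i < j < k\<close> had a common point, its parameters in the intervals \<open>i\<close>, \<open>j\<close> and in the
  intervals \<open>j\<close>, \<open>k\<close> would have to agree, since only the first and the last interval have parameters
  that differ by a turn. Then \<open>k = i + 2\<close>, but the intervals \<open>i\<close> and \<open>i + 2\<close> are disjoint.\<close>

lemma regular_cyclic_cover:
  assumes N: "3 \<le> N"
  shows "cyclic_cover (N - 1) (\<lambda>k. circ ` step_interval N k)"
proof -
  let ?J = "\<lambda>k. circ ` step_interval N k"
  have N0: "N > 0" using N by simp
  have arc: "open_arc (?J k)" for k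
    unfolding open_arc_def
    by (rule exI[of _ "real k / N"], rule exI[of _ "real k / N + 3 / (2 * real N)"])
      (use N in \<open>auto simp: step_interval_def field_simps\<close>)
  have overlap: "l = Suc k \<and> (\<exists>x. w = circ x \<and> x \<in> step_interval N k \<and> x \<in> step_interval N l) \<or>
      k = 0 \<and> Suc l = N \<and> (\<exists>x. w = circ x \<and> x \<in> step_interval N k \<and> x + 1 \<in> step_interval N l)"
    if kl: "k < l" "l < N" and w: "w \<in> ?J k" "w \<in> ?J l" for k l w
  proof -
    obtain x where x: "x \<in> step_interval N k" "w = circ x"
      using w(1) by blast
    obtain m :: int where m: "x + of_int m \<in> step_interval N l"
      using w(2) unfolding x(2) circ_image_iff by blast
    show ?thesis
      using step_interval_overlap[OF kl N x(1) m] x m by auto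
  qed
  have cover: "\<exists>k<N. w \<in> ?J k" if w: "w \<in> circle" for w
  proof -
    obtain s where s: "w = circ s"
      using circ_surj[OF w] .
    define t where "t = s - of_int \<lceil>s\<rceil> + 1"
    have t: "0 < t" "t \<le> 1"
      unfolding t_def by linarith+
    have wt: "w = circ t"
      unfolding s circ_eq_iff t_def by (rule exI[of _ "\<lceil>s\<rceil> - 1"]) simp
    define k where "k = nat (\<lceil>N * t\<rceil> - 1)"
    have p: "0 < N * t" "N * t \<le> N"
      using t N0 by auto
    then have k: "real k < N * t" "N * t \<le> real k + 1" "k < N"
      unfolding k_def by linarith+
    then have "t \<in> step_interval N k"
      unfolding step_interval_iff[OF N0] by linarith
    then show ?thesis
      using wt k(3) by blast
  qed
  have union: "(\<Union>k\<le>N - 1. ?J k) = circle"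
  proof
    show "(\<Union>k\<le>N - 1. ?J k) \<subseteq> circle"
      using open_arc_sub_circle[OF arc] by blast
    show "circle \<subseteq> (\<Union>k\<le>N - 1. ?J k)"
    proof
      fix w assume "w \<in> circle"
      then obtain k where "k < N" "w \<in> ?J k"
        using cover by blast
      then show "w \<in> (\<Union>k\<le>N - 1. ?J k)"
        by (intro UN_I[of k]) auto
    qed
  qed
  have next_arc: "open_arc (?J k \<inter> ?J (cyclic_next (N - 1) k))" if k: "k \<le> N - 1" for k
  proof (cases "k = N - 1")
    case False
    have "?J k \<inter> ?J (Suc k) = circ ` {real (Suc k) / N <..< real k / N + 3 / (2 * real N)}"
    proof (intro subset_antisym subsetI)
      fix w assume "w \<in> ?J k \<inter> ?J (Suc k)"
      then have w: "w \<in> ?J k" "w \<in> ?J (Suc k)"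
        by blast+
      have "k < Suc k" "Suc k < N"
        using k False N by arith+
      from overlap[OF this w] obtain x
        where "w = circ x" "x \<in> step_interval N k" "x \<in> step_interval N (Suc k)"
        using N by auto
      then show "w \<in> circ ` {real (Suc k) / N <..< real k / N + 3 / (2 * real N)}"
        by (auto simp: step_interval_def)
    next
      fix w assume "w \<in> circ ` {real (Suc k) / N <..< real k / N + 3 / (2 * real N)}"
      then obtain x where x: "w = circ x" "real (Suc k) / N < x" "x < real k / N + 3 / (2 * real N)"
        by auto
      then have "x \<in> step_interval N k \<inter> step_interval N (Suc k)"
        using N0 by (auto simp: step_interval_iff[OF N0] field_simps)
      then show "w \<in> ?J k \<inter> ?J (Suc k)"
        using x by blast
    qed
    then show ?thesis
      using False N0 unfolding open_arc_def cyclic_next_def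
      by (intro exI[of _ "real (Suc k) / N"] exI[of _ "real k / N + 3 / (2 * real N)"])
        (auto simp: field_simps)
  next
    case True
    have "?J k \<inter> ?J 0 = circ ` {1 <..< real k / N + 3 / (2 * real N)}"
    proof (intro subset_antisym subsetI)
      fix w assume "w \<in> ?J k \<inter> ?J 0"
      then have w: "w \<in> ?J 0" "w \<in> ?J k"
        by blast+
      have "0 < k" "k < N"
        using True N by arith+
      from overlap[OF this w] obtain x
        where "w = circ x" "x \<in> step_interval N 0" "x + 1 \<in> step_interval N k"
        using True N by auto
      then have "w = circ (x + 1)" "x + 1 \<in> {1 <..< real k / N + 3 / (2 * real N)}"
        by (auto simp: step_interval_def)
      then show "w \<in> circ ` {1 <..< real k / N + 3 / (2 * real N)}"
        by (rule image_eqI)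
    next
      fix w assume "w \<in> circ ` {1 <..< real k / N + 3 / (2 * real N)}"
      then obtain x where x: "w = circ x" "1 < x" "x < real k / N + 3 / (2 * real N)"
        by auto
      have k: "real k = real N - 1"
        using True N0 by (simp add: of_nat_diff)
      have "real N * x < real k + 3 / 2"
        using x(3) N0 by (simp add: field_simps)
      moreover have "real N < real N * x"
        using x(2) N0 by simp
      ultimately have "x \<in> step_interval N k" "x - 1 \<in> step_interval N 0"
        unfolding step_interval_iff[OF N0] right_diff_distrib using k by (intro conjI; linarith)+
      moreover have "w = circ (x - 1)"
        using x(1) circ_add_1[of "x - 1"] by simp
      ultimately show "w \<in> ?J k \<inter> ?J 0"
        using x(1) by blast
    qed
    moreover have "real k = real N - 1"
      using True N0 by (simp add: of_nat_diff)
    ultimately show ?thesis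
      using True N unfolding open_arc_def cyclic_next_def
      by (intro exI[of _ 1] exI[of _ "real k / N + 3 / (2 * real N)"]) (auto simp: field_simps)
  qed
  have far: "?J i \<inter> ?J j = {}"
    if ij: "i < j" "j \<le> N - 1" "j \<noteq> cyclic_next (N - 1) i" "i \<noteq> cyclic_next (N - 1) j" for i j
  proof (rule ccontr)
    assume "?J i \<inter> ?J j \<noteq> {}"
    then obtain w where w: "w \<in> ?J i" "w \<in> ?J j"
      by blast
    have "j < N" using ij N by linarith
    from overlap[OF ij(1) this w] show False
      using ij N unfolding cyclic_next_def by (auto split: if_splits)
  qed
  have triple: "?J i \<inter> ?J j \<inter> ?J k = {}" if ijk: "i < j" "j < k" "k \<le> N - 1" for i j k
  proof (rule ccontr)
    assume "?J i \<inter> ?J j \<inter> ?J k \<noteq> {}"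
    then obtain w where w: "w \<in> ?J i" "w \<in> ?J j" "w \<in> ?J k"
      by blast
    obtain x where x: "x \<in> step_interval N i" "w = circ x"
      using w(1) by blast
    obtain m :: int where m: "x + of_int m \<in> step_interval N j"
      using w(2) unfolding x(2) circ_image_iff by blast
    obtain m' :: int where m': "x + of_int m' \<in> step_interval N k"
      using w(3) unfolding x(2) circ_image_iff by blast
    have m'': "(x + of_int m) + of_int (m' - m) \<in> step_interval N k"
      using m' by simp
    have b: "j < N" "k < N" "i < k"
      using ijk N by linarith+
    from step_interval_overlap[OF ijk(1) b(1) N x(1) m]
      step_interval_overlap[OF b(3,2) N x(1) m'] step_interval_overlap[OF ijk(2) b(2) N m m'']
    show False
      using ijk b by auto
  qed
  have "2 \<le> N - 1"
    using N by simp
  moreover have "?J i \<inter> ?J j = {}" if "i \<le> N - 1" "j \<le> N - 1"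
    "i \<noteq> j \<and> j \<noteq> cyclic_next (N - 1) i \<and> i \<noteq> cyclic_next (N - 1) j" for i j
    using that far[of i j] far[of j i] by (cases i j rule: linorder_cases) (auto simp: Int_commute)
  moreover have "?J i \<inter> ?J j \<inter> ?J k = {}" if le: "i \<le> N - 1" "j \<le> N - 1" "k \<le> N - 1"
    and ne: "i \<noteq> j \<and> j \<noteq> k \<and> i \<noteq> k" for i j k
  proof -
    consider "i < j" "j < k" | "i < k" "k < j" | "j < i" "i < k" | "j < k" "k < i" | "k < i" "i < j" | "k < j" "j < i"
      using ne by linarith
    then show ?thesis
      using triple[of i j k] triple[of i k j] triple[of j i k] triple[of j k i] triple[of k i j]
        triple[of k j i] le by cases (simp_all add: Int_ac)
  qed
  ultimately show ?thesis
    unfolding cyclic_cover_def using arc union next_arc by simp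
qed

lemma cyclic_cover_rotate:
  assumes z: "z \<in> circle" and I: "cyclic_cover n I"
  shows "cyclic_cover n (\<lambda>i. (\<lambda>w. z * w) ` I i)"
proof -
  obtain r where r: "z = circ r"
    using circ_surj[OF z] .
  have z0: "z \<noteq> 0" using r by simp
  have inj: "inj ((*) z)"
    using z0 by (simp add: inj_on_def)
  have arc: "open_arc ((\<lambda>w. z * w) ` J)" if J: "open_arc J" for J
  proof -
    obtain a b where ab: "a < b" "b \<le> a + 1" "J = circ ` {a<..<b}"
      using J unfolding open_arc_def by blast
    have "(\<lambda>w. z * w) ` J = circ ` ((+) r ` {a<..<b})"
      unfolding ab r image_image circ_add ..
    also have "(+) r ` {a<..<b} = {r + a<..<r + b}"
    proof (intro subset_antisym subsetI)
      show "x \<in> (+) r ` {a<..<b}" if "x \<in> {r + a<..<r + b}" for x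
        using that by (intro image_eqI[of _ _ "x - r"]) auto
    qed auto
    finally show ?thesis
      unfolding open_arc_def using ab by (intro exI[of _ "r + a"] exI[of _ "r + b"]) auto
  qed
  have "(\<lambda>w. z * w) ` circle = circle"
  proof
    show "(\<lambda>w. z * w) ` circle \<subseteq> circle"
      using z by (auto simp: norm_mult)
    show "circle \<subseteq> (\<lambda>w. z * w) ` circle"
    proof
      fix w assume "w \<in> circle"
      then show "w \<in> (\<lambda>w. z * w) ` circle"
        using z z0 by (intro image_eqI[of _ _ "w / z"]) (auto simp: norm_divide)
    qed
  qed
  then have "(\<Union>i\<le>n. (\<lambda>w. z * w) ` I i) = circle"
    using I unfolding cyclic_cover_def by (simp flip: image_UN)
  then show ?thesis
    using I arc unfolding cyclic_cover_def by (simp flip: image_Int[OF inj])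
qed

section \<open>Equivalence of loop systems and periodic morphisms\<close>

context orbispace
begin

text \<open>Refinements and isomorphisms of loop systems both provide one germ \<open>c k\<close> per patch, into one patch
  \<open>\<theta> k\<close> of the other cocycle. The gluing germs of \<open>E\<close> carry it to the remaining patches.\<close>

lemma morphism_of_family:
  assumes D: "is_cocycle D" and E: "is_cocycle E"
    and sub: "\<And>k t. t \<in> patch D k \<Longrightarrow> t \<in> patch E (\<theta> k)"
    and c: "\<And>k t. t \<in> patch D k \<Longrightarrow>
      arr (c k t) \<and> flat_at (c k) t \<and> src (c k t) = obj D k t \<and> trg (c k t) = obj E (\<theta> k) t"
    and nat: "\<And>k l t. t \<in> patch D k \<Longrightarrow> t \<in> patch D l \<Longrightarrow>
      c l t \<cdot> glue D l k t = glue E (\<theta> l) (\<theta> k) t \<cdot> c k t"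
  shows "morphism_on UNIV D E (\<lambda>j k t. glue E j (\<theta> k) t \<cdot> c k t)"
  unfolding morphism_on_def
proof (intro allI impI)
  fix k j t assume t: "t \<in> UNIV" "t \<in> patch D k" "t \<in> patch E j"
  note tk = sub[OF t(2)]
  have "flat_at (\<lambda>t. glue E j (\<theta> k) t \<cdot> c k t) t"
  proof (rule flat_comp)
    show "open (patch D k \<inter> patch E j)"
      using is_cocycleD(1)[OF D] is_cocycleD(1)[OF E] by blast
    show "src (glue E j (\<theta> k) r) = trg (c k r)" if "r \<in> patch D k \<inter> patch E j" for r
      using that sub c is_cocycleD(5)[OF E, of r "\<theta> k" j] by simp
  qed (use c t tk is_cocycleD(4)[OF E tk t(3)] in auto)
  moreover have "(glue E j (\<theta> k') t \<cdot> c k' t) \<cdot> glue D k' k t = glue E j (\<theta> k) t \<cdot> c k t"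
    if k': "t \<in> patch D k'" for k'
  proof -
    have "(glue E j (\<theta> k') t \<cdot> c k' t) \<cdot> glue D k' k t = glue E j (\<theta> k') t \<cdot> c k' t \<cdot> glue D k' k t"
      using c[OF k'] is_cocycleD(3,5)[OF E sub[OF k'] t(3)] is_cocycleD(3,6)[OF D t(2) k']
      by (simp add: comp_assoc)
    also have "\<dots> = glue E j (\<theta> k') t \<cdot> glue E (\<theta> k') (\<theta> k) t \<cdot> c k t"
      using nat[OF t(2) k'] by simp
    also have "\<dots> = (glue E j (\<theta> k') t \<cdot> glue E (\<theta> k') (\<theta> k) t) \<cdot> c k t"
      using c[OF t(2)] is_cocycleD(3,5)[OF E sub[OF k'] t(3)] is_cocycleD(3,5,6)[OF E tk sub[OF k']]
      by (simp add: comp_assoc)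
    finally show ?thesis
      using is_cocycleD(7)[OF E tk sub[OF k'] t(3)] by simp
  qed
  moreover have "glue E j' j t \<cdot> glue E j (\<theta> k) t \<cdot> c k t = glue E j' (\<theta> k) t \<cdot> c k t"
    if "t \<in> patch E j'" for j'
    using c[OF t(2)] is_cocycleD(3,5,6)[OF E tk t(3)] is_cocycleD(3,5)[OF E t(3) that]
      is_cocycleD(7)[OF E tk t(3) that] by (simp flip: comp_assoc)
  ultimately show "arr (glue E j (\<theta> k) t \<cdot> c k t) \<and> flat_at (\<lambda>t. glue E j (\<theta> k) t \<cdot> c k t) t \<and>
      src (glue E j (\<theta> k) t \<cdot> c k t) = obj D k t \<and> trg (glue E j (\<theta> k) t \<cdot> c k t) = obj E j t \<and>
      (\<forall>k'. t \<in> patch D k' \<longrightarrow>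
         (glue E j (\<theta> k') t \<cdot> c k' t) \<cdot> glue D k' k t = glue E j (\<theta> k) t \<cdot> c k t) \<and>
      (\<forall>j'. t \<in> patch E j' \<longrightarrow> glue E j' j t \<cdot> glue E j (\<theta> k) t \<cdot> c k t = glue E j' (\<theta> k) t \<cdot> c k t)"
    using c[OF t(2)] is_cocycleD(3,5,6)[OF E tk t(3)] by simp
qed

text \<open>The source moves continuously because the lifts of a loop system do; a single label then makes the
  family flat.\<close>

lemma flat_lift:
  assumes s: "s \<in> loop_systems X" and t: "t \<in> patch (loop_cocycle s) k"
    and c: "\<And>r. r \<in> patch (loop_cocycle s) k \<Longrightarrow>
      arr (c r) \<and> src (c r) = obj (loop_cocycle s) k r \<and> label (c r) = \<xi> \<and> fst (trg (c r)) = b"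
  shows "flat_at c t"
proof -
  let ?P = "patch (loop_cocycle s) k"
  have k: "k \<le> top_index s"
    using t by simp
  have "continuous_map (top_of_set ?P) (top_of_set (arc s k)) circ"
    using continuous_circ by (auto simp: continuous_map_in_subtopology)
  then have "continuous_map (top_of_set ?P) (hat X (chart s k)) (\<lambda>t. lft s k (circ t))"
    using continuous_map_compose loop_systemD(3)[OF s k] unfolding o_def by blast
  moreover have "c r = Germ (chart s k, lft s k (circ r)) \<xi> (b, tmap X (chart s k) b \<xi> (lft s k (circ r)))"
    if "r \<in> ?P" for r
    using c[OF that] arrD(8)[of "c r"] by (auto intro!: germ.expand simp: prod_eq_iff)
  ultimately show ?thesis
    unfolding flat_at_def using is_cocycleD(1)[OF is_cocycle_loop[OF s]] t c by blast
qed

lemma equiv_of_refines: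
  assumes s: "s' \<in> loop_systems X" "s \<in> loop_systems X" "loop_refines X s' s"
  shows "loop_equiv s' s"
proof -
  let ?D = "loop_cocycle s'" and ?E = "loop_cocycle s"
  obtain \<theta> \<iota> where r: "\<forall>k \<le> top_index s'. \<theta> k \<le> top_index s \<and> arc s' k \<subseteq> arc s (\<theta> k) \<and>
       \<iota> k \<in> Tran X (chart s' k) (chart s (\<theta> k)) \<and>
       (\<forall>t \<in> arc s' k.
          lft s' k t \<in> tdom X (chart s' k) (chart s (\<theta> k)) (\<iota> k) \<and>
          tmap X (chart s' k) (chart s (\<theta> k)) (\<iota> k) (lft s' k t) = lft s (\<theta> k) t)"
    and n: "\<forall>k l. meets s' k l \<longrightarrow> (\<forall>t \<in> arc s' k \<inter> arc s' l.
       tcomp X (chart s' k) (chart s' l) (chart s (\<theta> l)) (\<iota> l) (gl s' l k) (lft s' k t) =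
       tcomp X (chart s' k) (chart s (\<theta> k)) (chart s (\<theta> l)) (gl s (\<theta> l) (\<theta> k)) (\<iota> k) (lft s' k t))"
    using s(3) unfolding loop_refines_def by metis
  define c where "c = (\<lambda>k t. Germ (chart s' k, lft s' k (circ t)) (\<iota> k) (chart s (\<theta> k), lft s (\<theta> k) (circ t)))"
  have sub: "t \<in> patch ?E (\<theta> k)" if "t \<in> patch ?D k" for k t
    using that r by auto
  have arr: "arr (c k t)" if "t \<in> patch ?D k" for k t
    using that r loop_systemD(2)[OF s(1), of k] loop_systemD(2)[OF s(2), of "\<theta> k"]
    unfolding arr_def c_def by auto
  have flat: "flat_at (c k) t" if "t \<in> patch ?D k" for k t
    using arr by (intro flat_lift[OF s(1) that, where \<xi> = "\<iota> k" and b = "chart s (\<theta> k)"]) (auto simp: c_def)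
  have nat: "c l t \<cdot> glue ?D l k t = glue ?E (\<theta> l) (\<theta> k) t \<cdot> c k t"
    if "t \<in> patch ?D k" "t \<in> patch ?D l" for k l t
  proof -
    have "meets s' k l" "circ t \<in> arc s' k \<inter> arc s' l"
      using that unfolding meets_def by auto
    then show ?thesis
      using n unfolding c_def glue_loop comp_def by simp
  qed
  have "morphism_on UNIV ?D ?E (\<lambda>j k t. glue ?E j (\<theta> k) t \<cdot> c k t)"
    using sub arr flat nat
    by (intro morphism_of_family is_cocycle_loop s) (auto simp: c_def)
  then show ?thesis
    unfolding loop_equiv_def periodic_morphism_def
    by (intro exI[of _ "\<lambda>j k t. glue ?E j (\<theta> k) t \<cdot> c k t"]) (simp add: glue_loop c_def)
qed

lemma equiv_of_iso:
  assumes s: "s \<in> loop_systems X" "s' \<in> loop_systems X" "loop_iso X s s'"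
  shows "loop_equiv s s'"
proof -
  let ?D = "loop_cocycle s" and ?E = "loop_cocycle s'"
  obtain \<delta> where top: "top_index s' = top_index s"
    and same: "\<forall>i \<le> top_index s. arc s' i = arc s i \<and> chart s' i = chart s i"
    and \<delta>: "\<forall>i \<le> top_index s. \<delta> i \<in> carrier (grp X (chart s i)) \<and>
             (\<forall>t \<in> arc s i. lft s' i t = hact X (chart s i) (\<delta> i) (lft s i t))"
    and n: "\<forall>i j. meets s i j \<longrightarrow> (\<forall>t \<in> arc s i \<inter> arc s j.
             gl s' j i =
               tcomp X (chart s i) (chart s j) (chart s j) (aut X (chart s j) (\<delta> j))
                 (tcomp X (chart s i) (chart s i) (chart s j) (gl s j i)
                    (aut X (chart s i) (inv\<^bsub>grp X (chart s i)\<^esub> (\<delta> i))) (lft s' i t))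
                 (lft s' i t))"
    using s(3) unfolding loop_iso_def by metis
  define d where "d = (\<lambda>i t. aut_germ (chart s i, lft s i (circ t)) (\<delta> i))"
  have sub: "t \<in> patch ?E i" if "t \<in> patch ?D i" for i t
    using that same top by simp
  have pt: "point (obj ?D i t)" if "t \<in> patch ?D i" for i t
    using is_cocycleD(8)[OF is_cocycle_loop[OF s(1)] that] .
  have d: "arr (d i t)" "src (d i t) = obj ?D i t" "trg (d i t) = obj ?E i t"
    if t: "t \<in> patch ?D i" for i t
  proof -
    show "arr (d i t)"
      unfolding d_def using \<delta> t pt[OF t] by (intro arr_aut_germ) auto
    show "src (d i t) = obj ?D i t" "trg (d i t) = obj ?E i t"
      unfolding d_def using \<delta> same t by (auto simp: trg_aut_germ)
  qed
  have flat: "flat_at (d i) t" if t: "t \<in> patch ?D i" for i t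
    using d by (intro flat_lift[OF s(1) t, where \<xi> = "aut X (chart s i) (\<delta> i)" and b = "chart s i"])
      (auto simp: d_def aut_germ_def)
  have nat: "d j t \<cdot> glue ?D j i t = glue ?E j i t \<cdot> d i t"
    if t: "t \<in> patch ?D i" "t \<in> patch ?D j" for i j t
  proof -
    let ?a = "chart s i"
    interpret G: group "grp X ?a"
      using chart_group loop_systemD(2)[OF s(1)] t by simp
    have \<delta>i: "\<delta> i \<in> carrier (grp X ?a)"
      using \<delta> t by simp
    define e where "e = aut_germ (obj ?E i t) (inv\<^bsub>grp X ?a\<^esub> (\<delta> i))"
    have ai: "fst (obj ?E i t) = ?a"
      using same t by simp
    have pE: "point (obj ?E i t)"
      using arrD(2)[OF d(1)[OF t(1)]] d(3)[OF t(1)] by simp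
    have e: "arr e" "src e = obj ?E i t"
      unfolding e_def using \<delta>i pE ai by simp_all
    have ed: "e \<cdot> d i t = unit (obj ?D i t)"
      using comp_aut_germ[OF pt[OF t(1)], of "inv\<^bsub>grp X ?a\<^esub> (\<delta> i)" "\<delta> i" "obj ?E i t"] \<delta>i
        d(3)[OF t(1)] aut_germ_one[OF pt[OF t(1)]] unfolding e_def d_def by simp
    then have te: "trg e = obj ?D i t"
      by (metis trg_comp trg_unit)
    note g = is_cocycleD(3,5,6)[OF is_cocycle_loop[OF s(1)] t]
    have "meets s i j" "circ t \<in> arc s i \<inter> arc s j"
      using t unfolding meets_def by auto
    then have "label (glue ?E j i t) = label (d j t \<cdot> glue ?D j i t \<cdot> e)"
      using n te ai same t d(3)[OF t(2)] unfolding comp_def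
      by (simp add: glue_loop e_def d_def aut_germ_def)
    then have "glue ?E j i t = d j t \<cdot> glue ?D j i t \<cdot> e"
      using e d(3)[OF t(2)] by (auto intro!: germ.expand simp: glue_loop)
    then have "glue ?E j i t \<cdot> d i t = d j t \<cdot> glue ?D j i t \<cdot> e \<cdot> d i t"
      using g e te d[OF t(1)] d[OF t(2)] by (simp add: comp_assoc)
    then show ?thesis
      unfolding ed using g by simp
  qed
  have "morphism_on UNIV ?D ?E (\<lambda>j i t. glue ?E j (id i) t \<cdot> d i t)"
    using sub d flat nat by (intro morphism_of_family is_cocycle_loop s) auto
  then show ?thesis
    unfolding loop_equiv_def periodic_morphism_def
    by (intro exI[of _ "\<lambda>j i t. glue ?E j (id i) t \<cdot> d i t"]) (simp add: glue_loop d_def)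
qed

lemma loop_iso_refl:
  assumes s: "s \<in> loop_systems X"
  shows "loop_iso X s s"
proof -
  let ?D = "loop_cocycle s"
  define \<delta> where "\<delta> = (\<lambda>i. \<one>\<^bsub>grp X (chart s i)\<^esub>)"
  have one: "\<delta> i \<in> carrier (grp X (chart s i))" "inv\<^bsub>grp X (chart s i)\<^esub> (\<delta> i) = \<delta> i"
    "hact X (chart s i) (\<delta> i) (lft s i w) = lft s i w" if i: "i \<le> top_index s" "w \<in> arc s i" for i w
  proof -
    interpret G: group "grp X (chart s i)"
      using chart_group loop_systemD(2)[OF s i(1)] .
    show "\<delta> i \<in> carrier (grp X (chart s i))" "inv\<^bsub>grp X (chart s i)\<^esub> (\<delta> i) = \<delta> i"
      unfolding \<delta>_def by simp_all
    have "w \<in> circle"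
      using i cyclic_coverD(1)[OF loop_systemD(1)[OF s]] open_arc_sub_circle by blast
    then obtain t where t: "w = circ t"
      using circ_surj by blast
    then have "point (chart s i, lft s i w)"
      using is_cocycleD(8)[OF is_cocycle_loop[OF s], of t i] i by simp
    from arg_cong[OF aut_germ_one[OF this], of trg]
    show "hact X (chart s i) (\<delta> i) (lft s i w) = lft s i w"
      by (simp add: trg_aut_germ \<delta>_def)
  qed
  have glue: "gl s j i = tcomp X (chart s i) (chart s j) (chart s j) (aut X (chart s j) (\<delta> j))
       (tcomp X (chart s i) (chart s i) (chart s j) (gl s j i)
         (aut X (chart s i) (inv\<^bsub>grp X (chart s i)\<^esub> (\<delta> i))) (lft s i w)) (lft s i w)"
    if m: "meets s i j" and w: "w \<in> arc s i \<inter> arc s j" for i j w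
  proof -
    have ij: "i \<le> top_index s" "j \<le> top_index s"
      using m unfolding meets_def by auto
    have "w \<in> circle"
      using ij w cyclic_coverD(1)[OF loop_systemD(1)[OF s]] open_arc_sub_circle by blast
    then obtain t where t: "w = circ t"
      using circ_surj by blast
    have "arr (glue ?D j i t)"
      using is_cocycleD(3)[OF is_cocycle_loop[OF s], of t i j] t ij w by simp
    from arg_cong[OF comp_units[OF this], of label] show ?thesis
      using t one(2)[of i w] ij w by (simp add: comp_def unit_def glue_loop \<delta>_def)
  qed
  have ne: "\<exists>w. w \<in> arc s i" if "i \<le> top_index s" for i
    using cyclic_coverD(1)[OF loop_systemD(1)[OF s] that] dense unfolding open_arc_def by fastforce
  show ?thesis
    unfolding loop_iso_def
  proof (intro conjI exI[of _ \<delta>] allI impI ballI)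
    show "\<delta> i \<in> carrier (grp X (chart s i))" if "i \<le> top_index s" for i
      using ne[OF that] one(1)[OF that] by blast
  qed (use one(3) glue in auto)
qed

lemma periodic_int:
  assumes "\<And>t. P t \<Longrightarrow> P (t + 1) \<and> f (t + 1) = f t" "\<And>t. P t \<Longrightarrow> P (t - 1)" "P (t::real)"
  shows "f (t + of_int m) = f t"
proof -
  have up: "P (t + real n) \<and> f (t + real n) = f t" if "P t" for n t
    using that
  proof (induction n)
    case (Suc n)
    then show ?case
      using assms(1)[of "t + real n"] by (simp add: algebra_simps)
  qed simp
  have down: "P (t - real n)" for n
  proof (induction n)
    case (Suc n)
    then show ?case
      using assms(2)[of "t - real n"] by (simp add: algebra_simps)
  qed (use assms in simp)
  show ?thesis
  proof (cases "m \<ge> 0")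
    case True
    then show ?thesis
      using up[OF assms(3), of "nat m"] by simp
  next
    case False
    then show ?thesis
      using up[OF down[of "nat (- m)"], of "nat (- m)"] by simp
  qed
qed

text \<open>Equivalent systems \<open>s\<close>, \<open>u\<close> have a common refinement: on arcs that are short enough to lie in
  an arc of \<open>s\<close> and in an arc of \<open>u\<close> it carries the charts and lifts of \<open>s\<close>, and the germs of the
  equivalence, which have constant labels there, are its transition maps into the charts of \<open>u\<close>.\<close>

lemma loop_rel_of_equiv:
  assumes s: "s \<in> loop_systems X" and u: "u \<in> loop_systems X" and su: "loop_equiv s u"
  shows "(s, u) \<in> loop_rel X"
proof -
  let ?D = "loop_cocycle s" and ?E = "loop_cocycle u"
  note D = is_cocycle_loop[OF s] and E = is_cocycle_loop[OF u]
  obtain H where H: "morphism_on UNIV ?D ?E H"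
    "\<And>i j t. \<lbrakk> t \<in> patch ?D i; t \<in> patch ?E j \<rbrakk> \<Longrightarrow> H j i (t + 1) = H j i t"
    using su unfolding loop_equiv_def periodic_morphism_def by blast
  obtain \<epsilon> where \<epsilon>: "\<epsilon> > 0"
    "\<And>x. x \<in> {0..1} \<Longrightarrow> \<exists>G \<in> range (\<lambda>(i, j). patch ?D i \<inter> patch ?E j). ball x \<epsilon> \<subseteq> G"
  proof (rule Heine_Borel_lemma[of "{0..1::real}" "range (\<lambda>(i, j). patch ?D i \<inter> patch ?E j)"])
    show "{0..1} \<subseteq> \<Union> (range (\<lambda>(i, j). patch ?D i \<inter> patch ?E j))"
      using is_cocycleD(2)[OF D] is_cocycleD(2)[OF E] by fast
    show "open G" if "G \<in> range (\<lambda>(i, j). patch ?D i \<inter> patch ?E j)" for G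
      using that is_cocycleD(1)[OF D] is_cocycleD(1)[OF E] by auto
  qed (simp, metis)
  \<comment> \<open>The intervals have length \<open>3 / (2 * N)\<close>, which is less than the Lebesgue number \<open>\<epsilon>\<close>.\<close>
  obtain M where M: "2 / \<epsilon> < real M"
    using reals_Archimedean2 by blast
  define N where "N = max 3 M"
  have N: "3 \<le> N" "2 / \<epsilon> < real N"
    using M unfolding N_def by auto
  then have N\<epsilon>: "2 < N * \<epsilon>" "N > 0"
    using \<epsilon>(1) by (auto simp: field_simps)
  have "\<exists>i j. step_interval N k \<subseteq> patch ?D i \<inter> patch ?E j" if k: "k < N" for k
  proof -
    have "real k / N \<in> {0..1}"
      using k by auto
    then obtain i j where ij: "ball (real k / N) \<epsilon> \<subseteq> patch ?D i \<inter> patch ?E j"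
      using \<epsilon>(2) by fastforce
    have "step_interval N k \<subseteq> ball (real k / N) \<epsilon>"
    proof
      fix x assume x: "x \<in> step_interval N k"
      have "3 / (2 * real N) < \<epsilon>"
        using N\<epsilon> by (simp add: field_simps)
      then show "x \<in> ball (real k / N) \<epsilon>"
        using x unfolding step_interval_def by (auto simp: dist_real_def)
    qed
    then show ?thesis
      using ij by blast
  qed
  then obtain \<theta> \<theta>' where \<theta>: "\<And>k. k < N \<Longrightarrow> step_interval N k \<subseteq> patch ?D (\<theta> k) \<inter> patch ?E (\<theta>' k)"
    by metis
  define v :: "('x, 'y, 't) loop_system" where
    "v = \<lparr> top_index = N - 1, arc = (\<lambda>k. circ ` step_interval N k), chart = (\<lambda>k. chart s (\<theta> k)),
       lft = (\<lambda>k. lft s (\<theta> k)), gl = (\<lambda>l k. gl s (\<theta> l) (\<theta> k)) \<rparr>"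
  have sel [simp]: "top_index v = N - 1" "arc v = (\<lambda>k. circ ` step_interval N k)"
    "chart v = (\<lambda>k. chart s (\<theta> k))" "lft v = (\<lambda>k. lft s (\<theta> k))" "gl v = (\<lambda>l k. gl s (\<theta> l) (\<theta> k))"
    unfolding v_def by simp_all
  have le: "k \<le> N - Suc 0 \<longleftrightarrow> k < N" for k
    using N(1) by arith
  have mid: "real k / N + 1 / (2 * real N) \<in> step_interval N k" for k
    using N\<epsilon> unfolding step_interval_def by (auto simp: field_simps)
  have idx: "\<theta> k \<le> top_index s" "\<theta>' k \<le> top_index u" if "k < N" for k
    using \<theta>[OF that] mid[of k] by auto
  have sub: "circ ` step_interval N k \<subseteq> arc s (\<theta> k)" "circ ` step_interval N k \<subseteq> arc u (\<theta>' k)"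
    if "k < N" for k
    using \<theta>[OF that] by auto
  have v: "v \<in> loop_systems X"
    unfolding loop_systems_def is_loop_system_def mem_Collect_eq
  proof (intro conjI allI impI)
    show "cyclic_cover (top_index v) (arc v)"
      using regular_cyclic_cover[OF N(1)] by simp
  next
    fix k assume "k \<le> top_index v"
    then have k: "k < N" by (simp add: le)
    show "chart v k \<in> basic X"
      using loop_systemD(2)[OF s idx(1)[OF k]] by simp
    show "continuous_map (top_of_set (arc v k)) (hat X (chart v k)) (lft v k)"
      using continuous_map_from_subtopology_mono[OF loop_systemD(3)[OF s idx(1)[OF k]] sub(1)[OF k]] by simp
    show "gl v k k = aut X (chart v k) \<one>\<^bsub>grp X (chart v k)\<^esub>"
      using loop_systemD(4)[OF s idx(1)[OF k]] by simp
  next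
    fix i j assume "meets v i j"
    then obtain w where ij: "i < N" "j < N" and w: "w \<in> arc s (\<theta> i)" "w \<in> arc s (\<theta> j)"
      unfolding meets_def using sub by (auto simp: le)
    then show "gl v j i \<in> Tran X (chart v i) (chart v j)"
      using loop_systemD(5)[OF s idx(1)[OF ij(1)] idx(1)[OF ij(2)]] by simp
    show "\<forall>t \<in> arc v i \<inter> arc v j.
           lft v i t \<in> tdom X (chart v i) (chart v j) (gl v j i) \<and>
           lft v j t = tmap X (chart v i) (chart v j) (gl v j i) (lft v i t) \<and>
           tcomp X (chart v i) (chart v j) (chart v i) (gl v i j) (gl v j i) (lft v i t)
             = aut X (chart v i) \<one>\<^bsub>grp X (chart v i)\<^esub>"
    proof
      fix t assume "t \<in> arc v i \<inter> arc v j"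
      then have "t \<in> arc s (\<theta> i)" "t \<in> arc s (\<theta> j)"
        using sub ij by auto
      then show "lft v i t \<in> tdom X (chart v i) (chart v j) (gl v j i) \<and>
           lft v j t = tmap X (chart v i) (chart v j) (gl v j i) (lft v i t) \<and>
           tcomp X (chart v i) (chart v j) (chart v i) (gl v i j) (gl v j i) (lft v i t)
             = aut X (chart v i) \<one>\<^bsub>grp X (chart v i)\<^esub>"
        using loop_systemD(5)[OF s idx(1)[OF ij(1)] idx(1)[OF ij(2)]] by simp
    qed
  qed
  have "loop_refines X v s"
    unfolding loop_refines_def
  proof (intro exI conjI allI impI ballI)
    let ?\<iota> = "\<lambda>k. aut X (chart s (\<theta> k)) \<one>\<^bsub>grp X (chart s (\<theta> k))\<^esub>"
    fix k assume "k \<le> top_index v"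
    then have k: "k < N" by (simp add: le)
    show "\<theta> k \<le> top_index s" "arc v k \<subseteq> arc s (\<theta> k)"
      using idx[OF k] sub[OF k] by auto
    have u: "arr (unit (chart s (\<theta> k), lft s (\<theta> k) (circ t)))" if "circ t \<in> arc v k" for t
      using is_cocycleD(8)[OF D, of t "\<theta> k"] that sub(1)[OF k] idx(1)[OF k] by simp (blast intro: arr_unit)
    note uD = arrD[OF u, unfolded unit_def, simplified]
    have "circ (real k / N + 1 / (2 * real N)) \<in> arc v k"
      using mid by simp
    from uD(6)[OF this[simplified]] show "?\<iota> k \<in> Tran X (chart v k) (chart s (\<theta> k))"
      by simp
    fix w assume w: "w \<in> arc v k"
    then obtain t where t: "w = circ t" by auto
    show "lft v k w \<in> tdom X (chart v k) (chart s (\<theta> k)) (?\<iota> k)"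
      "tmap X (chart v k) (chart s (\<theta> k)) (?\<iota> k) (lft v k w) = lft s (\<theta> k) w"
      using uD(7,8)[of t] w t by simp_all
  next
    let ?\<iota> = "\<lambda>k. aut X (chart s (\<theta> k)) \<one>\<^bsub>grp X (chart s (\<theta> k))\<^esub>"
    fix k l w assume m: "meets v k l" and w: "w \<in> arc v k \<inter> arc v l"
    have kl: "k < N" "l < N"
      using m unfolding meets_def by (auto simp: le)
    obtain t where t: "w = circ t" using w by auto
    have ts: "t \<in> patch ?D (\<theta> k)" "t \<in> patch ?D (\<theta> l)"
      using sub(1)[OF kl(1)] sub(1)[OF kl(2)] idx(1)[OF kl(1)] idx(1)[OF kl(2)] w t by auto
    note g = is_cocycleD(3,5,6)[OF D ts]
    have "unit (obj ?D (\<theta> l) t) \<cdot> glue ?D (\<theta> l) (\<theta> k) t = glue ?D (\<theta> l) (\<theta> k) t \<cdot> unit (obj ?D (\<theta> k) t)"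
      using g by simp
    from arg_cong[OF this, of label]
    show "tcomp X (chart v k) (chart v l) (chart s (\<theta> l)) (?\<iota> l) (gl v l k) (lft v k w) =
        tcomp X (chart v k) (chart s (\<theta> k)) (chart s (\<theta> l)) (gl s (\<theta> l) (\<theta> k)) (?\<iota> k) (lft v k w)"
      using t by (simp add: comp_def unit_def glue_loop)
  qed
  moreover have "loop_refines X v u"
  proof -
    define \<iota> where "\<iota> = (\<lambda>k. label (H (\<theta>' k) (\<theta> k) (real k / N + 1 / (2 * real N))))"
    have germ: "arr (H (\<theta>' k) (\<theta> k) t)"
      "H (\<theta>' k) (\<theta> k) t = Germ (chart s (\<theta> k), lft s (\<theta> k) (circ t)) (\<iota> k) (chart u (\<theta>' k), lft u (\<theta>' k) (circ t))"
      if k: "k < N" and t: "circ t \<in> circ ` step_interval N k" for k t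
    proof -
      obtain m :: int where m: "t + of_int m \<in> step_interval N k"
        using t circ_image_iff by blast
      have ts: "t \<in> patch ?D (\<theta> k)" "t \<in> patch ?E (\<theta>' k)"
        using sub[OF k] idx[OF k] t by auto
      note h = morphism_onD[OF H(1) UNIV_I ts]
      have "label (H (\<theta>' k) (\<theta> k) (t + of_int m)) = \<iota> k"
        unfolding \<iota>_def
      proof (rule flat_label_constant[OF _ _ mid m])
        show "connected (step_interval N k)"
          unfolding step_interval_def by simp
        show "flat_at (H (\<theta>' k) (\<theta> k)) r" if "r \<in> step_interval N k" for r
          using morphism_onD(2)[OF H(1) UNIV_I] \<theta>[OF k] that by blast
      qed
      moreover have "H (\<theta>' k) (\<theta> k) (t + of_int m) = H (\<theta>' k) (\<theta> k) t"
      proof (rule periodic_int[where P = "\<lambda>t. t \<in> patch ?D (\<theta> k) \<and> t \<in> patch ?E (\<theta>' k)"])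
        show "r - 1 \<in> patch ?D (\<theta> k) \<and> r - 1 \<in> patch ?E (\<theta>' k)"
          if "r \<in> patch ?D (\<theta> k) \<and> r \<in> patch ?E (\<theta>' k)" for r
          using that circ_add_1[of "r - 1"] by simp
      qed (use H(2) ts in auto)
      ultimately show "arr (H (\<theta>' k) (\<theta> k) t)"
        "H (\<theta>' k) (\<theta> k) t = Germ (chart s (\<theta> k), lft s (\<theta> k) (circ t)) (\<iota> k) (chart u (\<theta>' k), lft u (\<theta>' k) (circ t))"
        using h by (auto intro!: germ.expand)
    qed
    show ?thesis
      unfolding loop_refines_def
    proof (intro exI conjI allI impI ballI)
      fix k assume "k \<le> top_index v"
      then have k: "k < N" by (simp add: le)
      show "\<theta>' k \<le> top_index u" "arc v k \<subseteq> arc u (\<theta>' k)"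
        using idx[OF k] sub[OF k] by auto
      have m: "circ (real k / N + 1 / (2 * real N)) \<in> circ ` step_interval N k"
        using mid by simp
      show "\<iota> k \<in> Tran X (chart v k) (chart u (\<theta>' k))"
        using arrD(6)[OF germ(1)[OF k m]] germ(2)[OF k m] by simp
      fix w assume w: "w \<in> arc v k"
      then obtain t where t: "w = circ t" "circ t \<in> circ ` step_interval N k" by auto
      show "lft v k w \<in> tdom X (chart v k) (chart u (\<theta>' k)) (\<iota> k)"
        "tmap X (chart v k) (chart u (\<theta>' k)) (\<iota> k) (lft v k w) = lft u (\<theta>' k) w"
        using arrD(7,8)[OF germ(1)[OF k t(2)]] germ(2)[OF k t(2)] t(1) by simp_all
    next
      fix k l w assume m: "meets v k l" and w: "w \<in> arc v k \<inter> arc v l"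
      have kl: "k < N" "l < N"
        using m unfolding meets_def by (auto simp: le)
      obtain t where t: "w = circ t" using w by auto
      have tk: "circ t \<in> circ ` step_interval N k" and tl: "circ t \<in> circ ` step_interval N l"
        using w t by auto
      have ts: "t \<in> patch ?D (\<theta> k)" "t \<in> patch ?D (\<theta> l)" "t \<in> patch ?E (\<theta>' k)" "t \<in> patch ?E (\<theta>' l)"
        using sub[OF kl(1)] sub[OF kl(2)] idx[OF kl(1)] idx[OF kl(2)] w t by auto
      have "H (\<theta>' l) (\<theta> l) t \<cdot> glue ?D (\<theta> l) (\<theta> k) t = glue ?E (\<theta>' l) (\<theta>' k) t \<cdot> H (\<theta>' k) (\<theta> k) t"
        using morphism_onD(5)[OF H(1) UNIV_I ts(1,4,2)] morphism_onD(6)[OF H(1) UNIV_I ts(1,3,4)] by simp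
      from arg_cong[OF this, of label]
      show "tcomp X (chart v k) (chart v l) (chart u (\<theta>' l)) (\<iota> l) (gl v l k) (lft v k w) =
          tcomp X (chart v k) (chart u (\<theta>' k)) (chart u (\<theta>' l)) (gl u (\<theta>' l) (\<theta>' k)) (\<iota> k) (lft v k w)"
        using t germ(2)[OF kl(1) tk] germ(2)[OF kl(2) tl] by (simp add: comp_def glue_loop)
    qed
  qed
  ultimately show ?thesis
    unfolding loop_rel_def using s u v loop_iso_refl[OF v] by blast
qed

lemma loop_rel_iff:
  "(s, u) \<in> loop_rel X \<longleftrightarrow> s \<in> loop_systems X \<and> u \<in> loop_systems X \<and> loop_equiv s u"
proof
  assume "(s, u) \<in> loop_rel X"
  then obtain s' u' where su: "s \<in> loop_systems X" "u \<in> loop_systems X" "s' \<in> loop_systems X"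
    "u' \<in> loop_systems X" "loop_refines X s' s" "loop_refines X u' u" "loop_iso X s' u'"
    unfolding loop_rel_def by blast
  have "loop_equiv s s'"
    using loop_equiv_sym[OF su(3,1) equiv_of_refines[OF su(3,1,5)]] .
  then have "loop_equiv s u'"
    using loop_equiv_trans[OF su(1,3,4) _ equiv_of_iso[OF su(3,4,7)]] by blast
  then show "s \<in> loop_systems X \<and> u \<in> loop_systems X \<and> loop_equiv s u"
    using loop_equiv_trans[OF su(1,4,2) _ equiv_of_refines[OF su(4,2,6)]] su(1,2) by blast
qed (use loop_rel_of_equiv in blast)

lemma loop_equiv_refl: "s \<in> loop_systems X \<Longrightarrow> loop_equiv s s"
  unfolding loop_equiv_def periodic_morphism_def
  using morphism_glue[OF is_cocycle_loop] glue_loop_periodic by blast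

lemma equiv_loop_rel: "equiv (loop_systems X) (loop_rel X)"
proof (rule equivI)
  show "refl_on (loop_systems X) (loop_rel X)"
    by (rule refl_onI) (use loop_rel_iff loop_equiv_refl in blast)+
  show "sym (loop_rel X)"
    by (rule symI) (use loop_rel_iff loop_equiv_sym in blast)
  show "trans (loop_rel X)"
    by (rule transI) (use loop_rel_iff loop_equiv_trans in blast)
qed (use loop_rel_iff in auto)

lemma free_loop_eq_iff:
  "\<lbrakk> s \<in> loop_systems X; u \<in> loop_systems X \<rbrakk> \<Longrightarrow>
     free_loop X s = free_loop X u \<longleftrightarrow> loop_equiv s u"
  unfolding free_loop_def using eq_equiv_class_iff[OF equiv_loop_rel] loop_rel_iff by blast

lemma mem_free_loop: "u \<in> free_loop X s \<longleftrightarrow> s \<in> loop_systems X \<and> u \<in> loop_systems X \<and> loop_equiv s u"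
  unfolding free_loop_def using loop_rel_iff by simp

section \<open>Rotation of loops\<close>

lemma rotate_loop_simps [simp]:
  "top_index (rotate_loop z s) = top_index s" "chart (rotate_loop z s) = chart s"
  "arc (rotate_loop z s) i = (\<lambda>w. z * w) ` arc s i" "lft (rotate_loop z s) i w = lft s i (w / z)"
  "gl (rotate_loop z s) = gl s"
  by (simp_all add: rotate_loop_def)

lemma rotate_in_systems:
  assumes z: "z \<in> circle" and s: "s \<in> loop_systems X"
  shows "rotate_loop z s \<in> loop_systems X"
proof -
  have z0: "z \<noteq> 0" using z by auto
  have cont: "continuous_map (top_of_set ((\<lambda>w. z * w) ` arc s i)) (hat X (chart s i)) (\<lambda>w. lft s i (w / z))"
    if "i \<le> top_index s" for i
  proof -
    have "continuous_map (top_of_set ((\<lambda>w. z * w) ` arc s i)) (top_of_set (arc s i)) (\<lambda>w. w / z)"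
      using z0 by (auto simp: continuous_map_in_subtopology intro!: continuous_intros)
    then show ?thesis
      using continuous_map_compose loop_systemD(3)[OF s that] unfolding o_def by blast
  qed
  have mem: "w \<in> (\<lambda>w. z * w) ` arc s i \<longleftrightarrow> w / z \<in> arc s i" for w i
    using z0 by (auto intro!: image_eqI[of _ _ "w / z"])
  show ?thesis
    unfolding loop_systems_def is_loop_system_def mem_Collect_eq
  proof (intro conjI allI impI)
    show "cyclic_cover (top_index (rotate_loop z s)) (arc (rotate_loop z s))"
      using cyclic_cover_rotate[OF z loop_systemD(1)[OF s]] by (simp add: rotate_loop_def)
  next
    fix i assume i: "i \<le> top_index (rotate_loop z s)"
    show "chart (rotate_loop z s) i \<in> basic X"
      "gl (rotate_loop z s) i i = aut X (chart (rotate_loop z s) i) \<one>\<^bsub>grp X (chart (rotate_loop z s) i)\<^esub>"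
      using i loop_systemD(2,4)[OF s] by simp_all
    show "continuous_map (top_of_set (arc (rotate_loop z s) i)) (hat X (chart (rotate_loop z s) i))
        (lft (rotate_loop z s) i)"
      using cont i by (simp add: rotate_loop_def)
  next
    fix i j assume m: "meets (rotate_loop z s) i j"
    then obtain w where ij: "i \<le> top_index s" "j \<le> top_index s" "w \<in> arc s i" "w \<in> arc s j"
      unfolding meets_def using z0 by auto
    then show "gl (rotate_loop z s) j i \<in> Tran X (chart (rotate_loop z s) i) (chart (rotate_loop z s) j)"
      using loop_systemD(5)[OF s] by simp
    show "\<forall>t \<in> arc (rotate_loop z s) i \<inter> arc (rotate_loop z s) j.
        lft (rotate_loop z s) i t \<in> tdom X (chart (rotate_loop z s) i) (chart (rotate_loop z s) j)
          (gl (rotate_loop z s) j i) \<and>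
        lft (rotate_loop z s) j t = tmap X (chart (rotate_loop z s) i) (chart (rotate_loop z s) j)
          (gl (rotate_loop z s) j i) (lft (rotate_loop z s) i t) \<and>
        tcomp X (chart (rotate_loop z s) i) (chart (rotate_loop z s) j) (chart (rotate_loop z s) i)
          (gl (rotate_loop z s) i j) (gl (rotate_loop z s) j i) (lft (rotate_loop z s) i t)
          = aut X (chart (rotate_loop z s) i) \<one>\<^bsub>grp X (chart (rotate_loop z s) i)\<^esub>"
      unfolding rotate_loop_simps
    proof
      fix t assume "t \<in> (\<lambda>w. z * w) ` arc s i \<inter> (\<lambda>w. z * w) ` arc s j"
      then have "t / z \<in> arc s i" "t / z \<in> arc s j"
        unfolding Int_iff mem by simp_all
      then show "lft s i (t / z) \<in> tdom X (chart s i) (chart s j) (gl s j i) \<and>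
          lft s j (t / z) = tmap X (chart s i) (chart s j) (gl s j i) (lft s i (t / z)) \<and>
          tcomp X (chart s i) (chart s j) (chart s i) (gl s i j) (gl s j i) (lft s i (t / z))
            = aut X (chart s i) \<one>\<^bsub>grp X (chart s i)\<^esub>"
        using loop_systemD(5)[OF s ij(1,2)] by simp
    qed
  qed
qed

text \<open>Translating a flat section along the line does not change what closes it up after one turn.\<close>

lemma holonomy_rotate:
  assumes z: "z \<in> circle" and s: "s \<in> loop_systems X" and g: "has_holonomy s g"
  shows "has_holonomy (rotate_loop z s) g"
proof -
  obtain r where r: "z = circ r"
    using circ_surj[OF z] .
  have z0: "z \<noteq> 0" using r by simp
  have ct: "circ (t + - r) = circ t / z" for t
    using circ_diff[of t r] r by simp
  obtain \<sigma> where \<sigma>: "arr g" "src g = trg g" "is_cocycle (const_cocycle (src g))"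
    "morphism_on UNIV (const_cocycle (src g)) (loop_cocycle s) \<sigma>"
    "\<And>i t. i \<le> top_index s \<Longrightarrow> circ t \<in> arc s i \<Longrightarrow> \<sigma> i 0 (t + 1) = \<sigma> i 0 t \<cdot> g"
    using has_holonomyE[OF g] by metis
  have mem: "w \<in> (\<lambda>w. z * w) ` arc s i \<longleftrightarrow> w / z \<in> arc s i" for w i
    using z0 by (auto intro!: image_eqI[of _ _ "w / z"])
  have patch: "t \<in> patch (loop_cocycle (rotate_loop z s)) i \<longleftrightarrow> t + - r \<in> patch (loop_cocycle s) i" for i t
    unfolding patch_loop rotate_loop_simps mem ct ..
  have "morphism_on UNIV (const_cocycle (src g)) (loop_cocycle (rotate_loop z s)) (\<lambda>i k t. \<sigma> i k (t + - r))"
  proof (rule morphism_translate[OF \<sigma>(4) patch])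
    show "glue (loop_cocycle (rotate_loop z s)) j i t = glue (loop_cocycle s) j i (t + - r)" for i j t
      unfolding glue_loop rotate_loop_simps ct ..
  qed
  moreover have "\<sigma> i 0 (t + 1 + - r) = \<sigma> i 0 (t + - r) \<cdot> g"
    if "t \<in> patch (loop_cocycle (rotate_loop z s)) i" for i t
  proof -
    have "t + - r \<in> patch (loop_cocycle s) i"
      using that patch by blast
    then show ?thesis
      using \<sigma>(5)[of i "t + - r"] unfolding patch_loop by (simp add: algebra_simps)
  qed
  ultimately show ?thesis
    unfolding has_holonomy_def using \<sigma>(1,2) by blast
qed

end

section \<open>Constant loops closed up by a group element\<close>

lemma constant_loop_simps [simp]:
  "top_index (constant_loop X U y g) = 2"
  "arc (constant_loop X U y g) = (\<lambda>i. circ ` step_interval 3 i)"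
  "chart (constant_loop X U y g) = (\<lambda>i. U)" "lft (constant_loop X U y g) = (\<lambda>i t. y)"
  "gl (constant_loop X U y g) j i =
     (if j = 0 \<and> i = 2 then aut X U g
      else if j = 2 \<and> i = 0 then aut X U (inv\<^bsub>grp X U\<^esub> g) else aut X U \<one>\<^bsub>grp X U\<^esub>)"
  by (auto simp: constant_loop_def step_interval_def)

lemma conj_class_eq_iff:
  fixes G :: "'g monoid" (structure)
  assumes "group G" "x \<in> carrier G" "y \<in> carrier G"
  shows "conj_class G x = conj_class G y \<longleftrightarrow> (\<exists>h\<in>carrier G. h \<otimes> x = y \<otimes> h)"
proof -
  interpret group G by fact
  show ?thesis
  proof
    assume eq: "conj_class G x = conj_class G y"
    have "y = \<one> \<otimes> y \<otimes> inv \<one>"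
      using assms by simp
    then have "y \<in> conj_class G y"
      using one_closed unfolding conj_class_def by blast
    then have "y \<in> conj_class G x"
      unfolding eq .
    then obtain h where "h \<in> carrier G" "y = h \<otimes> x \<otimes> inv h"
      unfolding conj_class_def by blast
    then show "\<exists>h\<in>carrier G. h \<otimes> x = y \<otimes> h"
      using assms by (intro bexI[of _ h]) (simp_all add: m_assoc)
  next
    have sub: "conj_class G b \<subseteq> conj_class G a"
      if ab: "a \<in> carrier G" "b \<in> carrier G" "h \<in> carrier G" "h \<otimes> a = b \<otimes> h" for a b h
    proof
      fix z assume "z \<in> conj_class G b"
      then obtain k where k: "k \<in> carrier G" "z = k \<otimes> b \<otimes> inv k"
        unfolding conj_class_def by blast
      have b: "b = h \<otimes> a \<otimes> inv h"
        using ab by (simp add: m_assoc)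
      have "z = (k \<otimes> h) \<otimes> a \<otimes> inv (k \<otimes> h)"
        unfolding k(2) b using k(1) ab(1,3) by (simp add: m_assoc inv_mult_group)
      then show "z \<in> conj_class G a"
        unfolding conj_class_def using k ab by blast
    qed
    assume "\<exists>h\<in>carrier G. h \<otimes> x = y \<otimes> h"
    then obtain h where h: "h \<in> carrier G" "h \<otimes> x = y \<otimes> h" by blast
    have "inv h \<otimes> y = inv h \<otimes> (y \<otimes> h) \<otimes> inv h"
      using h assms by (simp add: m_assoc)
    also have "\<dots> = x \<otimes> inv h"
      unfolding h(2)[symmetric] using h(1) assms by (simp add: m_assoc[symmetric])
    finally have "inv h \<otimes> y = x \<otimes> inv h" .
    then show "conj_class G x = conj_class G y"
      using sub[OF assms(2,3) h] sub[OF assms(3,2) inv_closed[OF h(1)]] by blast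
  qed
qed

context orbispace
begin

lemma isotropy_group:
  assumes "point A"
  shows "group (isotropy X (fst A) (snd A))"
proof -
  interpret group_action "grp X (fst A)" "topspace (hat X (fst A))" "hact X (fst A)"
    using chart_action assms unfolding point_def by blast
  show ?thesis
    unfolding isotropy_def
    using subgroup.subgroup_is_group[OF stabilizer_subgroup] assms group_hom group_hom.axioms(1)
    unfolding point_def by blast
qed

lemma isotropy_iff:
  "g \<in> carrier (isotropy X (fst A) (snd A)) \<longleftrightarrow>
     g \<in> carrier (grp X (fst A)) \<and> trg (aut_germ A g) = A"
  unfolding isotropy_def stabilizer_def trg_aut_germ by (simp add: prod_eq_iff)

lemma constant_loop_in_systems:
  assumes A: "point A" and g: "g \<in> carrier (isotropy X (fst A) (snd A))"
  shows "constant_loop X (fst A) (snd A) g \<in> loop_systems X" (is "?s \<in> _")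
proof -
  let ?a = "fst A" and ?y = "snd A"
  interpret G: group "grp X ?a"
    using chart_group A unfolding point_def by blast
  interpret I: group "isotropy X ?a ?y"
    using isotropy_group[OF A] .
  have subI: "carrier (isotropy X ?a ?y) \<subseteq> carrier (grp X ?a)"
    using isotropy_iff by blast
  interpret group_action "grp X ?a" "topspace (hat X ?a)" "hact X ?a"
    using chart_action A unfolding point_def by blast
  define h where "h = (\<lambda>j i. if j = (0::nat) \<and> i = (2::nat) then g
      else if j = 2 \<and> i = 0 then inv\<^bsub>grp X ?a\<^esub> g else \<one>\<^bsub>grp X ?a\<^esub>)"
  have gl: "gl ?s j i = aut X ?a (h j i)" for i j
    by (simp add: h_def)
  have "inv\<^bsub>grp X ?a\<^esub> g \<in> carrier (isotropy X ?a ?y)"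
    using stabilizer_m_inv_closed[of ?y g] g A unfolding isotropy_def point_def by simp
  moreover have "\<one>\<^bsub>grp X ?a\<^esub> \<in> carrier (isotropy X ?a ?y)"
    using stabilizer_one_closed[of ?y] A unfolding isotropy_def point_def by simp
  ultimately have h: "h j i \<in> carrier (isotropy X ?a ?y)" for i j
    using g by (simp add: h_def)
  have hG: "h j i \<in> carrier (grp X ?a)" and hA: "trg (aut_germ A (h j i)) = A" for i j
    using h isotropy_iff by blast+
  have inv: "h i j \<otimes>\<^bsub>grp X ?a\<^esub> h j i = \<one>\<^bsub>grp X ?a\<^esub>" for i j
    using g subI by (auto simp: h_def)
  have arr: "arr (aut_germ A (h j i))" for i j
    using A hG by simp
  have comp: "aut_germ A (h i j) \<cdot> aut_germ A (h j i) = unit A" for i j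
    using comp_aut_germ[OF A hG hG, of A] hA inv aut_germ_one[OF A] by simp
  show ?thesis
    unfolding loop_systems_def is_loop_system_def mem_Collect_eq
  proof (intro conjI allI impI ballI)
    show "cyclic_cover (top_index ?s) (arc ?s)"
      using regular_cyclic_cover[of 3] by simp
    show "chart ?s i \<in> basic X" "continuous_map (top_of_set (arc ?s i)) (hat X (chart ?s i)) (lft ?s i)"
      "gl ?s i i = aut X (chart ?s i) \<one>\<^bsub>grp X (chart ?s i)\<^esub>" for i
      using A unfolding point_def by auto
    fix i j
    note d = arrD(6-8)[OF arr, of j i, unfolded hA, unfolded aut_germ_def, simplified]
    show "gl ?s j i \<in> Tran X (chart ?s i) (chart ?s j)"
      using d(1) unfolding gl by simp
    fix t
    show "lft ?s i t \<in> tdom X (chart ?s i) (chart ?s j) (gl ?s j i)"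
      "lft ?s j t = tmap X (chart ?s i) (chart ?s j) (gl ?s j i) (lft ?s i t)"
      using d(2,3) unfolding gl by simp_all
    show "tcomp X (chart ?s i) (chart ?s j) (chart ?s i) (gl ?s i j) (gl ?s j i) (lft ?s i t) =
        aut X (chart ?s i) \<one>\<^bsub>grp X (chart ?s i)\<^esub>"
      using arg_cong[OF comp[of i j], of label] hA unfolding gl
      by (simp add: comp_def unit_def) (simp add: aut_germ_def)
  qed
qed

text \<open>The section that starts as \<open>m\<close> on the first arc stays \<open>m\<close> on the next two and returns to the
  first arc as \<open>g \<circ> m\<close>.\<close>

lemma constant_loop_holonomy:
  assumes A: "point A" and g: "g \<in> carrier (isotropy X (fst A) (snd A))"
  shows "has_holonomy (constant_loop X (fst A) (snd A) g) (aut_germ A g)"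
proof -
  let ?s = "constant_loop X (fst A) (snd A) g"
  let ?D = "loop_cocycle ?s"
  have s: "?s \<in> loop_systems X"
    using constant_loop_in_systems[OF A g] .
  have gA: "g \<in> carrier (grp X (fst A))" "trg (aut_germ A g) = A"
    using g isotropy_iff by blast+
  obtain q where q: "has_holonomy ?s q"
    by (rule holonomy_of_const_lifts[OF s]) auto
  obtain \<sigma> where \<sigma>: "arr q" "src q = trg q" "is_cocycle (const_cocycle (src q))"
    "morphism_on UNIV (const_cocycle (src q)) ?D \<sigma>"
    "\<And>i t. i \<le> top_index ?s \<Longrightarrow> circ t \<in> arc ?s i \<Longrightarrow> \<sigma> i 0 (t + 1) = \<sigma> i 0 t \<cdot> q"
    using has_holonomyE[OF q] by metis
  have patch: "t \<in> patch ?D i" if "i \<le> 2" "t + of_int m \<in> step_interval 3 i" for t i m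
    using that circ_image_iff by auto
  have sec: "arr (\<sigma> i 0 t)" "src (\<sigma> i 0 t) = src q" "trg (\<sigma> i 0 t) = A" "flat_at (\<sigma> i 0) t"
    if "t \<in> patch ?D i" for i t
    using morphism_onD(1-4)[OF \<sigma>(4) UNIV_I _ that, of 0] by simp_all
  have stay: "\<sigma> i 0 t' = \<sigma> i 0 t"
    if "i \<le> 2" "t \<in> step_interval 3 i" "t' \<in> step_interval 3 i" for i t t'
  proof -
    have p: "r \<in> patch ?D i" if "r \<in> step_interval 3 i" for r
      using patch[of i r 0] that \<open>i \<le> 2\<close> by simp
    have "label (\<sigma> i 0 t') = label (\<sigma> i 0 t)"
    proof (rule flat_label_constant[OF _ _ that(2,3)])
      show "connected (step_interval 3 i)"
        unfolding step_interval_def by simp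
    qed (use sec(4) p in blast)
    then show ?thesis
      using sec p that by (intro germ.expand) simp
  qed
  have jump: "glue ?D j i t \<cdot> \<sigma> i 0 t = \<sigma> j 0 t" if "t \<in> patch ?D i" "t \<in> patch ?D j" for i j t
    using morphism_onD(6)[OF \<sigma>(4) UNIV_I _ that, of 0] by simp
  have gu: "glue ?D 1 0 t = unit A" "glue ?D 2 1 t = unit A" "glue ?D 0 2 t = aut_germ A g" for t
    using gA(2) by (auto simp: glue_loop unit_def aut_germ_def)
  \<comment> \<open>Sample points: \<open>5/12\<close>, \<open>3/4\<close> and \<open>13/12\<close> lie in the overlaps of consecutive arcs, and \<open>1/12\<close> is the
    translate of the last one into the interval of the first arc.\<close>
  let ?m = "\<sigma> 0 0 (1/12)"
  have p: "1/12 \<in> patch ?D 0" "5/12 \<in> patch ?D 0" "5/12 \<in> patch ?D 1" "3/4 \<in> patch ?D 1"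
    "3/4 \<in> patch ?D 2" "13/12 \<in> patch ?D 2" "13/12 \<in> patch ?D 0"
    using patch[of 0 "1/12" 0] patch[of 0 "5/12" 0] patch[of 1 "5/12" 0] patch[of 1 "3/4" 0]
      patch[of 2 "3/4" 0] patch[of 2 "13/12" 0] patch[of 0 "13/12" "-1"]
    by (simp_all add: step_interval_def)
  have "\<sigma> 0 0 (5/12) = ?m" "\<sigma> 1 0 (3/4) = \<sigma> 1 0 (5/12)" "\<sigma> 2 0 (13/12) = \<sigma> 2 0 (3/4)"
    using stay[of 0 "1/12" "5/12"] stay[of 1 "5/12" "3/4"] stay[of 2 "3/4" "13/12"]
    by (simp_all add: step_interval_def)
  moreover have "\<sigma> 1 0 (5/12) = \<sigma> 0 0 (5/12)" "\<sigma> 2 0 (3/4) = \<sigma> 1 0 (3/4)"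
    "\<sigma> 0 0 (13/12) = aut_germ A g \<cdot> \<sigma> 2 0 (13/12)"
    using jump[OF p(2,3)] jump[OF p(4,5)] jump[OF p(6,7)] sec[OF p(2)] sec[OF p(4)] gu by simp_all
  ultimately have turn: "\<sigma> 0 0 (13/12) = aut_germ A g \<cdot> ?m"
    by simp
  have "\<sigma> 0 0 (1/12 + 1) = ?m \<cdot> q"
    using \<sigma>(5)[of 0 "1/12"] p(1) by simp
  then have mq: "?m \<cdot> q = aut_germ A g \<cdot> ?m"
    using turn by simp
  note m = sec[OF p(1)]
  have ag: "arr (aut_germ A g)"
    using A gA by simp
  have "has_holonomy ?s (inverse_germ (inverse_germ ?m) \<cdot> q \<cdot> inverse_germ ?m)"
    using holonomy_change_base[OF s q, of "inverse_germ ?m"] m by simp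
  moreover have "inverse_germ (inverse_germ ?m) = ?m"
    using inverse_unique[of "inverse_germ ?m" ?m] m by simp
  moreover have "?m \<cdot> q \<cdot> inverse_germ ?m = (?m \<cdot> q) \<cdot> inverse_germ ?m"
    using m \<sigma>(1,2) by (simp add: comp_assoc)
  moreover have "\<dots> = aut_germ A g"
    unfolding mq using m ag by (simp add: comp_assoc)
  ultimately show ?thesis
    by simp
qed

lemma constant_loop_equiv_iff:
  assumes A: "point A" "g \<in> carrier (isotropy X (fst A) (snd A))"
    and B: "point B" "h \<in> carrier (isotropy X (fst B) (snd B))"
  shows "loop_equiv (constant_loop X (fst A) (snd A) g) (constant_loop X (fst B) (snd B) h) \<longleftrightarrow>
    (\<exists>k. arr k \<and> src k = A \<and> trg k = B \<and> k \<cdot> aut_germ A g = aut_germ B h \<cdot> k)"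
    (is "loop_equiv ?s ?u \<longleftrightarrow> _")
proof
  note s = constant_loop_in_systems[OF A] and u = constant_loop_in_systems[OF B]
  note hs = constant_loop_holonomy[OF A] and hu = constant_loop_holonomy[OF B]
  show "\<exists>k. arr k \<and> src k = A \<and> trg k = B \<and> k \<cdot> aut_germ A g = aut_germ B h \<cdot> k" if "loop_equiv ?s ?u"
    using holonomy_unique[OF u holonomy_of_equiv[OF s u hs that] hu] src_aut_germ by metis
  assume "\<exists>k. arr k \<and> src k = A \<and> trg k = B \<and> k \<cdot> aut_germ A g = aut_germ B h \<cdot> k"
  then obtain k where k: "arr k" "src k = A" "trg k = B" "k \<cdot> aut_germ A g = aut_germ B h \<cdot> k"
    by blast
  have ag: "arr (aut_germ A g)" "trg (aut_germ A g) = A"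
    using A isotropy_iff by auto
  have "inverse_germ k \<cdot> aut_germ B h \<cdot> k = aut_germ A g"
    unfolding k(4)[symmetric] using k(1-3) ag by simp
  then have "has_holonomy ?u (aut_germ A g)"
    using holonomy_change_base[OF u hu, of k] k by simp
  then show "loop_equiv ?s ?u"
    using equiv_of_same_holonomy[OF s u hs] by blast
qed

section \<open>Loops that are fixed by all rotations\<close>

lemma rotate_loop_inverse:
  assumes "z \<noteq> 0"
  shows "rotate_loop z (rotate_loop (1 / z) u) = u"
proof -
  have "(\<lambda>w. z * w) ` (\<lambda>w. 1 / z * w) ` J = J" for J
    using assms by (simp add: image_image)
  then show ?thesis
    using assms by (cases u) (simp add: rotate_loop_def)
qed

text \<open>All rotations of all systems of the class have the same holonomy \<open>g\<close>, hence are equivalent to \<open>s\<close>.\<close>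

lemma rotation_fixed_of_holonomy:
  assumes s: "s \<in> loop_systems X" and g: "has_holonomy s g"
  shows "free_loop X s \<in> rotation_fixed X"
proof -
  have rot: "rotate_loop z u \<in> free_loop X s" if z: "z \<in> circle" and u: "u \<in> free_loop X s" for z u
  proof -
    have u': "u \<in> loop_systems X" "loop_equiv s u"
      using u mem_free_loop by blast+
    have r: "rotate_loop z u \<in> loop_systems X"
      using rotate_in_systems[OF z u'(1)] .
    have "has_holonomy (rotate_loop z u) g"
      using holonomy_rotate[OF z u'(1) holonomy_of_equiv[OF s u'(1) g u'(2)]] .
    then show ?thesis
      unfolding mem_free_loop using equiv_of_same_holonomy[OF s r g] s r by blast
  qed
  have "rotate_loop z ` free_loop X s = free_loop X s" if z: "z \<in> circle" for z
  proof
    show "rotate_loop z ` free_loop X s \<subseteq> free_loop X s"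
      using rot[OF z] by blast
    have z0: "z \<noteq> 0" "1 / z \<in> circle"
      using z by (auto simp: norm_divide)
    show "free_loop X s \<subseteq> rotate_loop z ` free_loop X s"
      using rot[OF z0(2)] rotate_loop_inverse[OF z0(1)] by (metis image_eqI subsetI)
  qed
  moreover have "free_loop X s \<in> free_loops X"
    unfolding free_loops_def free_loop_def using s by (rule quotientI)
  ultimately show ?thesis
    unfolding rotation_fixed_def by blast
qed

text \<open>An equivalence of a system with its rotations preserves the underlying points, so that all
  lifts on an arc lie over one point. Its fibre is a finite orbit, hence discrete, and an arc is
  connected.\<close>

lemma rotation_fixed_const_lifts:
  assumes s: "s \<in> loop_systems X" and rot: "\<And>z. z \<in> circle \<Longrightarrow> loop_equiv s (rotate_loop z s)"
    and fin: "finite (carrier (grp X (chart s i)))" and t1: "t1_space (hat X (chart s i))"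
    and i: "i \<le> top_index s" and w: "w \<in> arc s i" "w' \<in> arc s i"
  shows "lft s i w = lft s i w'"
proof -
  let ?a = "chart s i"
  have sub: "arc s i \<subseteq> circle"
    using open_arc_sub_circle cyclic_coverD(1)[OF loop_systemD(1)[OF s] i] .
  have pt: "point (?a, lft s i v)" if v: "v \<in> arc s i" for v
  proof -
    obtain t where "v = circ t"
      using circ_surj v sub by blast
    then show ?thesis
      using is_cocycleD(8)[OF is_cocycle_loop[OF s], of t i] i v by simp
  qed
  have foot: "foot (?a, lft s i v) = foot (?a, lft s i w)" if v: "v \<in> arc s i" for v
  proof -
    have n: "norm w = 1" "norm v = 1"
      using sub w v by auto
    then have z: "v / w \<in> circle" and nz: "w \<noteq> 0" "v \<noteq> 0"
      by (auto simp: norm_divide)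
    obtain t where t: "v = circ t"
      using circ_surj v sub by blast
    obtain H where H: "morphism_on UNIV (loop_cocycle s) (loop_cocycle (rotate_loop (v / w) s)) H"
      using rot[OF z] unfolding loop_equiv_def periodic_morphism_def by blast
    have p: "t \<in> patch (loop_cocycle s) i"
      using v t i by simp
    have "v = v / w * w"
      using nz by simp
    then have "v \<in> (\<lambda>x. v / w * x) ` arc s i"
      using w(1) by blast
    then have p': "t \<in> patch (loop_cocycle (rotate_loop (v / w) s)) i"
      unfolding patch_loop rotate_loop_simps using t i by simp
    note h = morphism_onD[OF H UNIV_I p p']
    have "src (H i i t) = (?a, lft s i v)" "trg (H i i t) = (?a, lft s i w)"
      using h(3,4) t nz by simp_all
    then show ?thesis
      using arrD(3)[OF h(1)] by simp
  qed
  let ?F = "(\<lambda>g. hact X ?a g (lft s i w)) ` carrier (grp X ?a)"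
  have F: "lft s i ` arc s i \<subseteq> ?F"
  proof
    fix y assume "y \<in> lft s i ` arc s i"
    then obtain v where v: "v \<in> arc s i" "y = lft s i v" by blast
    obtain g where g: "g \<in> carrier (grp X ?a)" "trg (aut_germ (?a, lft s i w) g) = (?a, lft s i v)"
      using germ_over_chart[OF pt[OF w(1)] pt[OF v(1)]] foot[OF v(1)] by auto
    then show "y \<in> ?F"
      using v(2) by (intro image_eqI[OF _ g(1)]) (simp add: trg_aut_germ)
  qed
  let ?S = "lft s i ` arc s i"
  have finS: "finite ?S"
    using F fin finite_subset by blast
  have "connectedin (top_of_set (arc s i)) (arc s i)"
    using open_arc_connected[OF cyclic_coverD(1)[OF loop_systemD(1)[OF s] i]]
    by (simp add: connectedin_subtopology)
  then have "connectedin (hat X ?a) ?S"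
    using connectedin_continuous_map_image[OF loop_systemD(3)[OF s i]] by blast
  moreover have "subtopology (hat X ?a) ?S = discrete_topology (topspace (hat X ?a) \<inter> ?S)"
    using subtopology_eq_discrete_topology_gen_finite[OF t1 finS] .
  ultimately have "connected_space (discrete_topology (topspace (hat X ?a) \<inter> ?S))"
    unfolding connectedin_def by simp
  then obtain c where c: "topspace (hat X ?a) \<inter> ?S \<subseteq> {c}"
    unfolding connected_space_discrete_topology by blast
  have "lft s i v = c" if "v \<in> arc s i" for v
    using pt[OF that] that c unfolding point_def by auto
  then show ?thesis
    using w by simp
qed

end

theorem proposition3p5p3:
  fixes X :: "('x, 'y, 'g, 't) orbi"
    and U :: "'x \<Rightarrow> 'x set" and e :: "'x \<Rightarrow> 'y"
  assumes "orbispace X"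
    and "\<And>V. V \<in> basic X \<Longrightarrow> finite (carrier (grp X V))"
    and "\<And>V. V \<in> basic X \<Longrightarrow> t1_space (hat X V)"
    and "lift_choice X U e"
  shows "\<exists>F. bij_betw F (inertia X U e) (rotation_fixed X) \<and>
           (\<forall>p \<in> topspace (space_of X). \<forall>g \<in> carrier (isotropy X (U p) (e p)).
              F (p, conj_class (isotropy X (U p) (e p)) g) =
                free_loop X (constant_loop X (U p) (e p) g))"
proof -
  interpret orbispace X by fact
  let ?I = "\<lambda>p. isotropy X (U p) (e p)"
  let ?L = "\<lambda>p g. free_loop X (constant_loop X (U p) (e p) g)"
  let ?A = "\<lambda>p. (U p, e p)"
  have A: "point (?A p)" "foot (?A p) = p" if "p \<in> topspace (space_of X)" for p
    using assms(4) that unfolding lift_choice_def point_def foot_def by auto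
  note const = constant_loop_in_systems[OF A(1), simplified]
    and hol = constant_loop_holonomy[OF A(1), simplified]
  have eq: "?L p g = ?L q h \<longleftrightarrow> p = q \<and> conj_class (?I p) g = conj_class (?I q) h"
    if p: "p \<in> topspace (space_of X)" "g \<in> carrier (?I p)"
      and q: "q \<in> topspace (space_of X)" "h \<in> carrier (?I q)" for p q g h
  proof -
    have gG: "g \<in> carrier (grp X (U p))" "trg (aut_germ (?A p) g) = ?A p"
      using isotropy_iff[of g "?A p"] p by simp_all
    have "?L p g = ?L q h \<longleftrightarrow> loop_equiv (constant_loop X (U p) (e p) g) (constant_loop X (U q) (e q) h)"
      using free_loop_eq_iff[OF const[OF p] const[OF q]] .
    also have "\<dots> \<longleftrightarrow> (\<exists>k. arr k \<and> src k = ?A p \<and> trg k = ?A q \<and>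
        k \<cdot> aut_germ (?A p) g = aut_germ (?A q) h \<cdot> k)"
      using constant_loop_equiv_iff[OF A(1)[OF p(1)] _ A(1)[OF q(1)], simplified, OF p(2) q(2)] .
    also have "\<dots> \<longleftrightarrow> p = q \<and> (\<exists>k\<in>carrier (?I p). k \<otimes>\<^bsub>?I p\<^esub> g = h \<otimes>\<^bsub>?I p\<^esub> k)" (is "?l \<longleftrightarrow> ?r")
    proof
      assume ?l
      then obtain k where k: "arr k" "src k = ?A p" "trg k = ?A q"
        "k \<cdot> aut_germ (?A p) g = aut_germ (?A q) h \<cdot> k" by blast
      have pq: "p = q"
        using arrD(3)[OF k(1)] k A(2) p q by simp
      obtain c where c: "c \<in> carrier (grp X (U p))" "k = aut_germ (?A p) c"
        using vertex_germ[OF k(1)] k(2,3) pq by auto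
      have hG: "h \<in> carrier (grp X (U p))"
        using isotropy_iff[of h "?A p"] q pq by simp
      have cI: "c \<in> carrier (?I p)"
        using isotropy_iff[of c "?A p"] c k(3) pq by simp
      interpret G: group "grp X (U p)"
        using chart_group A(1)[OF p(1)] unfolding point_def by simp
      have "aut_germ (?A p) (c \<otimes>\<^bsub>grp X (U p)\<^esub> g) = aut_germ (?A p) (h \<otimes>\<^bsub>grp X (U p)\<^esub> c)"
        using comp_aut_germ[OF A(1)[OF p(1)], of c g "?A p"] comp_aut_germ[OF A(1)[OF p(1)], of h c "?A p"]
          k(3,4) c gG hG pq by simp
      then have "c \<otimes>\<^bsub>grp X (U p)\<^esub> g = h \<otimes>\<^bsub>grp X (U p)\<^esub> c"
        using aut_germ_inj[OF A(1)[OF p(1)]] c(1) gG(1) hG by simp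
      then show ?r
        using pq cI by (auto simp: isotropy_def)
    next
      assume ?r
      then obtain c where pq: "p = q" and c: "c \<in> carrier (?I p)" "c \<otimes>\<^bsub>?I p\<^esub> g = h \<otimes>\<^bsub>?I p\<^esub> c"
        by blast
      have cG: "c \<in> carrier (grp X (U p))" "trg (aut_germ (?A p) c) = ?A p"
        using isotropy_iff[of c "?A p"] c by simp_all
      have hG: "h \<in> carrier (grp X (U p))"
        using isotropy_iff[of h "?A p"] q pq by simp
      have "aut_germ (?A p) c \<cdot> aut_germ (?A p) g = aut_germ (?A p) h \<cdot> aut_germ (?A p) c"
        using comp_aut_germ[OF A(1)[OF p(1)], of c g "?A p"] comp_aut_germ[OF A(1)[OF p(1)], of h c "?A p"]
          c(2) cG gG hG by (simp add: isotropy_def)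
      then show ?l
        using cG pq A(1)[OF p(1)] by (intro exI[of _ "aut_germ (?A p) c"]) simp
    qed
    also have "\<dots> \<longleftrightarrow> p = q \<and> conj_class (?I p) g = conj_class (?I q) h"
      using conj_class_eq_iff[OF isotropy_group[OF A(1)[OF p(1)]], simplified, OF p(2), of h] q
      by auto
    finally show ?thesis .
  qed
  \<comment> \<open>Any representative of the conjugacy class may be taken.\<close>
  define F where "F = (\<lambda>(p, c). ?L p (SOME g. g \<in> carrier (?I p) \<and> conj_class (?I p) g = c))"
  have F: "F (p, conj_class (?I p) g) = ?L p g"
    if p: "p \<in> topspace (space_of X)" "g \<in> carrier (?I p)" for p g
  proof -
    let ?g = "SOME g'. g' \<in> carrier (?I p) \<and> conj_class (?I p) g' = conj_class (?I p) g"
    have "?g \<in> carrier (?I p) \<and> conj_class (?I p) ?g = conj_class (?I p) g"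
      using p(2) by (intro someI_ex[of "\<lambda>g'. g' \<in> carrier (?I p) \<and> conj_class (?I p) g' = conj_class (?I p) g"]) blast
    then show ?thesis
      unfolding F_def using eq[OF p(1) _ p, of ?g] by simp
  qed
  have "inj_on F (inertia X U e)"
  proof (rule inj_onI)
    fix x y assume "x \<in> inertia X U e" "y \<in> inertia X U e" and xy: "F x = F y"
    then obtain p g q h
      where x: "x = (p, conj_class (?I p) g)" "p \<in> topspace (space_of X)" "g \<in> carrier (?I p)"
        and y: "y = (q, conj_class (?I q) h)" "q \<in> topspace (space_of X)" "h \<in> carrier (?I q)"
      unfolding inertia_def by blast
    have "?L p g = ?L q h"
      using xy F[OF x(2,3)] F[OF y(2,3)] x(1) y(1) by simp
    then have "p = q \<and> conj_class (?I p) g = conj_class (?I q) h"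
      using eq[OF x(2,3) y(2,3)] by blast
    then show "x = y"
      unfolding x(1) y(1) prod.inject .
  qed
  moreover have "F ` inertia X U e = rotation_fixed X"
  proof (intro subset_antisym subsetI)
    fix L assume "L \<in> F ` inertia X U e"
    then obtain p g where "p \<in> topspace (space_of X)" "g \<in> carrier (?I p)" "L = ?L p g"
      using F unfolding inertia_def by auto
    then show "L \<in> rotation_fixed X"
      using rotation_fixed_of_holonomy[OF const hol] by blast
  next
    fix L assume L: "L \<in> rotation_fixed X"
    then obtain s where s: "s \<in> loop_systems X" "L = free_loop X s"
      unfolding rotation_fixed_def free_loops_def free_loop_def by (auto elim: quotientE)
    have sL: "s \<in> L"
      unfolding s(2) mem_free_loop using s(1) loop_equiv_refl by blast
    have rot: "loop_equiv s (rotate_loop z s)" if "z \<in> circle" for z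
    proof -
      have "rotate_loop z s \<in> L"
        using L that sL unfolding rotation_fixed_def by blast
      then show ?thesis
        unfolding s(2) mem_free_loop by blast
    qed
    \<comment> \<open>The lifts are constant, so there is a holonomy germ; it is moved to the chosen lift of its foot,
      where it is an element of the isotropy group.\<close>
    obtain k where k: "has_holonomy s k"
    proof (rule holonomy_of_const_lifts[OF s(1)])
      show "lft s i w = lft s i w'" if "i \<le> top_index s" "w \<in> arc s i" "w' \<in> arc s i" for i w w'
        using rotation_fixed_const_lifts[OF s(1) rot] assms(2,3) loop_systemD(2)[OF s(1)] that by blast
    qed
    have k': "arr k" "src k = trg k"
      using k unfolding has_holonomy_def by blast+
    define p where "p = foot (src k)"
    have pS: "point (src k)"
      using arrD(1)[OF k'(1)] .
    then have p: "p \<in> topspace (space_of X)"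
      using chart_proj_in basic_connected openin_subset unfolding p_def point_def foot_def by blast
    obtain j where j: "arr j" "src j = ?A p" "trg j = src k"
      using germ_between[OF A(1)[OF p] pS] A(2)[OF p] p_def by auto
    let ?q = "inverse_germ j \<cdot> k \<cdot> j"
    have q: "has_holonomy s ?q"
      using holonomy_change_base[OF s(1) k j(1,3)] .
    have arq: "arr ?q" "src ?q = ?A p" "trg ?q = ?A p"
      using j k' by simp_all
    then obtain g where g: "g \<in> carrier (grp X (U p))" "?q = aut_germ (?A p) g"
      using vertex_germ[OF arq(1)] by auto
    have gI: "g \<in> carrier (?I p)"
      using isotropy_iff[of g "?A p"] g arq(3) by simp
    have "loop_equiv s (constant_loop X (U p) (e p) g)"
      using equiv_of_same_holonomy[OF s(1) const[OF p gI] q] hol[OF p gI] g(2) by simp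
    then have "L = ?L p g"
      using free_loop_eq_iff[OF s(1) const[OF p gI]] s(2) by simp
    then have "L = F (p, conj_class (?I p) g)"
      using F[OF p gI] by simp
    moreover have "(p, conj_class (?I p) g) \<in> inertia X U e"
      unfolding inertia_def using p gI by blast
    ultimately show "L \<in> F ` inertia X U e"
      by (rule image_eqI)
  qed
  ultimately have "bij_betw F (inertia X U e) (rotation_fixed X)"
    unfolding bij_betw_def by blast
  then show ?thesis
    using F by (intro exI[of _ F]) blast
qed

end
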